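(* Let $\Sigma\subseteq\mathbb{R}^n$ be a Jordan surface with rectifiable boundary $\Gamma$, and let $f:\mathbb{U}\to\Sigma$ be a harmonic homeomorphism of the unit disk onto $\Sigma$ (that is, onto $\Sigma\setminus\Gamma$). Then: (1) There exists a function $\phi:\mathbb{T}\to\Gamma$ of bounded variation, with at most countably many points of discontinuity, at each of which it has a left and a right limit, such that $f=P[\phi]$. (2) If $\Gamma$ does not contain any (nondegenerate straight line) segment, then $f$ has a continuous extension up to the boundary, i.e. to $\overline{\mathbb{U}}$. (3) If $e^{is}$ is a point of discontinuity of $\phi$ (with $\phi$ as in (1)), then the limits $A_0=\lim_{t\uparrow s}\phi(e^{it})$ and $B_0=\lim_{t\downarrow s}\phi(e^{it})$ exist and $$C_{\mathbb{U}}(f,e^{is})=[A_0,B_0]\subseteq\Gamma .$$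
   Context: $\mathbb{U}=\{z\in\mathbb{C}:|z|<1\}$ is the unit disk and $\mathbb{T}$ is the unit circle. A Jordan surface $\Sigma\subseteq\mathbb{R}^n$ is a set of the form $\Sigma=\Phi(\overline{\mathbb{U}})$, where $\Phi$ is a homeomorphism of the closed unit disk onto its image; its boundary is the Jordan curve $\Gamma=\partial\Sigma=\Phi(\mathbb{T})$. A homeomorphism of $\mathbb{U}$ onto the Jordan surface $\Sigma$ means a homeomorphism of $\mathbb{U}$ onto $\Phi(\mathbb{U})=\Sigma\setminus\Gamma$. A mapping $f=(f^1,\dots,f^n):\mathbb{U}\to\mathbb{R}^n$ is harmonic if each $f^j$ is a harmonic function. For a bounded measurable $F:\mathbb{T}\to\mathbb{R}^n$ the Poisson integral is $$P[F](re^{i\theta})=\int_0^{2\pi}P(r,t-\theta)F(e^{it})\,dt,\qquad P(r,t)=\frac{1-r^2}{2\pi(1-2r\cos t+r^2)},\quad 0\le r<1.$$ For $\zeta\in\mathbb{T}$, the cluster set $C_{\mathbb{U}}(f,\zeta)$ is the set of all $\alpha$ for which there is a sequence $(z_n)\subseteq\mathbb{U}$ with $z_n\to\zeta$ and $f(z_n)\to\alpha$. $[A_0,B_0]$ denotes the closed line segment in $\mathbb{R}^n$ with endpoints $A_0,B_0$. *)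

theory Defs
  imports "HOL-Analysis.Analysis"
begin

(* Twice continuously differentiable with vanishing Laplacian, where the complex plane is
   identified with the real plane. The functions u1, u2 are the first partial derivatives of u
   in the directions 1 and \<i>, and u11, u12, u21, u22 those of u1 and u2. *)
definition harmonic_on :: "(complex \<Rightarrow> real) \<Rightarrow> complex set \<Rightarrow> bool" where
  "harmonic_on u S \<longleftrightarrow> open S \<and>
    (\<exists>u1 u2 u11 u12 u21 u22.
      (\<forall>z\<in>S.
        (u has_derivative (\<lambda>h. u1 z * Re h + u2 z * Im h)) (at z) \<and>
        (u1 has_derivative (\<lambda>h. u11 z * Re h + u12 z * Im h)) (at z) \<and>
        (u2 has_derivative (\<lambda>h. u21 z * Re h + u22 z * Im h)) (at z) \<and>
        u11 z + u22 z = 0) \<and>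
      continuous_on S u11 \<and> continuous_on S u12 \<and> continuous_on S u21 \<and> continuous_on S u22)"

definition bounded_variation_on :: "(real \<Rightarrow> 'a::metric_space) \<Rightarrow> real \<Rightarrow> real \<Rightarrow> bool" where
  "bounded_variation_on g a b \<longleftrightarrow>
    (\<exists>B. \<forall>n (x :: nat \<Rightarrow> real). mono_on {..n} x \<and> x ` {..n} \<subseteq> {a..b} \<longrightarrow>
      (\<Sum>i<n. dist (g (x i)) (g (x (Suc i)))) \<le> B)"

(* The length of a Jordan curve does not depend on the choice of the parametrization. *)
definition rectifiable_jordan_curve :: "'a::metric_space set \<Rightarrow> bool" where
  "rectifiable_jordan_curve \<Gamma> \<longleftrightarrow>
    (\<exists>\<gamma>. simple_path \<gamma> \<and> pathfinish \<gamma> = pathstart \<gamma> \<and> path_image \<gamma> = \<Gamma> \<and>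
      bounded_variation_on \<gamma> 0 1)"

definition jordan_surface_param :: "(complex \<Rightarrow> 'a::topological_space) \<Rightarrow> 'a set \<Rightarrow> bool" where
  "jordan_surface_param \<Phi> \<Sigma> \<longleftrightarrow> (\<exists>\<Psi>. homeomorphism (cball 0 1) \<Sigma> \<Phi> \<Psi>)"

definition poisson_kernel :: "real \<Rightarrow> real \<Rightarrow> real" where
  "poisson_kernel r t = (1 - r\<^sup>2) / (2 * pi * (1 - 2 * r * cos t + r\<^sup>2))"

definition poisson_integral :: "(complex \<Rightarrow> 'a::euclidean_space) \<Rightarrow> complex \<Rightarrow> 'a" where
  "poisson_integral F z =
    (LINT t:{0..2*pi}|lebesgue. poisson_kernel (cmod z) (t - Arg z) *\<^sub>R F (cis t))"

lemma poisson_integral_rcis: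
  assumes "0 \<le> r"
  shows "poisson_integral F (rcis r \<theta>) =
    (LINT t:{0..2*pi}|lebesgue. poisson_kernel r (t - \<theta>) *\<^sub>R F (cis t))"
proof (cases "r = 0")
  case True
  then show ?thesis by (simp add: poisson_integral_def poisson_kernel_def)
next
  case False
  with assms have r: "r > 0" by simp
  let ?z = "rcis r \<theta>"
  have "cis (Arg ?z) = sgn ?z" using r by (intro cis_Arg) simp
  also have "sgn ?z = cis \<theta>" using r by (simp add: sgn_div_norm rcis_def norm_mult scaleR_conv_of_real)
  finally have *: "cos (Arg ?z) = cos \<theta>" "sin (Arg ?z) = sin \<theta>"
    by (simp_all add: complex_eq_iff)
  have "cos (t - Arg ?z) = cos (t - \<theta>)" for t by (simp add: cos_diff *)
  then show ?thesis using r by (simp add: poisson_integral_def poisson_kernel_def)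
qed

definition cluster_set :: "(complex \<Rightarrow> 'a::topological_space) \<Rightarrow> complex \<Rightarrow> 'a set" where
  "cluster_set f \<zeta> =
    {\<alpha>. \<exists>z :: nat \<Rightarrow> complex. (\<forall>n. z n \<in> ball 0 1) \<and> z \<longlonglongrightarrow> \<zeta> \<and> (\<lambda>n. f (z n)) \<longlonglongrightarrow> \<alpha>}"

definition circle_discontinuity :: "(complex \<Rightarrow> 'a::topological_space) \<Rightarrow> complex \<Rightarrow> bool" where
  "circle_discontinuity \<phi> \<zeta> \<longleftrightarrow> \<zeta> \<in> sphere 0 1 \<and> \<not> continuous (at \<zeta> within sphere 0 1) \<phi>"

definition boundary_function ::
    "(complex \<Rightarrow> 'a::euclidean_space) \<Rightarrow> (complex \<Rightarrow> 'a) \<Rightarrow> 'a set \<Rightarrow> bool" where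
  "boundary_function \<phi> f \<Gamma> \<longleftrightarrow>
    \<phi> ` sphere 0 1 \<subseteq> \<Gamma> \<and>
    bounded_variation_on (\<lambda>t. \<phi> (cis t)) 0 (2 * pi) \<and>
    countable {\<zeta>. circle_discontinuity \<phi> \<zeta>} \<and>
    (\<forall>s. circle_discontinuity \<phi> (cis s) \<longrightarrow>
      (\<exists>A. ((\<lambda>t. \<phi> (cis t)) \<longlongrightarrow> A) (at_left s)) \<and>
      (\<exists>B. ((\<lambda>t. \<phi> (cis t)) \<longlongrightarrow> B) (at_right s))) \<and>
    (\<forall>z\<in>ball 0 1. f z = poisson_integral \<phi> z)"

end

theory Submission
  imports Defs "HOL-Complex_Analysis.Complex_Analysis"
begin

text \<open>
Write \<open>C t\<close> for the cluster set of \<open>f\<close> at \<open>cis t\<close>. Since \<open>f\<close> is a homeomorphism onto the open surface, it is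
proper, and \<open>C t\<close> is a nonempty connected subset of the boundary curve \<open>\<Gamma>\<close>. Topology alone gives no more:
a homeomorphism of the disk may spiral near the circle. Harmonicity enters through a single fact
(\<open>shared_cluster_value\<close>): if \<open>p\<close> belongs to both \<open>C s\<close> and \<open>C s'\<close>, then \<open>C = {p}\<close> throughout one of the two
open arcs between \<open>cis s\<close> and \<open>cis s'\<close>. To see this, pull back by \<open>f\<close> short segments of the parameter
disk near the boundary point that corresponds to \<open>p\<close>. This gives curves that approach the circle, that
lead from near \<open>cis s\<close> to near \<open>cis s'\<close>, and on which \<open>f\<close> is close to \<open>p\<close>. A maximum principle on the side
of such a curve away from the circle (\<open>bound_above_low_paths\<close>) then shows that \<open>f\<close> has the boundary value \<open>p\<close>
along the arc that the curves follow.

What remains for the first part is combinatorics of the set-valued map \<open>C\<close>. At each \<open>t\<close> at most two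
values are shared with other points of the circle, so the nondegenerate sets \<open>C t\<close> are essentially
disjoint arcs and countable in number (\<open>countable_not_singleton\<close>). If the circle is cut into arcs, the sets of
values on these arcs are connected and cover \<open>\<Gamma>\<close> at most three times up to finitely many points, so the
finite length of \<open>\<Gamma>\<close> bounds the variation of every selection \<open>\<phi>\<close> from \<open>C\<close> (\<open>selection_bounded_variation\<close>).
Off a countable set \<open>\<phi>\<close> is the radial limit of \<open>f\<close>, and dominated convergence in Poisson's formula gives
\<open>f = P[\<phi>]\<close>.

At a jump of \<open>\<phi>\<close> from \<open>A\<close> to \<open>B\<close> one compares \<open>f\<close> with the explicit harmonic function that has the same jump,
a multiple of the argument of \<open>1 - z cis (- s)\<close>. The comparison shows that the values of \<open>f\<close> near \<open>cis s\<close>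
accumulate exactly at the points of the segment from \<open>A\<close> to \<open>B\<close> (\<open>cluster_set_poisson_jump\<close>), and this segment lies
in \<open>\<Gamma>\<close> because \<open>f\<close> is proper. If \<open>\<Gamma>\<close> contains no segment, then \<open>A = B\<close> at every jump, all cluster sets are
singletons, and \<open>f\<close> extends continuously.
\<close>

section \<open>Harmonic functions as real parts\<close>

lemma DERIV_along_line:
  fixes u :: "complex \<Rightarrow> real"
  assumes "(u has_derivative (\<lambda>h. p * Re h + q * Im h)) (at (z + of_real x * d))"
  shows "((\<lambda>x. u (z + of_real x * d)) has_real_derivative (p * Re d + q * Im d)) (at x)"
proof -
  have "((\<lambda>x. z + of_real x * d) has_derivative (\<lambda>h. of_real h * d)) (at x)"
    by (auto intro!: derivative_eq_intros)
  from has_derivative_compose[OF this assms]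
  have "((\<lambda>x. u (z + of_real x * d)) has_derivative
      (\<lambda>h. p * Re (of_real h * d) + q * Im (of_real h * d))) (at x)" .
  moreover have "(\<lambda>h. p * Re (of_real h * d) + q * Im (of_real h * d)) = (*) (p * Re d + q * Im d)"
    by (auto simp: fun_eq_iff algebra_simps)
  ultimately show ?thesis
    by (simp add: has_field_derivative_def)
qed

text \<open>The second difference of \<open>u\<close> over a square of side \<open>h\<close> can be expanded by two applications of
the mean value theorem in either order of the two directions; comparing the two results gives
values of the two mixed derivatives, at points near \<open>z\<close>, that agree. Letting \<open>h\<close> tend to 0
turns this into the symmetry of the second derivative.\<close>

lemma mixed_second_difference:
  fixes u u1 u2 :: "complex \<Rightarrow> real"
  assumes du: "\<And>w. w \<in> ball z r \<Longrightarrow> (u has_derivative (\<lambda>h. u1 w * Re h + u2 w * Im h)) (at w)"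
    and du1: "\<And>w. w \<in> ball z r \<Longrightarrow> (u1 has_derivative (\<lambda>h. u11 w * Re h + u12 w * Im h)) (at w)"
    and du2: "\<And>w. w \<in> ball z r \<Longrightarrow> (u2 has_derivative (\<lambda>h. u21 w * Re h + u22 w * Im h)) (at w)"
    and h: "0 < h" "2 * h < r"
  shows "\<exists>a b. cmod (a - z) < 2 * h \<and> cmod (b - z) < 2 * h \<and> u12 a = u21 b"
proof -
  have size: "cmod (of_real x + \<i> * of_real y) \<le> \<bar>x\<bar> + \<bar>y\<bar>" for x y
    by (rule order_trans[OF norm_triangle_ineq]) (simp add: norm_mult)
  have in_ball: "z + of_real x + \<i> * of_real y \<in> ball z r" if "0 \<le> x" "x \<le> h" "0 \<le> y" "y \<le> h" for x y
  proof -
    have "cmod (of_real x + \<i> * of_real y) < r"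
      using size[of x y] h that by linarith
    moreover have "dist z (z + of_real x + \<i> * of_real y) = cmod (of_real x + \<i> * of_real y)"
      by (subst dist_commute) (simp add: dist_norm)
    ultimately show ?thesis by simp
  qed
  have small: "cmod (z + of_real x + \<i> * of_real y - z) < 2 * h" if "0 < x" "x < h" "0 < y" "y < h" for x y
    using size[of x y] that by (simp add: algebra_simps)
  define \<Delta> where "\<Delta> = u (z + of_real h + \<i> * of_real h) - u (z + of_real h) - u (z + \<i> * of_real h) + u z"
  have dx: "((\<lambda>x. v (z + of_real x + \<i> * of_real y)) has_real_derivative p) (at x)"
    if "(v has_derivative (\<lambda>h. p * Re h + q * Im h)) (at (z + of_real x + \<i> * of_real y))"
    for v :: "complex \<Rightarrow> real" and p q x y
    using DERIV_along_line[of v p q "z + \<i> * of_real y" x 1] that by (simp add: algebra_simps)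
  have dy: "((\<lambda>y. v (z + of_real x + \<i> * of_real y)) has_real_derivative q) (at y)"
    if "(v has_derivative (\<lambda>h. p * Re h + q * Im h)) (at (z + of_real x + \<i> * of_real y))"
    for v :: "complex \<Rightarrow> real" and p q x y
    using DERIV_along_line[of v p q "z + of_real x" y \<i>] that by (simp add: algebra_simps)
  have "\<exists>x>0. x < h \<and> (u (z + of_real h + \<i> * of_real h) - u (z + of_real h + \<i> * of_real 0)) -
      (u (z + of_real 0 + \<i> * of_real h) - u (z + of_real 0 + \<i> * of_real 0))
      = (h - 0) * (u1 (z + of_real x + \<i> * of_real h) - u1 (z + of_real x + \<i> * of_real 0))"
    by (rule MVT2[OF h(1)], rule DERIV_diff, (rule dx[OF du], rule in_ball; use h in linarith)+)
  then obtain x where x: "0 < x" "x < h"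
    and xe: "\<Delta> = h * (u1 (z + of_real x + \<i> * of_real h) - u1 (z + of_real x + \<i> * of_real 0))"
    by (auto simp: \<Delta>_def algebra_simps)
  have "\<exists>y>0. y < h \<and> u1 (z + of_real x + \<i> * of_real h) - u1 (z + of_real x + \<i> * of_real 0)
      = (h - 0) * u12 (z + of_real x + \<i> * of_real y)"
    by (rule MVT2[OF h(1)], (rule dy[OF du1], rule in_ball; use h x in linarith)+)
  then obtain y where y: "0 < y" "y < h" and ye: "\<Delta> = h * (h * u12 (z + of_real x + \<i> * of_real y))"
    using xe by auto
  have "\<exists>y>0. y < h \<and> (u (z + of_real h + \<i> * of_real h) - u (z + of_real 0 + \<i> * of_real h)) -
      (u (z + of_real h + \<i> * of_real 0) - u (z + of_real 0 + \<i> * of_real 0))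
      = (h - 0) * (u2 (z + of_real h + \<i> * of_real y) - u2 (z + of_real 0 + \<i> * of_real y))"
    by (rule MVT2[OF h(1)], rule DERIV_diff, (rule dy[OF du], rule in_ball; use h in linarith)+)
  then obtain y' where y': "0 < y'" "y' < h"
    and ye': "\<Delta> = h * (u2 (z + of_real h + \<i> * of_real y') - u2 (z + of_real 0 + \<i> * of_real y'))"
    by (auto simp: \<Delta>_def algebra_simps)
  have "\<exists>x>0. x < h \<and> u2 (z + of_real h + \<i> * of_real y') - u2 (z + of_real 0 + \<i> * of_real y')
      = (h - 0) * u21 (z + of_real x + \<i> * of_real y')"
    by (rule MVT2[OF h(1)], (rule dx[OF du2], rule in_ball; use h y' in linarith)+)
  then obtain x' where x': "0 < x'" "x' < h" and xe': "\<Delta> = h * (h * u21 (z + of_real x' + \<i> * of_real y'))"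
    using ye' by auto
  have "u12 (z + of_real x + \<i> * of_real y) = u21 (z + of_real x' + \<i> * of_real y')"
    using ye xe' h(1) by simp
  then show ?thesis
    using small[OF x y] small[OF x' y']
    by (intro exI[of _ "z + of_real x + \<i> * of_real y"] exI[of _ "z + of_real x' + \<i> * of_real y'"] conjI)
qed

lemma mixed_partials_eq:
  fixes u u1 u2 :: "complex \<Rightarrow> real"
  assumes "open S" "z \<in> S"
    and du: "\<And>w. w \<in> S \<Longrightarrow> (u has_derivative (\<lambda>h. u1 w * Re h + u2 w * Im h)) (at w)"
    and du1: "\<And>w. w \<in> S \<Longrightarrow> (u1 has_derivative (\<lambda>h. u11 w * Re h + u12 w * Im h)) (at w)"
    and du2: "\<And>w. w \<in> S \<Longrightarrow> (u2 has_derivative (\<lambda>h. u21 w * Re h + u22 w * Im h)) (at w)"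
    and "continuous_on S u12" "continuous_on S u21"
  shows "u12 z = u21 z"
proof -
  obtain r where r: "r > 0" "ball z r \<subseteq> S"
    using assms(1,2) openE by blast
  define h where "h = (\<lambda>n. r / (4 * real (Suc n)))"
  have h: "0 < h n" "2 * h n < r" for n
    using r(1) by (auto simp: h_def field_simps intro: add_pos_nonneg)
  have "\<exists>a b. cmod (a - z) < 2 * h n \<and> cmod (b - z) < 2 * h n \<and> u12 a = u21 b" for n
    by (rule mixed_second_difference[OF du du1 du2 h]) (use r in auto)
  then obtain a b where ab: "\<And>n. cmod (a n - z) < 2 * h n" "\<And>n. cmod (b n - z) < 2 * h n"
    "\<And>n. u12 (a n) = u21 (b n)" by metis
  have h0: "(\<lambda>n. 2 * h n) \<longlonglongrightarrow> 0"
    unfolding h_def by real_asymp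
  have "(\<lambda>n. a n - z) \<longlonglongrightarrow> 0" "(\<lambda>n. b n - z) \<longlonglongrightarrow> 0"
    by (rule Lim_null_comparison[OF _ h0]; use ab in \<open>auto intro: less_imp_le always_eventually\<close>)+
  then have "a \<longlonglongrightarrow> z" "b \<longlonglongrightarrow> z"
    by (simp_all add: LIM_zero_iff)
  moreover have "isCont u12 z" "isCont u21 z"
    using assms by (auto simp: continuous_on_eq_continuous_at)
  ultimately have "(\<lambda>n. u12 (a n)) \<longlonglongrightarrow> u12 z" "(\<lambda>n. u21 (b n)) \<longlonglongrightarrow> u21 z"
    by (auto intro: isCont_tendsto_compose)
  then show ?thesis using ab(3) by (auto intro: LIMSEQ_unique)
qed

text \<open>If \<open>u\<^sub>1\<close> and \<open>u\<^sub>2\<close> are the partial derivatives of \<open>u\<close>, then the symmetry of the second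
derivative and the Laplace equation are the Cauchy-Riemann equations for \<open>u\<^sub>1 - \<i> u\<^sub>2\<close>. A primitive
of this function has \<open>u\<close> as its real part, up to a constant. In this form the maximum modulus
principle and Cauchy's formula become available for harmonic functions.\<close>

lemma harmonic_on_Re_holomorphic:
  assumes "harmonic_on u S" "convex S"
  obtains F where "F holomorphic_on S" "\<And>z. z \<in> S \<Longrightarrow> Re (F z) = u z"
proof (cases "S = {}")
  case True
  then show ?thesis using that[of "\<lambda>_. 0"] by auto
next
  case False
  from assms(1) obtain u1 u2 u11 u12 u21 u22 where S: "open S"
    and d: "\<forall>z\<in>S. (u has_derivative (\<lambda>h. u1 z * Re h + u2 z * Im h)) (at z) \<and>
        (u1 has_derivative (\<lambda>h. u11 z * Re h + u12 z * Im h)) (at z) \<and>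
        (u2 has_derivative (\<lambda>h. u21 z * Re h + u22 z * Im h)) (at z) \<and>
        u11 z + u22 z = 0"
    and cont: "continuous_on S u12" "continuous_on S u21"
    unfolding harmonic_on_def by (elim conjE exE) (rule that)
  note d1 = d[rule_format, THEN conjunct1]
  note d2 = d[rule_format, THEN conjunct2, THEN conjunct1]
  note d3 = d[rule_format, THEN conjunct2, THEN conjunct2, THEN conjunct1]
  note lap = d[rule_format, THEN conjunct2, THEN conjunct2, THEN conjunct2]
  define G where "G = (\<lambda>z. of_real (u1 z) - \<i> * of_real (u2 z))"
  have dG: "(G has_field_derivative (of_real (u11 z) - \<i> * of_real (u21 z))) (at z)" if "z \<in> S" for z
  proof -
    have "u12 z = u21 z" by (rule mixed_partials_eq[OF S that d1 d2 d3 cont])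
    moreover have "u22 z = - u11 z" using lap[OF that] by simp
    ultimately have "(\<lambda>h. of_real (u11 z * Re h + u12 z * Im h) - \<i> * of_real (u21 z * Re h + u22 z * Im h))
      = (\<lambda>h. (of_real (u11 z) - \<i> * of_real (u21 z)) * h)"
      by (auto simp: fun_eq_iff complex_eq_iff algebra_simps)
    moreover have "(G has_derivative (\<lambda>h. of_real (u11 z * Re h + u12 z * Im h) - \<i> * of_real (u21 z * Re h + u22 z * Im h))) (at z)"
      unfolding G_def
      by (intro has_derivative_diff has_derivative_mult_right has_derivative_of_real d2 d3 that)
    ultimately show ?thesis by (simp add: has_field_derivative_def)
  qed
  then have "G holomorphic_on S"
    using S by (auto simp: holomorphic_on_open)
  then obtain F where F: "\<And>z. z \<in> S \<Longrightarrow> (F has_field_derivative G z) (at z within S)"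
    using holomorphic_convex_primitive'[OF assms(2) S] by blast
  have "((\<lambda>z. Re (F z) - u z) has_derivative (\<lambda>h. 0)) (at z within S)" if "z \<in> S" for z
  proof -
    have "((\<lambda>z. Re (F z) - u z) has_derivative (\<lambda>h. Re (G z * h) - (u1 z * Re h + u2 z * Im h))) (at z within S)"
      by (intro has_derivative_diff has_derivative_Re has_derivative_at_withinI[OF d1] that
          F[unfolded has_field_derivative_def])
    then show ?thesis by (simp add: G_def)
  qed
  from has_derivative_zero_constant[OF assms(2) this]
  obtain c where c: "\<And>z. z \<in> S \<Longrightarrow> Re (F z) - u z = c" by auto
  show ?thesis
  proof (rule that[of "\<lambda>z. F z - of_real c"])
    have "F holomorphic_on S"
      using F by (auto simp: holomorphic_on_def field_differentiable_def)
    then show "(\<lambda>z. F z - of_real c) holomorphic_on S"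
      by (intro holomorphic_intros)
  qed (use c in force)
qed

section \<open>A maximum principle above curves close to the boundary\<close>

lemma fashoda_complex:
  fixes p q :: "real \<Rightarrow> complex"
  assumes "path p" "path q"
    and box: "\<And>z. z \<in> path_image p \<union> path_image q \<Longrightarrow> a \<le> Re z \<and> Re z \<le> a' \<and> b \<le> Im z \<and> Im z \<le> b'"
    and "Re (pathstart p) = a" "Re (pathfinish p) = a'" "Im (pathstart q) = b" "Im (pathfinish q) = b'"
  obtains z where "z \<in> path_image p" "z \<in> path_image q"
proof -
  define v :: "complex \<Rightarrow> real^2" where "v = (\<lambda>z. \<chi> i. if i = 1 then Re z else Im z)"
  have v1: "v z $ 1 = Re z" and v2: "v z $ 2 = Im z" for z by (simp_all add: v_def)
  have contv: "continuous_on A v" for A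
    unfolding v_def
  proof (rule continuous_on_vec_lambda)
    show "continuous_on A (\<lambda>z. if i = 1 then Re z else Im z)" for i :: 2
      by (cases "i = 1") (auto intro!: continuous_intros)
  qed
  have vinj: "x = y" if "v x = v y" for x y
    using that by (metis complex_eqI v1 v2)
  have inbox: "path_image (v \<circ> r) \<subseteq> cbox (v (Complex a b)) (v (Complex a' b'))"
    if "path_image r \<subseteq> path_image p \<union> path_image q" for r
    using that box by (auto simp: path_image_def mem_box_cart forall_2 v1 v2 subset_iff)
  obtain y where "y \<in> path_image (v \<circ> p)" "y \<in> path_image (v \<circ> q)"
    by (rule fashoda[of "v \<circ> p" "v \<circ> q" "v (Complex a b)" "v (Complex a' b')"])
      (use assms inbox in \<open>auto simp: v1 v2 pathstart_compose pathfinish_compose intro!: path_continuous_image contv\<close>)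
  then obtain z z' where "z \<in> path_image p" "z' \<in> path_image q" "v z = v z'"
    by (auto simp: path_image_compose)
  with vinj that show ?thesis by blast
qed

text \<open>A two-constants estimate. If \<open>Re F\<close> is almost nonpositive on curves that cross the strip
\<open>c - d \<le> Re \<tau> \<le> c + d\<close> from side to side arbitrarily close to the real axis, then \<open>Re F\<close> is
bounded above each such curve by \<open>M\<close> times a harmonic function that is at least 1 on the vertical
sides and on the top of the box \<open>\<bar>Re \<tau> - c\<bar> < d\<close>, \<open>0 < Im \<tau> < d\<close>. That function is an explicit
quadratic polynomial and vanishes at \<open>c\<close>, so the bound controls \<open>Re F\<close> near the boundary point \<open>c\<close>.
The crossing curve shields the points above it from the unknown boundary values on the real axis;
that a curve from side to side really separates is the theorem of Fashoda.\<close>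

lemma bound_above_low_paths:
  fixes F :: "complex \<Rightarrow> complex"
  assumes holo: "F holomorphic_on {\<tau>. Im \<tau> > 0}"
    and bound: "\<And>\<tau>. Im \<tau> > 0 \<Longrightarrow> Re (F \<tau>) \<le> M" and M: "M \<ge> 0" and d: "d > 0"
    and paths: "\<And>e. e > 0 \<Longrightarrow> \<exists>\<eta>. path \<eta> \<and> Re (pathstart \<eta>) \<le> c - d \<and> c + d \<le> Re (pathfinish \<eta>) \<and>
      (\<forall>\<tau>\<in>path_image \<eta>. 0 < Im \<tau> \<and> Im \<tau> < e \<and> Re (F \<tau>) < e)"
    and \<sigma>: "\<bar>Re \<sigma> - c\<bar> < d" "0 < Im \<sigma>" "Im \<sigma> < d"
  shows "Re (F \<sigma>) \<le> M * (((Re \<sigma> - c)\<^sup>2 - (Im \<sigma>)\<^sup>2 + 2 * d * Im \<sigma>) / d\<^sup>2)"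
proof (rule field_le_epsilon)
  define \<omega> where "\<omega> = (\<lambda>\<tau>. ((Re \<tau> - c)\<^sup>2 - (Im \<tau>)\<^sup>2 + 2 * d * Im \<tau>) / d\<^sup>2)"
  \<comment> \<open>The barrier as the real part of a holomorphic function.\<close>
  define \<Omega> where "\<Omega> = (\<lambda>\<tau>. ((\<tau> - of_real c)\<^sup>2 - 2 * \<i> * of_real d * (\<tau> - of_real c)) / of_real (d\<^sup>2))"
  have Re\<Omega>: "Re (\<Omega> \<tau>) = \<omega> \<tau>" for \<tau>
    unfolding \<Omega>_def \<omega>_def by (simp only: Re_divide_of_real) (simp add: power2_eq_square)
  fix e0 :: real assume "e0 > 0"
  define e where "e = min e0 (Im \<sigma>)"
  have e: "0 < e" "e \<le> e0" "e \<le> Im \<sigma>" using \<open>e0 > 0\<close> \<sigma> by (auto simp: e_def)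
  from paths[OF e(1)] obtain \<eta> where \<eta>: "path \<eta>" "Re (pathstart \<eta>) \<le> c - d" "c + d \<le> Re (pathfinish \<eta>)"
    and low: "\<And>\<tau>. \<tau> \<in> path_image \<eta> \<Longrightarrow> 0 < Im \<tau> \<and> Im \<tau> < e \<and> Re (F \<tau>) < e"
    by blast
  obtain \<mu> where \<mu>: "\<mu> \<in> path_image \<eta>" "\<And>\<tau>. \<tau> \<in> path_image \<eta> \<Longrightarrow> Im \<mu> \<le> Im \<tau>"
    using continuous_attains_inf[OF compact_path_image[OF \<eta>(1)] path_image_nonempty continuous_on_Im[OF continuous_on_id]]
    by auto
  define B where "B = {\<tau>. c - d < Re \<tau>} \<inter> {\<tau>. Re \<tau> < c + d} \<inter> {\<tau>. 0 < Im \<tau>} \<inter> {\<tau>. Im \<tau> < d}"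
  have memB: "\<tau> \<in> B \<longleftrightarrow> c - d < Re \<tau> \<and> Re \<tau> < c + d \<and> 0 < Im \<tau> \<and> Im \<tau> < d" for \<tau>
    by (auto simp: B_def)
  have openB: "open B" unfolding B_def
    by (intro open_Int open_halfspace_Re_gt open_halfspace_Re_lt open_halfspace_Im_gt open_halfspace_Im_lt)
  define R where "R = B - path_image \<eta>"
  have openR: "open R" unfolding R_def
    by (intro open_Diff openB closed_path_image \<eta>)
  \<comment> \<open>The part of the box above the curve, as seen from \<open>\<sigma>\<close>.\<close>
  define D where "D = connected_component_set R \<sigma>"
  have \<sigma>R: "\<sigma> \<in> R" using \<sigma> low e by (force simp: R_def memB abs_less_iff)
  have DR: "D \<subseteq> R" unfolding D_def by (rule connected_component_subset)
  have openD: "open D" unfolding D_def by (rule open_connected_component[OF openR])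
  have \<sigma>D: "\<sigma> \<in> D" unfolding D_def using \<sigma>R by (simp add: connected_component_refl)
  have connD: "connected D" unfolding D_def by (rule connected_connected_component)
  \<comment> \<open>Otherwise a path in \<open>D\<close> from such a point up to \<open>\<sigma>\<close>, prolonged vertically to the bottom and to
     the top of the box, would avoid the curve.\<close>
  have above: "Im \<mu> \<le> Im \<tau>" if \<tau>D: "\<tau> \<in> D" for \<tau>
  proof (rule ccontr)
    assume "\<not> Im \<mu> \<le> Im \<tau>"
    then have \<tau>: "Im \<tau> < Im \<mu>" by simp
    have \<tau>B: "\<tau> \<in> B" using \<tau>D DR by (auto simp: R_def)
    have \<sigma>B: "\<sigma> \<in> B" using \<sigma>R by (auto simp: R_def)
    have "path_connected D" using connected_open_path_connected[OF openD connD] .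
    then obtain g where g: "path g" "path_image g \<subseteq> D" "pathstart g = \<tau>" "pathfinish g = \<sigma>"
      using \<tau>D \<sigma>D unfolding path_connected_def by metis
    define q where "q = linepath (Complex (Re \<tau>) 0) \<tau> +++ (g +++ linepath \<sigma> (Complex (Re \<sigma>) d))"
    \<comment> \<open>Clamping the real part keeps the curve in the box and changes it only on the vertical sides,
       which \<open>q\<close> avoids.\<close>
    define p where "p = (\<lambda>t. Complex (max (c - d) (min (c + d) (Re (\<eta> t)))) (Im (\<eta> t)))"
    have segs: "x \<in> path_image q \<Longrightarrow> (Re x = Re \<tau> \<and> 0 \<le> Im x \<and> Im x \<le> Im \<tau>) \<or> x \<in> D \<or> (Re x = Re \<sigma> \<and> Im \<sigma> \<le> Im x \<and> Im x \<le> d)" for x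
    proof -
      assume "x \<in> path_image q"
      then consider "x \<in> closed_segment (Complex (Re \<tau>) 0) \<tau>" | "x \<in> path_image g" | "x \<in> closed_segment \<sigma> (Complex (Re \<sigma>) d)"
        unfolding q_def using path_image_join_subset path_image_linepath by blast
      then show ?thesis
        using \<tau>B \<sigma>B g(2)
        by cases (auto simp: closed_segment_same_Re closed_segment_eq_real_ivl memB)
    qed
    have pimg: "x \<in> path_image p \<Longrightarrow> \<exists>y\<in>path_image \<eta>. x = Complex (max (c - d) (min (c + d) (Re y))) (Im y)" for x
      by (auto simp: p_def path_image_def)
    have qbox: "c - d < Re x \<and> Re x < c + d \<and> 0 \<le> Im x \<and> Im x \<le> d \<and> x \<notin> path_image \<eta>" if "x \<in> path_image q" for x
    proof -
      consider "Re x = Re \<tau> \<and> 0 \<le> Im x \<and> Im x \<le> Im \<tau>" | "x \<in> D" | "Re x = Re \<sigma> \<and> Im \<sigma> \<le> Im x \<and> Im x \<le> d"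
        using segs[OF \<open>x \<in> path_image q\<close>] by blast
      then show ?thesis
      proof cases
        case 1
        then show ?thesis using \<tau>B \<tau> \<mu>(2)[of x] by (auto simp: memB)
      next
        case 2
        then have "x \<in> B" "x \<notin> path_image \<eta>" using DR by (auto simp: R_def)
        then show ?thesis by (auto simp: memB)
      next
        case 3
        then show ?thesis using \<sigma>B e low[of x] \<sigma> by (auto simp: memB)
      qed
    qed
    have pathp: "path p"
      using \<eta>(1) unfolding p_def path_def Complex_eq
      by (auto intro!: continuous_intros)
    obtain x where x: "x \<in> path_image p" "x \<in> path_image q"
    proof (rule fashoda_complex[of p q "c - d" "c + d" 0 d])
      show "path q" unfolding q_def using g by auto
      show "c - d \<le> Re z \<and> Re z \<le> c + d \<and> 0 \<le> Im z \<and> Im z \<le> d" if z: "z \<in> path_image p \<union> path_image q" for z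
      proof (cases "z \<in> path_image q")
        case True
        then show ?thesis using qbox[of z] by auto
      next
        case False
        then obtain y where "y \<in> path_image \<eta>" "z = Complex (max (c - d) (min (c + d) (Re y))) (Im y)"
          using z pimg by blast
        then show ?thesis using low[of y] e \<sigma> d by auto
      qed
    qed (use \<eta> pathp d in \<open>auto simp: p_def q_def pathstart_def pathfinish_def joinpaths_def linepath_def\<close>)
    obtain y where y: "y \<in> path_image \<eta>" "x = Complex (max (c - d) (min (c + d) (Re y))) (Im y)"
      using pimg[OF x(1)] by blast
    have "x = y" using y(2) qbox[OF x(2)] by (auto simp: complex_eq_iff max_def min_def split: if_splits)
    then show False using qbox[OF x(2)] y(1) by simp
  qed
  \<comment> \<open>The modulus of \<open>E\<close> is at most 1 exactly where the desired bound holds, with the slack \<open>e\<close>.\<close>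
  define E where "E = (\<lambda>\<tau>. exp (F \<tau> - of_real e - of_real M * \<Omega> \<tau>))"
  have \<mu>0: "0 < Im \<mu>" using low \<mu>(1) by blast
  have closD: "c - d \<le> Re \<tau> \<and> Re \<tau> \<le> c + d \<and> Im \<mu> \<le> Im \<tau> \<and> Im \<tau> \<le> d" if "\<tau> \<in> closure D" for \<tau>
  proof -
    have "closed ({\<tau>. c - d \<le> Re \<tau>} \<inter> {\<tau>. Re \<tau> \<le> c + d} \<inter> {\<tau>. Im \<mu> \<le> Im \<tau>} \<inter> {\<tau>. Im \<tau> \<le> d})"
      by (intro closed_Int closed_halfspace_Re_ge closed_halfspace_Re_le closed_halfspace_Im_ge closed_halfspace_Im_le)
    moreover have "D \<subseteq> {\<tau>. c - d \<le> Re \<tau>} \<inter> {\<tau>. Re \<tau> \<le> c + d} \<inter> {\<tau>. Im \<mu> \<le> Im \<tau>} \<inter> {\<tau>. Im \<tau> \<le> d}"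
      using above DR by (auto simp: R_def memB subset_iff less_imp_le)
    ultimately show ?thesis using closure_minimal that by blast
  qed
  have holE: "E holomorphic_on {\<tau>. Im \<tau> > 0}"
    unfolding E_def \<Omega>_def by (intro holomorphic_intros holo) (use d in auto)
  have "norm (E \<sigma>) \<le> 1"
  proof (rule maximum_modulus_frontier[of E D])
    show "E holomorphic_on interior D"
      using holE by (rule holomorphic_on_subset) (use closD closure_subset \<mu>0 openD in \<open>force simp: interior_open\<close>)
    show "continuous_on (closure D) E"
      using holomorphic_on_imp_continuous_on[OF holE] by (rule continuous_on_subset) (use closD \<mu>0 in force)
    have "D \<subseteq> cbox (Complex (c - d) 0) (Complex (c + d) d)"
      using DR by (auto simp: R_def memB in_cbox_complex_iff subset_iff)
    then show "bounded D" using bounded_cbox bounded_subset by blast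
    show "norm (E z) \<le> 1" if z: "z \<in> frontier D" for z
    proof -
      have zc: "z \<in> closure D" using z by (simp add: frontier_def)
      note cl = closD[OF zc]
      have zR: "z \<notin> R"
        using z frontier_of_connected_component_subset[of R \<sigma>] openR
        unfolding D_def[symmetric] by (auto simp: frontier_def interior_open)
      have pos: "0 \<le> 2 * d * Im z - (Im z)\<^sup>2"
      proof -
        have "0 \<le> Im z * (2 * d - Im z)" using cl \<mu>0 d by (intro mult_nonneg_nonneg) auto
        then show ?thesis by (simp add: power2_eq_square algebra_simps)
      qed
      have "Re (F z) \<le> e + M * \<omega> z"
      proof (cases "z \<in> path_image \<eta>")
        case True
        have "0 \<le> (Re z - c)\<^sup>2" by simp
        with pos have "0 \<le> \<omega> z" unfolding \<omega>_def by (intro divide_nonneg_nonneg) (linarith, simp)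
        then have "0 \<le> M * \<omega> z" using M by simp
        then show ?thesis using low[OF True] by linarith
      next
        case False
        then have "z \<notin> B" using zR by (auto simp: R_def)
        then have side: "Re z = c - d \<or> Re z = c + d \<or> Im z = d" using cl \<mu>0 by (auto simp: memB)
        have "d\<^sup>2 \<le> (Re z - c)\<^sup>2 - (Im z)\<^sup>2 + 2 * d * Im z"
        proof (cases "Im z = d")
          case True
          have "0 \<le> (Re z - c)\<^sup>2" by simp
          then show ?thesis unfolding True by (simp add: power2_eq_square)
        next
          case False
          then have "(Re z - c)\<^sup>2 = d\<^sup>2" using side by auto
          then show ?thesis using pos by simp
        qed
        then have "1 \<le> \<omega> z" unfolding \<omega>_def using d by (simp add: field_simps)
        then have "M * 1 \<le> M * \<omega> z" using M by (intro mult_left_mono) auto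
        then show ?thesis using bound[of z] cl \<mu>0 e by auto
      qed
      then show ?thesis by (simp add: E_def Re\<Omega>)
    qed
  qed (rule \<sigma>D)
  then have "Re (F \<sigma>) \<le> e + M * \<omega> \<sigma>" by (simp add: E_def Re\<Omega>)
  then show "Re (F \<sigma>) \<le> M * (((Re \<sigma> - c)\<^sup>2 - (Im \<sigma>)\<^sup>2 + 2 * d * Im \<sigma>) / d\<^sup>2) + e0"
    using e by (simp add: \<omega>_def)
qed

section \<open>Cluster sets at points of the unit circle\<close>

lemma exp_ii_in_disc: "exp (\<i> * \<tau>) \<in> ball 0 1 \<longleftrightarrow> 0 < Im \<tau>"
  by (simp add: norm_exp_eq_Re)

text \<open>Cluster sets at points of the circle in the coordinate \<open>\<tau>\<close> of the upper half-plane, \<open>z = exp (\<i> \<tau>)\<close>: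
there arcs of the circle become intervals, and the neighbourhoods of an arc become rectangles.\<close>

lemma cluster_set_cis_iff:
  fixes f :: "complex \<Rightarrow> 'a::metric_space"
  shows "\<alpha> \<in> cluster_set f (cis s) \<longleftrightarrow>
    (\<forall>e>0. \<exists>\<tau>. 0 < Im \<tau> \<and> dist \<tau> (of_real s) < e \<and> dist (f (exp (\<i> * \<tau>))) \<alpha> < e)"
proof
  assume "\<alpha> \<in> cluster_set f (cis s)"
  then obtain z :: "nat \<Rightarrow> complex" where z: "\<And>n. z n \<in> ball 0 1" "z \<longlonglongrightarrow> cis s" "(\<lambda>n. f (z n)) \<longlonglongrightarrow> \<alpha>"
    by (auto simp: cluster_set_def)
  define \<tau> where "\<tau> = (\<lambda>n. of_real s - \<i> * Ln (z n / cis s))"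
  have lim1: "(\<lambda>n. z n / cis s) \<longlonglongrightarrow> 1"
    using tendsto_divide[OF z(2) tendsto_const, of "cis s"] by simp
  have "(\<lambda>n. Ln (z n / cis s)) \<longlonglongrightarrow> Ln 1"
    by (rule isCont_tendsto_compose[OF _ lim1]) (rule continuous_at_Ln, simp)
  then have "\<tau> \<longlonglongrightarrow> of_real s - \<i> * Ln 1"
    unfolding \<tau>_def by (intro tendsto_diff tendsto_mult tendsto_const)
  then have \<tau>lim: "\<tau> \<longlonglongrightarrow> of_real s" by simp
  have nz: "eventually (\<lambda>n. z n / cis s \<noteq> 0) sequentially"
    by (rule tendsto_imp_eventually_ne[OF lim1]) simp
  show "\<forall>e>0. \<exists>\<tau>. 0 < Im \<tau> \<and> dist \<tau> (of_real s) < e \<and> dist (f (exp (\<i> * \<tau>))) \<alpha> < e"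
  proof (intro allI impI)
    fix e :: real assume e: "e > 0"
    have "eventually (\<lambda>n. z n / cis s \<noteq> 0 \<and> dist (\<tau> n) (of_real s) < e \<and> dist (f (z n)) \<alpha> < e) sequentially"
      by (intro eventually_conj nz tendstoD[OF \<tau>lim e] tendstoD[OF z(3) e])
    then obtain n where n: "z n / cis s \<noteq> 0" "dist (\<tau> n) (of_real s) < e" "dist (f (z n)) \<alpha> < e"
      by (auto simp: eventually_sequentially)
    have "\<i> * \<tau> n = \<i> * of_real s + Ln (z n / cis s)" by (simp add: \<tau>_def algebra_simps)
    then have *: "exp (\<i> * \<tau> n) = z n"
      using n(1) by (simp add: exp_add exp_Ln cis_conv_exp[symmetric])
    then have "0 < Im (\<tau> n)" using z(1)[of n] exp_ii_in_disc by metis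
    with n * show "\<exists>\<tau>. 0 < Im \<tau> \<and> dist \<tau> (of_real s) < e \<and> dist (f (exp (\<i> * \<tau>))) \<alpha> < e" by metis
  qed
next
  assume R: "\<forall>e>0. \<exists>\<tau>. 0 < Im \<tau> \<and> dist \<tau> (of_real s) < e \<and> dist (f (exp (\<i> * \<tau>))) \<alpha> < e"
  have "\<forall>n. \<exists>\<tau>. 0 < Im \<tau> \<and> dist \<tau> (of_real s) < 1 / real (Suc n) \<and> dist (f (exp (\<i> * \<tau>))) \<alpha> < 1 / real (Suc n)"
    using R by simp
  then obtain \<tau> where \<tau>: "\<And>n. 0 < Im (\<tau> n)" "\<And>n. dist (\<tau> n) (of_real s) < 1 / real (Suc n)"
    "\<And>n. dist (f (exp (\<i> * \<tau> n))) \<alpha> < 1 / real (Suc n)" by metis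
  have l0: "(\<lambda>n. 1 / real (Suc n)) \<longlonglongrightarrow> 0" by (rule lim_1_over_n[THEN LIMSEQ_Suc])
  have "\<tau> \<longlonglongrightarrow> of_real s" "(\<lambda>n. f (exp (\<i> * \<tau> n))) \<longlonglongrightarrow> \<alpha>"
    by (rule metric_tendsto_imp_tendsto[OF l0], use \<tau> in \<open>auto intro!: always_eventually less_imp_le\<close>)+
  moreover from this(1) have "(\<lambda>n. exp (\<i> * \<tau> n)) \<longlonglongrightarrow> exp (\<i> * of_real s)"
    by (intro tendsto_intros)
  ultimately show "\<alpha> \<in> cluster_set f (cis s)"
    unfolding cluster_set_def using \<tau>(1) exp_ii_in_disc
    by (intro CollectI exI[of _ "\<lambda>n. exp (\<i> * \<tau> n)"]) (auto simp: cis_conv_exp)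
qed

lemma cluster_set_nonempty:
  fixes f :: "complex \<Rightarrow> 'a::metric_space"
  assumes "compact K" "f ` ball 0 1 \<subseteq> K" "z \<in> cball 0 1"
  shows "cluster_set f z \<noteq> {}"
proof -
  define w where "w = (\<lambda>n. of_real (1 - 1 / real (Suc n)) * z)"
  have inb: "w n \<in> ball 0 1" for n
  proof -
    have c: "0 \<le> 1 - 1 / real (Suc n)" "1 - 1 / real (Suc n) < 1" by simp_all
    have "norm (w n) = (1 - 1 / real (Suc n)) * norm z"
      unfolding w_def norm_mult norm_of_real using c(1) by (simp only: abs_of_nonneg)
    also have "\<dots> \<le> (1 - 1 / real (Suc n)) * 1"
      by (rule mult_left_mono[OF _ c(1)]) (use assms(3) in simp)
    also have "\<dots> < 1" using c(2) by simp
    finally show ?thesis by simp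
  qed
  have "(\<lambda>n. of_real (1 - 1 / real (Suc n)) * z) \<longlonglongrightarrow> of_real (1 - 0) * z"
    by (intro tendsto_mult tendsto_of_real tendsto_diff tendsto_const lim_1_over_n[THEN LIMSEQ_Suc])
  then have wlim: "w \<longlonglongrightarrow> z" by (simp add: w_def)
  have "\<forall>n. f (w n) \<in> K" using inb assms(2) by blast
  then obtain l r where lr: "strict_mono (r :: nat \<Rightarrow> nat)" "(f \<circ> w \<circ> r) \<longlonglongrightarrow> l"
    using assms(1) unfolding compact_def by (metis comp_apply)
  have "l \<in> cluster_set f z"
    unfolding cluster_set_def
    using inb LIMSEQ_subseq_LIMSEQ[OF wlim lr(1)] lr(2)
    by (intro CollectI exI[of _ "w \<circ> r"]) (auto simp: comp_def)
  then show ?thesis by blast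
qed

text \<open>The union of the cluster sets along an arc is a decreasing intersection of the closures of the
images of rectangles, which are compact and connected.\<close>

lemma connected_cluster_arc:
  fixes f :: "complex \<Rightarrow> 'a::euclidean_space"
  assumes K: "compact K" "f ` ball 0 1 \<subseteq> K" and contf: "continuous_on (ball 0 1) f" and "a \<le> b"
  shows "connected (\<Union>t\<in>{a..b}. cluster_set f (cis t))"
proof -
  define R where "R = (\<lambda>n::nat. {\<tau>. a - 1 / real (Suc n) < Re \<tau>} \<inter> {\<tau>. Re \<tau> < b + 1 / real (Suc n)}
      \<inter> {\<tau>. 0 < Im \<tau>} \<inter> {\<tau>. Im \<tau> < 1 / real (Suc n)})"
  let ?E = "\<lambda>\<tau>. f (exp (\<i> * \<tau>))"
  define S where "S = (\<lambda>n. closure (?E ` R n))"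
  have memR: "\<tau> \<in> R n \<longleftrightarrow> a - 1 / real (Suc n) < Re \<tau> \<and> Re \<tau> < b + 1 / real (Suc n) \<and> 0 < Im \<tau> \<and> Im \<tau> < 1 / real (Suc n)" for \<tau> n
    by (auto simp: R_def)
  have EK: "?E ` R n \<subseteq> K" for n
  proof
    fix y assume "y \<in> ?E ` R n"
    then obtain \<tau> where "\<tau> \<in> R n" "y = ?E \<tau>" by blast
    then have "exp (\<i> * \<tau>) \<in> ball 0 1" using exp_ii_in_disc memR by blast
    then show "y \<in> K" using K(2) \<open>y = ?E \<tau>\<close> by blast
  qed
  have SK: "S n \<subseteq> K" for n
    unfolding S_def using closure_minimal[OF EK compact_imp_closed[OF K(1)]] .
  have compS: "compact (S n)" for n
    using compact_Int_closed[OF K(1), of "S n"] SK[of n] by (simp add: S_def Int_absorb1)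
  have connS: "connected (S n)" for n
    unfolding S_def
  proof (intro connected_imp_connected_closure connected_continuous_image)
    have "convex (R n)" unfolding R_def
      by (intro convex_Int convex_halfspace_Re_gt convex_halfspace_Re_lt convex_halfspace_Im_gt convex_halfspace_Im_lt)
    then show "connected (R n)" by (rule convex_connected)
    show "continuous_on (R n) ?E"
      by (rule continuous_on_compose2[OF contf], intro continuous_intros) (use exp_ii_in_disc memR in blast)
  qed
  have nest: "S n \<subseteq> S m" if "m \<le> n" for m n
    unfolding S_def
  proof (intro closure_mono image_mono subsetI)
    fix \<tau> assume "\<tau> \<in> R n"
    moreover have "1 / real (Suc n) \<le> 1 / real (Suc m)" using that by (simp add: field_simps)
    ultimately show "\<tau> \<in> R m" unfolding memR by linarith
  qed
  have "connected (\<Inter>(range S))" by (rule connected_nest[OF compS connS nest])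
  moreover have "\<Inter>(range S) = (\<Union>t\<in>{a..b}. cluster_set f (cis t))"
  proof (intro subset_antisym subsetI)
    fix \<alpha> assume \<alpha>: "\<alpha> \<in> \<Inter>(range S)"
    have "\<exists>\<tau>. \<tau> \<in> R n \<and> dist (?E \<tau>) \<alpha> < 1 / real (Suc n)" for n
    proof -
      have "\<alpha> \<in> closure (?E ` R n)" using \<alpha> by (auto simp: S_def)
      then obtain y where "y \<in> ?E ` R n" "dist y \<alpha> < 1 / real (Suc n)"
        unfolding closure_approachable by (metis of_nat_0_less_iff zero_less_Suc zero_less_divide_1_iff)
      then show ?thesis by blast
    qed
    then obtain \<tau> where \<tau>: "\<And>n. \<tau> n \<in> R n" "\<And>n. dist (?E (\<tau> n)) \<alpha> < 1 / real (Suc n)" by metis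
    have le1: "1 / real (Suc n) \<le> 1" for n by simp
    have "\<forall>n. \<tau> n \<in> cbox (Complex (a - 1) 0) (Complex (b + 1) 1)"
    proof
      fix n show "\<tau> n \<in> cbox (Complex (a - 1) 0) (Complex (b + 1) 1)"
      proof -
        have "a - 1 \<le> Re (\<tau> n) \<and> Re (\<tau> n) \<le> b + 1 \<and> 0 \<le> Im (\<tau> n) \<and> Im (\<tau> n) \<le> 1"
          using \<tau>(1)[of n, unfolded memR] le1[of n] by linarith
        then show ?thesis by (simp add: in_cbox_complex_iff)
      qed
    qed
    then obtain l r where lr: "strict_mono (r :: nat \<Rightarrow> nat)" "(\<tau> \<circ> r) \<longlonglongrightarrow> l"
      using compact_cbox unfolding compact_def by metis
    have l0: "(\<lambda>n. 1 / real (Suc (r n))) \<longlonglongrightarrow> 0"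
      using LIMSEQ_subseq_LIMSEQ[OF lim_1_over_n[THEN LIMSEQ_Suc] lr(1)] by (simp add: comp_def)
    have Rel: "(\<lambda>n. Re (\<tau> (r n))) \<longlonglongrightarrow> Re l" and Iml: "(\<lambda>n. Im (\<tau> (r n))) \<longlonglongrightarrow> Im l"
      using tendsto_Re[OF lr(2)] tendsto_Im[OF lr(2)] by (simp_all add: comp_def)
    have "Im l = 0"
    proof (rule LIMSEQ_unique[OF Iml])
      show "(\<lambda>n. Im (\<tau> (r n))) \<longlonglongrightarrow> 0"
        by (rule tendsto_sandwich[OF _ _ tendsto_const l0])
          (use \<tau>(1) in \<open>auto intro!: always_eventually less_imp_le simp: memR simp del: of_nat_Suc\<close>)
    qed
    moreover have "a - 0 \<le> Re l"
      by (rule LIMSEQ_le[OF tendsto_diff[OF tendsto_const l0] Rel])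
        (use \<tau>(1) in \<open>auto intro!: exI[of _ 0] less_imp_le simp: memR simp del: of_nat_Suc\<close>)
    moreover have "Re l \<le> b + 0"
      by (rule LIMSEQ_le[OF Rel tendsto_add[OF tendsto_const l0]])
        (use \<tau>(1) in \<open>auto intro!: exI[of _ 0] less_imp_le simp: memR simp del: of_nat_Suc\<close>)
    ultimately have l: "l = of_real (Re l)" "Re l \<in> {a..b}" by (auto simp: complex_eq_iff)
    have "\<alpha> \<in> cluster_set f (cis (Re l))"
      unfolding cluster_set_cis_iff l(1)[symmetric]
    proof (intro allI impI)
      fix e :: real assume e: "e > 0"
      have "eventually (\<lambda>n. dist ((\<tau> \<circ> r) n) l < e \<and> dist (1 / real (Suc (r n))) 0 < e) sequentially"
        by (intro eventually_conj tendstoD[OF lr(2) e] tendstoD[OF l0 e])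
      then obtain n where "dist (\<tau> (r n)) l < e" "1 / real (Suc (r n)) < e"
        by (auto simp: eventually_sequentially simp del: of_nat_Suc)
      then show "\<exists>\<tau>. 0 < Im \<tau> \<and> dist \<tau> l < e \<and> dist (?E \<tau>) \<alpha> < e"
        using \<tau>[of "r n"] by (intro exI[of _ "\<tau> (r n)"]) (auto simp: memR)
    qed
    then show "\<alpha> \<in> (\<Union>t\<in>{a..b}. cluster_set f (cis t))" using l(2) by blast
  next
    fix \<alpha> assume "\<alpha> \<in> (\<Union>t\<in>{a..b}. cluster_set f (cis t))"
    then obtain t where t: "a \<le> t" "t \<le> b" "\<alpha> \<in> cluster_set f (cis t)" by auto
    have "\<alpha> \<in> closure (?E ` R n)" for n
      unfolding closure_approachable
    proof (intro allI impI)
      fix e :: real assume e: "e > 0"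
      define e' where "e' = min e (1 / real (Suc n))"
      have "e' > 0" using e by (simp add: e'_def)
      then obtain \<tau> where \<tau>: "0 < Im \<tau>" "dist \<tau> (of_real t) < e'" "dist (?E \<tau>) \<alpha> < e'"
        using t(3) unfolding cluster_set_cis_iff by blast
      have "\<bar>Re \<tau> - t\<bar> \<le> dist \<tau> (of_real t)" "\<bar>Im \<tau>\<bar> \<le> dist \<tau> (of_real t)"
        using abs_Re_le_cmod[of "\<tau> - of_real t"] abs_Im_le_cmod[of "\<tau> - of_real t"] by (simp_all add: dist_norm)
      then have "\<tau> \<in> R n" unfolding memR using \<tau> t e'_def by linarith
      moreover have "dist (?E \<tau>) \<alpha> < e" using \<tau>(3) by (simp add: e'_def)
      ultimately show "\<exists>y\<in>?E ` R n. dist y \<alpha> < e" by blast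
    qed
    then show "\<alpha> \<in> \<Inter>(range S)" by (auto simp: S_def)
  qed
  ultimately show ?thesis by simp
qed

text \<open>A harmonic analogue of Koebe's lemma: curves that tend to an arc of the circle and along which \<open>f\<close>
tends to \<open>p\<close> force \<open>f\<close> to have the boundary value \<open>p\<close> inside the arc. The two-constants estimate is
applied to both signs of each component of \<open>f - p\<close>.\<close>

lemma cluster_singleton_of_low_paths:
  fixes f :: "complex \<Rightarrow> real ^ 'n"
  assumes harm: "\<And>j. harmonic_on (\<lambda>z. f z $ j) (ball 0 1)"
    and K: "compact K" "f ` ball 0 1 \<subseteq> K" and d: "d > 0"
    and paths: "\<And>e. e > 0 \<Longrightarrow> \<exists>\<eta>. path \<eta> \<and> Re (pathstart \<eta>) \<le> c - d \<and> c + d \<le> Re (pathfinish \<eta>) \<and>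
      (\<forall>\<tau>\<in>path_image \<eta>. 0 < Im \<tau> \<and> Im \<tau> < e \<and> dist (f (exp (\<i> * \<tau>))) p < e)"
  shows "cluster_set f (cis c) = {p}"
proof -
  let ?E = "\<lambda>\<tau>. f (exp (\<i> * \<tau>))"
  obtain M where M: "\<And>y. y \<in> K \<Longrightarrow> norm (y - p) \<le> M"
  proof -
    have "bounded ((\<lambda>y. y - p) ` K)"
      using K(1) by (intro compact_imp_bounded compact_continuous_image continuous_intros)
    then show ?thesis using that by (auto simp: bounded_iff)
  qed
  have EK: "?E \<tau> \<in> K" if "0 < Im \<tau>" for \<tau>
    using K(2) exp_ii_in_disc[of \<tau>] that by blast
  define M' where "M' = max M 0"
  define \<omega> where "\<omega> = (\<lambda>\<tau>. M' * (((Re \<tau> - c)\<^sup>2 - (Im \<tau>)\<^sup>2 + 2 * d * Im \<tau>) / d\<^sup>2))"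
  have est: "\<bar>?E \<sigma> $ j - p $ j\<bar> \<le> \<omega> \<sigma>" if \<sigma>: "\<bar>Re \<sigma> - c\<bar> < d" "0 < Im \<sigma>" "Im \<sigma> < d" for \<sigma> j
  proof -
    obtain F where F: "F holomorphic_on ball 0 1" "\<And>z. z \<in> ball 0 1 \<Longrightarrow> Re (F z) = f z $ j"
      using harmonic_on_Re_holomorphic[OF harm convex_ball] by blast
    have holo: "(\<lambda>\<tau>. of_real m * (F (exp (\<i> * \<tau>)) - of_real (p $ j))) holomorphic_on {\<tau>. Im \<tau> > 0}" for m
    proof (intro holomorphic_intros)
      show "(\<lambda>\<tau>. F (exp (\<i> * \<tau>))) holomorphic_on {\<tau>. 0 < Im \<tau>}"
        by (rule holomorphic_on_compose_gen[OF _ F(1), unfolded comp_def])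
          (intro holomorphic_intros, use exp_ii_in_disc in blast)
    qed
    have ReF: "Re (of_real m * (F (exp (\<i> * \<tau>)) - of_real (p $ j))) = m * (?E \<tau> $ j - p $ j)" if "0 < Im \<tau>" for m \<tau>
      using F(2)[of "exp (\<i> * \<tau>)"] exp_ii_in_disc[of \<tau>] that by simp
    have comp: "\<bar>?E \<tau> $ j - p $ j\<bar> \<le> dist (?E \<tau>) p" for \<tau>
      using component_le_norm_cart[of "?E \<tau> - p" j] by (simp add: dist_norm)
    have "m * (?E \<sigma> $ j - p $ j) \<le> \<omega> \<sigma>" if m: "\<bar>m\<bar> = 1" for m
    proof -
      have le: "m * x \<le> \<bar>x\<bar>" for x :: real using m by (metis abs_ge_self abs_mult mult_1)
      have "Re (of_real m * (F (exp (\<i> * \<sigma>)) - of_real (p $ j))) \<le> \<omega> \<sigma>"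
        unfolding \<omega>_def
      proof (rule bound_above_low_paths[OF holo _ _ d _ \<sigma>])
        show "Re (of_real m * (F (exp (\<i> * \<tau>)) - of_real (p $ j))) \<le> M'" if "0 < Im \<tau>" for \<tau>
        proof -
          have "M \<le> M'" by (simp add: M'_def)
          then show ?thesis
            using ReF[OF that, of m] le[of "?E \<tau> $ j - p $ j"] comp[of \<tau>] M[OF EK[OF that]]
            unfolding dist_norm by linarith
        qed
        show "\<exists>\<eta>. path \<eta> \<and> Re (pathstart \<eta>) \<le> c - d \<and> c + d \<le> Re (pathfinish \<eta>) \<and>
          (\<forall>\<tau>\<in>path_image \<eta>. 0 < Im \<tau> \<and> Im \<tau> < e \<and> Re (of_real m * (F (exp (\<i> * \<tau>)) - of_real (p $ j))) < e)"
          if e: "e > 0" for e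
        proof -
          obtain \<eta> where \<eta>: "path \<eta>" "Re (pathstart \<eta>) \<le> c - d" "c + d \<le> Re (pathfinish \<eta>)"
            "\<forall>\<tau>\<in>path_image \<eta>. 0 < Im \<tau> \<and> Im \<tau> < e \<and> dist (?E \<tau>) p < e" using paths[OF e] by blast
          have "Re (of_real m * (F (exp (\<i> * \<tau>)) - of_real (p $ j))) < e" if "\<tau> \<in> path_image \<eta>" for \<tau>
            using ReF[of \<tau> m] \<eta>(4) that le[of "?E \<tau> $ j - p $ j"] comp[of \<tau>] by fastforce
          then show ?thesis using \<eta> by blast
        qed
      qed (simp add: M'_def)
      then show ?thesis unfolding ReF[OF \<sigma>(2)] .
    qed
    from this[of 1] this[of "-1"] show ?thesis by auto
  qed
  have "\<alpha> = p" if \<alpha>: "\<alpha> \<in> cluster_set f (cis c)" for \<alpha>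
  proof -
    have "\<bar>\<alpha> $ j - p $ j\<bar> \<le> 0" for j
    proof -
      have "\<forall>n. \<exists>\<tau>. 0 < Im \<tau> \<and> dist \<tau> (of_real c) < d / real (Suc n) \<and> dist (?E \<tau>) \<alpha> < d / real (Suc n)"
        using \<alpha> d unfolding cluster_set_cis_iff by simp
      then obtain \<tau> where \<tau>: "\<And>n. 0 < Im (\<tau> n)" "\<And>n. dist (\<tau> n) (of_real c) < d / real (Suc n)"
        "\<And>n. dist (?E (\<tau> n)) \<alpha> < d / real (Suc n)" by metis
      have l0: "(\<lambda>n. d / real (Suc n)) \<longlonglongrightarrow> 0"
        using tendsto_mult_right_zero[OF lim_1_over_n[THEN LIMSEQ_Suc], of d] by simp
      have \<tau>l: "\<tau> \<longlonglongrightarrow> of_real c" and El: "(\<lambda>n. ?E (\<tau> n)) \<longlonglongrightarrow> \<alpha>"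
        by (rule metric_tendsto_imp_tendsto[OF l0], use \<tau> d in \<open>auto intro!: always_eventually less_imp_le\<close>)+
      have "(\<lambda>n. \<omega> (\<tau> n)) \<longlonglongrightarrow> \<omega> (of_real c)"
        unfolding \<omega>_def by (intro tendsto_intros \<tau>l) (use d in simp)
      then have \<omega>l: "(\<lambda>n. \<omega> (\<tau> n)) \<longlonglongrightarrow> 0" by (simp add: \<omega>_def)
      have "\<bar>?E (\<tau> n) $ j - p $ j\<bar> \<le> \<omega> (\<tau> n)" for n
      proof (rule est)
        have "d / real (Suc n) \<le> d" using d by (simp add: field_simps)
        then have "cmod (\<tau> n - of_real c) < d" using \<tau>(2)[of n] by (simp add: dist_norm)
        then show "\<bar>Re (\<tau> n) - c\<bar> < d" "Im (\<tau> n) < d"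
          using abs_Re_le_cmod[of "\<tau> n - of_real c"] abs_Im_le_cmod[of "\<tau> n - of_real c"] by auto
      qed (rule \<tau>)
      then show ?thesis
        by (intro LIMSEQ_le[OF tendsto_rabs[OF tendsto_diff[OF tendsto_vec_nth[OF El] tendsto_const]] \<omega>l]) auto
    qed
    then show ?thesis by (simp add: vec_eq_iff)
  qed
  moreover have "cluster_set f (cis c) \<noteq> {}"
    by (rule cluster_set_nonempty[OF K]) simp
  ultimately show ?thesis by blast
qed

section \<open>Cluster values of harmonic homeomorphisms\<close>

locale harmonic_jordan_surface =
  fixes \<Phi> f :: "complex \<Rightarrow> real ^ 'n" and \<Sigma> \<Gamma> :: "(real ^ 'n) set"
    and \<Psi> g :: "real ^ 'n \<Rightarrow> complex"
  assumes param: "homeomorphism (cball 0 1) \<Sigma> \<Phi> \<Psi>"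
    and boundary: "\<Gamma> = \<Phi> ` sphere 0 1"
    and harmonic: "harmonic_on (\<lambda>z. f z $ j) (ball 0 1)"
    and homeo: "homeomorphism (ball 0 1) (\<Sigma> - \<Gamma>) f g"
begin

lemma compact_surface: "compact \<Sigma>"
  using param by (metis compact_cball compact_continuous_image homeomorphism_def)

lemma image_disc: "f ` ball 0 1 = \<Sigma> - \<Gamma>"
  using homeo by (simp add: homeomorphism_def)

lemma image_disc_subset: "f ` ball 0 1 \<subseteq> \<Sigma>"
  using image_disc by blast

lemma continuous_disc: "continuous_on (ball 0 1) f"
  using homeo by (simp add: homeomorphism_def)

lemma inverse_param: "w \<in> cball 0 1 \<Longrightarrow> \<Psi> (\<Phi> w) = w" "x \<in> \<Sigma> \<Longrightarrow> \<Phi> (\<Psi> x) = x"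
  using param by (auto simp: homeomorphism_def)

lemma inverse_map: "z \<in> ball 0 1 \<Longrightarrow> g (f z) = z" "x \<in> \<Sigma> - \<Gamma> \<Longrightarrow> f (g x) = x"
  using homeo by (simp_all add: homeomorphism_def)

lemma boundary_subset: "\<Gamma> \<subseteq> \<Sigma>"
  using param unfolding boundary homeomorphism_def by auto

lemma param_interior: "\<Phi> ` ball 0 1 = \<Sigma> - \<Gamma>"
proof -
  have "inj_on \<Phi> (cball 0 1)" by (rule inj_on_inverseI[of _ \<Psi>]) (rule inverse_param)
  then have "\<Phi> ` (cball 0 1 - sphere 0 1) = \<Phi> ` cball 0 1 - \<Phi> ` sphere 0 1"
    by (rule inj_on_image_set_diff) auto
  moreover have "cball 0 1 - sphere 0 1 = ball (0::complex) 1" by auto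
  ultimately show ?thesis using param unfolding boundary homeomorphism_def by simp
qed

text \<open>A homeomorphism is proper: if \<open>f (w n)\<close> converged to a point of the open surface, then \<open>w n\<close>
would converge to its preimage in the open disk.\<close>

lemma cluster_set_subset_boundary:
  assumes "z \<in> sphere 0 1"
  shows "cluster_set f z \<subseteq> \<Gamma>"
proof
  fix \<alpha> assume "\<alpha> \<in> cluster_set f z"
  then obtain w where w: "\<And>n. w n \<in> ball 0 1" "w \<longlonglongrightarrow> z" "(\<lambda>n. f (w n)) \<longlonglongrightarrow> \<alpha>"
    by (auto simp: cluster_set_def)
  have "\<alpha> \<in> \<Sigma>"
    by (rule closed_sequentially[OF compact_imp_closed[OF compact_surface] _ w(3)])
      (use w(1) image_disc_subset in blast)
  show "\<alpha> \<in> \<Gamma>"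
  proof (rule ccontr)
    assume "\<alpha> \<notin> \<Gamma>"
    with \<open>\<alpha> \<in> \<Sigma>\<close> have \<alpha>: "\<alpha> \<in> \<Sigma> - \<Gamma>" by blast
    have "continuous_on (\<Sigma> - \<Gamma>) g" using homeo by (simp add: homeomorphism_def)
    then have "(\<lambda>n. g (f (w n))) \<longlonglongrightarrow> g \<alpha>"
      by (rule continuous_on_tendsto_compose[OF _ w(3) \<alpha>])
        (use w(1) image_disc in \<open>blast intro: always_eventually\<close>)
    then have "w \<longlonglongrightarrow> g \<alpha>" using w(1) by (simp add: inverse_map)
    then have "g \<alpha> = z" using w(2) LIMSEQ_unique by blast
    moreover have "g \<alpha> \<in> ball 0 1" using homeo \<alpha> by (auto simp: homeomorphism_def)
    ultimately show False using assms by simp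
  qed
qed

text \<open>Points of the surface close to \<open>p\<close> correspond under \<open>\<Phi>\<close> to points of the disk close to one boundary
point \<open>w\<close>, and there two of them can be joined by a straight line. Pulled back by \<open>f\<close>, this line
is a curve close to the unit circle on which \<open>f\<close> is close to \<open>p\<close>. The integer \<open>k\<close> counts the
turns that its lift to the upper half-plane makes around the circle.\<close>

lemma paths_between_cluster_points:
  assumes p: "p \<in> cluster_set f (cis s)" "p \<in> cluster_set f (cis s')" and e: "e > 0"
  shows "\<exists>\<eta> (k::int). path \<eta> \<and> dist (pathstart \<eta>) (of_real s) < e \<and>
    dist (pathfinish \<eta>) (of_real (s' + 2 * pi * of_int k)) < e \<and>
    (\<forall>\<tau>\<in>path_image \<eta>. 0 < Im \<tau> \<and> Im \<tau> < e \<and> dist (f (exp (\<i> * \<tau>))) p < e)"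
proof -
  \<comment> \<open>A curve on which \<open>f\<close> avoids \<open>Q\<close> stays close to the unit circle.\<close>
  define Q where "Q = f ` cball 0 (exp (- e))"
  have "exp (- e) < 1" using e by simp
  have sub: "cball 0 (exp (- e)) \<subseteq> ball (0::complex) 1"
  proof
    fix x :: complex assume "x \<in> cball 0 (exp (- e))"
    then have "norm x < 1" using \<open>exp (- e) < 1\<close> by (simp only: mem_cball_0)
    then show "x \<in> ball 0 1" by simp
  qed
  have "compact Q" unfolding Q_def
    by (intro compact_continuous_image continuous_on_subset[OF continuous_disc sub]) simp
  have p\<Gamma>: "p \<in> \<Gamma>" using cluster_set_subset_boundary[of "cis s"] p(1) by auto
  have "p \<notin> Q" using p\<Gamma> sub image_disc unfolding Q_def by blast
  then obtain e1 where e1: "e1 > 0" "\<And>x. dist x p < e1 \<Longrightarrow> x \<notin> Q"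
    using open_Compl[OF compact_imp_closed[OF \<open>compact Q\<close>]] unfolding open_dist by (metis ComplD ComplI)
  define w where "w = \<Psi> p"
  have w: "w \<in> cball 0 1" "\<Phi> w = p"
    using param p\<Gamma> boundary_subset by (auto simp: w_def homeomorphism_def)
  have "continuous_on (cball 0 1) \<Phi>" using param by (simp add: homeomorphism_def)
  then obtain r where r: "r > 0" "\<And>v. v \<in> cball 0 1 \<Longrightarrow> dist v w < r \<Longrightarrow> dist (\<Phi> v) p < min e e1"
    unfolding continuous_on_iff using w e e1(1) by (metis min_less_iff_conj)
  have "continuous_on \<Sigma> \<Psi>" using param by (simp add: homeomorphism_def)
  then obtain e2 where e2: "e2 > 0" "\<And>x. x \<in> \<Sigma> \<Longrightarrow> dist x p < e2 \<Longrightarrow> dist (\<Psi> x) w < r"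
    unfolding continuous_on_iff w_def using p\<Gamma> boundary_subset r(1) by (metis subsetD)
  have "min e e2 > 0" using e e2(1) by simp
  then obtain \<tau>0 \<tau>1 where \<tau>0: "0 < Im \<tau>0" "dist \<tau>0 (of_real s) < min e e2" "dist (f (exp (\<i> * \<tau>0))) p < min e e2"
    and \<tau>1: "0 < Im \<tau>1" "dist \<tau>1 (of_real s') < min e e2" "dist (f (exp (\<i> * \<tau>1))) p < min e e2"
    using p unfolding cluster_set_cis_iff by meson
  define v where "v = (\<lambda>\<tau>. \<Psi> (f (exp (\<i> * \<tau>))))"
  have v: "v \<tau> \<in> ball 0 1 \<inter> ball w r" "g (\<Phi> (v \<tau>)) = exp (\<i> * \<tau>)"
    if "0 < Im \<tau>" "dist (f (exp (\<i> * \<tau>))) p < min e e2" for \<tau>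
  proof -
    have z: "exp (\<i> * \<tau>) \<in> ball 0 1" using that exp_ii_in_disc by blast
    then have "f (exp (\<i> * \<tau>)) \<in> \<Phi> ` ball 0 1" unfolding param_interior image_disc[symmetric] by blast
    then obtain b where b: "b \<in> ball 0 1" "f (exp (\<i> * \<tau>)) = \<Phi> b" by blast
    then have "v \<tau> = b" using inverse_param(1)[of b] by (simp add: v_def)
    moreover have "f (exp (\<i> * \<tau>)) \<in> \<Sigma>" using z image_disc_subset by blast
    ultimately show "v \<tau> \<in> ball 0 1 \<inter> ball w r" using b(1) e2(2)[of "f (exp (\<i> * \<tau>))"] that(2)
      by (simp add: v_def dist_commute)
    show "g (\<Phi> (v \<tau>)) = exp (\<i> * \<tau>)" using \<open>v \<tau> = b\<close> b(2) inverse_map(1)[OF z] by simp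
  qed
  define \<zeta> where "\<zeta> = (\<lambda>t. g (\<Phi> (linepath (v \<tau>0) (v \<tau>1) t)))"
  have line: "linepath (v \<tau>0) (v \<tau>1) t \<in> ball 0 1 \<inter> ball w r" if "t \<in> {0..1}" for t
  proof -
    have "closed_segment (v \<tau>0) (v \<tau>1) \<subseteq> ball 0 1 \<inter> ball w r"
      by (rule closed_segment_subset) (use v \<tau>0 \<tau>1 in \<open>auto intro!: convex_Int\<close>)
    moreover have "linepath (v \<tau>0) (v \<tau>1) t \<in> closed_segment (v \<tau>0) (v \<tau>1)"
      using that path_image_linepath[of "v \<tau>0" "v \<tau>1"] by (auto simp: path_image_def)
    ultimately show ?thesis by blast
  qed
  have \<Phi>line: "\<Phi> (linepath (v \<tau>0) (v \<tau>1) t) \<in> \<Sigma> - \<Gamma>" "dist (\<Phi> (linepath (v \<tau>0) (v \<tau>1) t)) p < min e e1"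
    if "t \<in> {0..1}" for t
  proof -
    show "\<Phi> (linepath (v \<tau>0) (v \<tau>1) t) \<in> \<Sigma> - \<Gamma>" using line[OF that] param_interior by blast
    show "dist (\<Phi> (linepath (v \<tau>0) (v \<tau>1) t)) p < min e e1"
      by (rule r(2)) (use line[OF that] in \<open>auto simp: dist_commute\<close>)
  qed
  have f\<zeta>: "f (\<zeta> t) = \<Phi> (linepath (v \<tau>0) (v \<tau>1) t)" if "t \<in> {0..1}" for t
    unfolding \<zeta>_def using \<Phi>line[OF that] inverse_map(2) by blast
  have \<zeta>_ball: "\<zeta> t \<in> ball 0 1" if "t \<in> {0..1}" for t
    unfolding \<zeta>_def using \<Phi>line(1)[OF that] homeo unfolding homeomorphism_def by blast
  have \<zeta>_big: "exp (- e) < norm (\<zeta> t)" if "t \<in> {0..1}" for t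
  proof (rule ccontr)
    assume "\<not> exp (- e) < norm (\<zeta> t)"
    then have "f (\<zeta> t) \<in> Q" by (auto simp: Q_def)
    then show False using f\<zeta>[OF that] \<Phi>line(2)[OF that] e1(2) by simp
  qed
  have "continuous_on (\<Sigma> - \<Gamma>) g" using homeo by (simp add: homeomorphism_def)
  moreover have "continuous_on {0..1} (\<lambda>t. \<Phi> (linepath (v \<tau>0) (v \<tau>1) t))"
    by (rule continuous_on_compose2[OF \<open>continuous_on (cball 0 1) \<Phi>\<close> continuous_on_linepath])
      (use line in \<open>force\<close>)
  ultimately have "continuous_on {0..1} \<zeta>" unfolding \<zeta>_def
    by (rule continuous_on_compose2) (use \<Phi>line(1) in blast)
  moreover have "contractible {0..1::real}" by (intro convex_imp_contractible convex_real_interval)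
  moreover have "\<zeta> t \<noteq> 0" if "t \<in> {0..1}" for t
    using \<zeta>_big[OF that] exp_gt_zero[of "- e"] by (metis norm_zero order_less_asym)
  ultimately obtain l where l: "continuous_on {0..1} l" "\<And>t. t \<in> {0..1} \<Longrightarrow> \<zeta> t = exp (l t)"
    using continuous_logarithm_on_contractible by metis
  \<comment> \<open>The lift of \<open>\<zeta>\<close> that starts at \<open>\<tau>0\<close>.\<close>
  define \<eta> where "\<eta> = (\<lambda>t. \<tau>0 - \<i> * (l t - l 0))"
  have \<zeta>0: "\<zeta> 0 = exp (\<i> * \<tau>0)" and \<zeta>1: "\<zeta> 1 = exp (\<i> * \<tau>1)"
    unfolding \<zeta>_def linepath_def using v(2)[OF \<tau>0(1,3)] v(2)[OF \<tau>1(1,3)] by simp_all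
  have exp_\<eta>: "exp (\<i> * \<eta> t) = \<zeta> t" if "t \<in> {0..1}" for t
  proof -
    have "\<i> * \<eta> t = \<i> * \<tau>0 + (l t - l 0)" by (simp add: \<eta>_def algebra_simps)
    then have "exp (\<i> * \<eta> t) = \<zeta> 0 * (exp (l t) / exp (l 0))" by (simp add: exp_add exp_diff \<zeta>0)
    also have "\<dots> = \<zeta> t" using l(2)[OF that] l(2)[of 0] by simp
    finally show ?thesis .
  qed
  have "path \<eta>" unfolding path_def \<eta>_def by (intro continuous_intros l)
  moreover have "dist (pathstart \<eta>) (of_real s) < e" using \<tau>0 by (simp add: pathstart_def \<eta>_def)
  moreover have "\<exists>k::int. dist (pathfinish \<eta>) (of_real (s' + 2 * pi * of_int k)) < e"
  proof -
    have "exp (\<i> * \<eta> 1) = exp (\<i> * \<tau>1)" using exp_\<eta>[of 1] \<zeta>1 by simp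
    then obtain k :: int where "\<i> * \<eta> 1 = \<i> * \<tau>1 + (of_int (2 * k) * pi) * \<i>"
      unfolding exp_eq by blast
    then have "\<i> * \<eta> 1 = \<i> * (\<tau>1 + of_real (2 * pi * of_int k))" by (simp add: algebra_simps)
    then have "\<eta> 1 = \<tau>1 + of_real (2 * pi * of_int k)" by simp
    then have "dist (pathfinish \<eta>) (of_real (s' + 2 * pi * of_int k)) < e"
      using \<tau>1(2) by (simp add: pathfinish_def dist_norm)
    then show ?thesis ..
  qed
  moreover have "0 < Im \<tau> \<and> Im \<tau> < e \<and> dist (f (exp (\<i> * \<tau>))) p < e" if "\<tau> \<in> path_image \<eta>" for \<tau>
  proof -
    from that obtain t where t: "t \<in> {0..1}" "\<tau> = \<eta> t" by (auto simp: path_image_def)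
    have "exp (- e) < exp (- Im \<tau>)" using \<zeta>_big[OF t(1)] exp_\<eta>[OF t(1)] t(2)
      by (metis exp_ii_in_disc norm_exp_eq_Re Re_i_times)
    then have "Im \<tau> < e" by simp
    moreover have "0 < Im \<tau>" using \<zeta>_ball[OF t(1)] exp_\<eta>[OF t(1)] t(2) exp_ii_in_disc by metis
    moreover have "dist (f (exp (\<i> * \<tau>))) p < e"
      using exp_\<eta>[OF t(1)] f\<zeta>[OF t(1)] \<Phi>line(2)[OF t(1)] t(2) by simp
    ultimately show ?thesis by blast
  qed
  ultimately show ?thesis by blast
qed

text \<open>A general homeomorphism of the disk may have large overlapping cluster sets; harmonicity excludes
this. The curves of the preceding lemma have lifts that sweep over the interval from \<open>s\<close> to \<open>s'\<close> if \<open>k \<ge> 0\<close>,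
and over the interval from \<open>s' - 2\<pi>\<close> to \<open>s\<close> if \<open>k < 0\<close>. One of the two cases occurs for
arbitrarily small \<open>e\<close>, and on the corresponding arc \<open>f\<close> has the boundary value \<open>p\<close>.\<close>

lemma shared_cluster_value:
  assumes s: "s < s'" "s' < s + 2 * pi" and p: "p \<in> cluster_set f (cis s)" "p \<in> cluster_set f (cis s')"
  shows "(\<forall>c\<in>{s<..<s'}. cluster_set f (cis c) = {p}) \<or> (\<forall>c\<in>{s'<..<s + 2 * pi}. cluster_set f (cis c) = {p})"
proof -
  define good where "good = (\<lambda>e \<eta> (k::int). path \<eta> \<and> dist (pathstart \<eta>) (of_real s) < e \<and>
    dist (pathfinish \<eta>) (of_real (s' + 2 * pi * of_int k)) < e \<and>
    (\<forall>\<tau>\<in>path_image \<eta>. 0 < Im \<tau> \<and> Im \<tau> < e \<and> dist (f (exp (\<i> * \<tau>))) p < e))"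
  have good_mono: "good e' \<eta> k" if "good e \<eta> k" "e \<le> e'" for e e' \<eta> k
    using that by (force simp: good_def)
  have ends: "\<bar>Re (pathstart \<eta>) - s\<bar> < e" "\<bar>Re (pathfinish \<eta>) - (s' + 2 * pi * of_int k)\<bar> < e"
    if "good e \<eta> k" for e \<eta> k
    using that abs_Re_le_cmod[of "pathstart \<eta> - of_real s"]
      abs_Re_le_cmod[of "pathfinish \<eta> - of_real (s' + 2 * pi * of_int k)"]
    by (auto simp: good_def dist_norm)
  consider "\<forall>e>0. \<exists>\<eta> k. good e \<eta> k \<and> k \<ge> 0" | "\<forall>e>0. \<exists>\<eta> k. good e \<eta> k \<and> k < 0"
  proof (cases "\<forall>e>0. \<exists>\<eta> k. good e \<eta> k \<and> k \<ge> 0")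
    case False
    then obtain e0 where e0: "e0 > 0" "\<And>\<eta> k. good e0 \<eta> k \<Longrightarrow> k < 0" by (meson not_le)
    have "\<exists>\<eta> k. good e \<eta> k \<and> k < 0" if "e > 0" for e
    proof -
      have "min e e0 > 0" using that e0 by simp
      then obtain \<eta> k where "good (min e e0) \<eta> k"
        using paths_between_cluster_points[OF p] unfolding good_def by blast
      then have "good e \<eta> k" "good e0 \<eta> k" by (auto intro: good_mono)
      then show ?thesis using e0(2) by blast
    qed
    then show ?thesis using that by blast
  qed (use that in blast)
  then show ?thesis
  proof cases
    case 1
    have "cluster_set f (cis c) = {p}" if c: "s < c" "c < s'" for c
    proof (rule cluster_singleton_of_low_paths[OF harmonic compact_surface image_disc_subset])
      define d where "d = min (c - s) (s' - c) / 2"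
      show d: "d > 0" using c by (simp add: d_def)
      have d2: "s + d \<le> c - d" "c + d \<le> s' - d" by (auto simp: d_def min_def field_simps)
      show "\<exists>\<eta>. path \<eta> \<and> Re (pathstart \<eta>) \<le> c - d \<and> c + d \<le> Re (pathfinish \<eta>) \<and>
          (\<forall>\<tau>\<in>path_image \<eta>. 0 < Im \<tau> \<and> Im \<tau> < e \<and> dist (f (exp (\<i> * \<tau>))) p < e)" if "e > 0" for e
      proof -
        have "min e d > 0" using that d by simp
        then obtain \<eta> k where \<eta>: "good (min e d) \<eta> k" "k \<ge> 0" using 1 by blast
        have "0 \<le> 2 * pi * of_int k" using \<eta>(2) by simp
        then have "Re (pathstart \<eta>) \<le> c - d" "c + d \<le> Re (pathfinish \<eta>)"
          using ends[OF \<eta>(1)] d2 by linarith+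
        then show ?thesis using \<eta>(1) unfolding good_def by (intro exI[of _ \<eta>]) auto
      qed
    qed
    then show ?thesis by auto
  next
    case 2
    have "cluster_set f (cis c) = {p}" if c: "s' < c" "c < s + 2 * pi" for c
    proof -
      have "cluster_set f (cis (c - 2 * pi)) = {p}"
      proof (rule cluster_singleton_of_low_paths[OF harmonic compact_surface image_disc_subset])
        define d where "d = min (c - s') (s + 2 * pi - c) / 2"
        show d: "d > 0" using c by (simp add: d_def)
        have d2: "s' - 2 * pi + d \<le> c - 2 * pi - d" "c - 2 * pi + d \<le> s - d" by (auto simp: d_def min_def field_simps)
        show "\<exists>\<eta>. path \<eta> \<and> Re (pathstart \<eta>) \<le> c - 2 * pi - d \<and> c - 2 * pi + d \<le> Re (pathfinish \<eta>) \<and>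
            (\<forall>\<tau>\<in>path_image \<eta>. 0 < Im \<tau> \<and> Im \<tau> < e \<and> dist (f (exp (\<i> * \<tau>))) p < e)" if "e > 0" for e
        proof -
          have "min e d > 0" using that d by simp
          then obtain \<eta> k where \<eta>: "good (min e d) \<eta> k" "k < 0" using 2 by blast
          have "of_int k \<le> (-1::real)" using \<eta>(2) by linarith
          then have "2 * pi * of_int k \<le> 2 * pi * (-1)" by (intro mult_left_mono) auto
          then have "Re (pathfinish \<eta>) \<le> c - 2 * pi - d" "c - 2 * pi + d \<le> Re (pathstart \<eta>)"
            using ends[OF \<eta>(1)] d2 by linarith+
          then show ?thesis using \<eta>(1) unfolding good_def by (intro exI[of _ "reversepath \<eta>"]) auto
        qed
      qed
      moreover have "cis (c - 2 * pi) = cis c" by (simp add: complex_eq_iff cos_diff sin_diff)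
      ultimately show ?thesis by simp
    qed
    then show ?thesis by auto
  qed
qed

end

section \<open>Connected subsets of a rectifiable Jordan curve\<close>

lemma dist_le_sum_dist:
  fixes g :: "nat \<Rightarrow> 'a::metric_space"
  assumes "k \<le> l"
  shows "dist (g k) (g l) \<le> (\<Sum>j=k..<l. dist (g j) (g (Suc j)))"
  using assms
proof (induction l rule: dec_induct)
  case (step n)
  then show ?case using dist_triangle[of "g k" "g (Suc n)" "g n"] by simp
qed simp

text \<open>Removing two points from a Jordan curve disconnects it, so a connected set cannot miss a point on
each of the two arcs between two of its own points.\<close>

lemma simple_loop_separation:
  fixes \<gamma> :: "real \<Rightarrow> 'a::t2_space"
  assumes \<gamma>: "simple_path \<gamma>" and S: "connected S" "S \<subseteq> path_image \<gamma>"
    and c: "0 \<le> c" "c < a" "a < c'" "c' \<le> 1" "\<gamma> c \<notin> S" "\<gamma> c' \<notin> S" "\<gamma> a \<in> S"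
    and b: "0 \<le> b" "b \<le> 1" "b < c \<or> c' < b"
  shows "\<gamma> b \<notin> S"
proof
  assume bS: "\<gamma> b \<in> S"
  define A where "A = \<gamma> ` {c..c'}"
  define B where "B = \<gamma> ` ({0..c} \<union> {c'..1})"
  have cont: "continuous_on {0..1} \<gamma>" using \<gamma> by (simp add: simple_path_def path_def)
  have inj: "x = y \<or> x = 0 \<and> y = 1 \<or> x = 1 \<and> y = 0" if "x \<in> {0..1}" "y \<in> {0..1}" "\<gamma> x = \<gamma> y" for x y
    using \<gamma> that by (auto simp: simple_path_def loop_free_def)
  have "closed A" unfolding A_def
    by (intro compact_imp_closed compact_continuous_image continuous_on_subset[OF cont]) (use c in auto)
  moreover have "closed B" unfolding B_def
    by (intro compact_imp_closed compact_continuous_image continuous_on_subset[OF cont] compact_Un) (use c in auto)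
  moreover have "S \<subseteq> A \<union> B"
  proof
    fix w assume "w \<in> S"
    then obtain x where "x \<in> {0..1}" "w = \<gamma> x" using S by (auto simp: path_image_def)
    moreover from this have "x \<in> {c..c'} \<or> x \<in> {0..c} \<union> {c'..1}" by auto
    ultimately show "w \<in> A \<union> B" unfolding A_def B_def by blast
  qed
  moreover have "A \<inter> B \<inter> S = {}"
  proof (rule ccontr)
    assume "A \<inter> B \<inter> S \<noteq> {}"
    then obtain w where w: "w \<in> A" "w \<in> B" "w \<in> S" by blast
    then obtain s t where st: "s \<in> {c..c'}" "t \<in> {0..c} \<union> {c'..1}" "\<gamma> s = \<gamma> t" "\<gamma> s \<in> S"
      unfolding A_def B_def by (metis (no_types, lifting) imageE)
    have "s = t \<or> s = 0 \<and> t = 1 \<or> s = 1 \<and> t = 0" by (rule inj) (use st c in auto)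
    then have "s = c \<or> s = c'" using st c by auto
    then show False using st(4) c(5,6) by auto
  qed
  ultimately have "A \<inter> S = {} \<or> B \<inter> S = {}"
    using connected_closedD[OF S(1)] by blast
  moreover have "\<gamma> a \<in> A" "\<gamma> b \<in> B" using c b by (auto simp: A_def B_def)
  ultimately show False using c(7) bS by blast
qed

text \<open>Of the two arcs into which two points of \<open>S\<close> divide the curve, at least one lies in \<open>S\<close>, and the
distance of the two points is at most the length of the polygon inscribed in this arc.\<close>

lemma dist_le_sum_over_covered_arcs:
  fixes \<gamma> :: "real \<Rightarrow> 'a::metric_space"
  assumes \<gamma>: "simple_path \<gamma>" "pathfinish \<gamma> = pathstart \<gamma>" and S: "connected S" "S \<subseteq> path_image \<gamma>"
    and y: "\<And>i j. i < j \<Longrightarrow> j \<le> N \<Longrightarrow> y i < y j" "y 0 = 0" "y N = 1"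
    and kl: "k \<le> N" "l \<le> N" "\<gamma> (y k) \<in> S" "\<gamma> (y l) \<in> S"
  shows "dist (\<gamma> (y k)) (\<gamma> (y l)) \<le>
    (\<Sum>j\<in>{j\<in>{..<N}. \<gamma> ` {y j<..<y (Suc j)} \<subseteq> S}. dist (\<gamma> (y j)) (\<gamma> (y (Suc j))))"
  using kl
proof (induction k l rule: linorder_wlog)
  case (sym k l)
  then show ?case by (simp add: dist_commute)
next
  case (le k l)
  let ?J = "{j\<in>{..<N}. \<gamma> ` {y j<..<y (Suc j)} \<subseteq> S}"
  let ?D = "\<lambda>j. dist (\<gamma> (y j)) (\<gamma> (y (Suc j)))"
  have y_mono: "y i \<le> y j" if "i \<le> j" "j \<le> N" for i j
    using y(1)[of i j] that by (cases "i = j") auto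
  show ?case
  proof (cases "{k..<l} \<subseteq> ?J")
    case True
    have "dist (\<gamma> (y k)) (\<gamma> (y l)) \<le> sum ?D {k..<l}"
      using dist_le_sum_dist[OF \<open>k \<le> l\<close>, of "\<lambda>j. \<gamma> (y j)"] by simp
    also have "\<dots> \<le> sum ?D ?J" by (rule sum_mono2) (use True in auto)
    finally show ?thesis .
  next
    case False
    then obtain j c where j: "k \<le> j" "j < l" and c: "y j < c" "c < y (Suc j)" "\<gamma> c \<notin> S"
      using le by (auto simp: subset_iff)
    have c_kl: "y k < c" "c < y l" "0 < c" "c < 1"
      using y_mono[of k j] y_mono[of "Suc j" l] y_mono[of 0 j] y_mono[of "Suc j" N] j c le y by auto
    have "{0..<k} \<union> {l..<N} \<subseteq> ?J"
    proof (rule ccontr)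
      assume "\<not> {0..<k} \<union> {l..<N} \<subseteq> ?J"
      then obtain j' where "j' \<in> {0..<k} \<union> {l..<N}" "j' \<notin> ?J" by blast
      then have j': "j' < N" "j' < k \<or> l \<le> j'" "\<not> \<gamma> ` {y j'<..<y (Suc j')} \<subseteq> S" using le by auto
      then obtain c' where c': "y j' < c'" "c' < y (Suc j')" "\<gamma> c' \<notin> S"
        by (auto simp: subset_iff)
      have "0 \<le> y j'" "y (Suc j') \<le> 1" using y_mono[of 0 j'] y_mono[of "Suc j'" N] j' y by auto
      then have c'01: "0 < c'" "c' < 1" using c' by auto
      have yk: "0 \<le> y k" "y k \<le> 1" "0 \<le> y l" "y l \<le> 1"
        using y_mono[of 0 k] y_mono[of k N] y_mono[of 0 l] y_mono[of l N] le y by auto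
      show False
      proof (cases "j' < k")
        case True
        then have "c' < y k" using y_mono[of "Suc j'" k] le c' by auto
        then show False
          using simple_loop_separation[OF \<gamma>(1) S, of c' "y k" c "y l"] c_kl c c' c'01 yk le by auto
      next
        case False
        then have "y l < c'" using y_mono[of l j'] j' c' by auto
        then show False
          using simple_loop_separation[OF \<gamma>(1) S, of c "y l" c' "y k"] c_kl c c' c'01 yk le by auto
      qed
    qed
    then have J: "{0..<k} \<union> {l..<N} \<subseteq> ?J" .
    have "\<gamma> (y 0) = \<gamma> (y N)" using \<gamma>(2) y by (simp add: pathfinish_def pathstart_def)
    then have "dist (\<gamma> (y k)) (\<gamma> (y l)) \<le> dist (\<gamma> (y 0)) (\<gamma> (y k)) + dist (\<gamma> (y l)) (\<gamma> (y N))"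
      by (metis dist_commute dist_triangle3 add.commute)
    also have "\<dots> \<le> sum ?D {0..<k} + sum ?D {l..<N}"
      using dist_le_sum_dist[of 0 k "\<lambda>j. \<gamma> (y j)"] dist_le_sum_dist[of l N "\<lambda>j. \<gamma> (y j)"] le
      by (intro add_mono) auto
    also have "\<dots> = sum ?D ({0..<k} \<union> {l..<N})"
      using le by (intro sum.union_disjoint[symmetric]) auto
    also have "\<dots> \<le> sum ?D ?J" by (rule sum_mono2) (use J in auto)
    finally show ?thesis .
  qed
qed

text \<open>A curve of finite length cannot accommodate many connected sets of large diameter unless they overlap.
All the points \<open>p i\<close> and \<open>q i\<close> together cut the curve into small arcs; each of these is contained in at most \<open>m\<close> of
the sets, because it has infinitely many points and only finitely many are exceptional.\<close>

lemma sum_dist_connected_multiplicity: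
  fixes \<gamma> :: "real \<Rightarrow> 'a::metric_space"
  assumes \<gamma>: "simple_path \<gamma>" "pathfinish \<gamma> = pathstart \<gamma>"
    and B: "\<And>n (x :: nat \<Rightarrow> real). mono_on {..n} x \<Longrightarrow> x ` {..n} \<subseteq> {0..1} \<Longrightarrow>
      (\<Sum>i<n. dist (\<gamma> (x i)) (\<gamma> (x (Suc i)))) \<le> B"
    and I: "finite I" and S: "\<And>i. i \<in> I \<Longrightarrow> connected (S i)" "\<And>i. i \<in> I \<Longrightarrow> S i \<subseteq> path_image \<gamma>"
    and pq: "\<And>i. i \<in> I \<Longrightarrow> p i \<in> S i" "\<And>i. i \<in> I \<Longrightarrow> q i \<in> S i"
    and P: "finite P" "\<And>w. w \<in> path_image \<gamma> \<Longrightarrow> w \<notin> P \<Longrightarrow> card {i\<in>I. w \<in> S i} \<le> m"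
  shows "(\<Sum>i\<in>I. dist (p i) (q i)) \<le> real m * B"
proof -
  have "\<exists>s. s \<in> {0..1} \<and> \<gamma> s = w" if "w \<in> path_image \<gamma>" for w
    using that by (auto simp: path_image_def)
  then obtain \<pi> where \<pi>: "\<And>w. w \<in> path_image \<gamma> \<Longrightarrow> \<pi> w \<in> {0..1} \<and> \<gamma> (\<pi> w) = w" by metis
  define Y where "Y = insert 0 (insert 1 (\<pi> ` (p ` I \<union> q ` I)))"
  have Y: "finite Y" "Y \<subseteq> {0..1}" "0 \<in> Y" "1 \<in> Y"
    using I \<pi> S(2) pq by (auto simp: Y_def subset_iff)
  define ys where "ys = sorted_list_of_set Y"
  have ys: "set ys = Y" "sorted_wrt (<) ys" using Y by (auto simp: ys_def)
  define N where "N = length ys - 1"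
  have len: "length ys = Suc N" unfolding N_def using Y(3) ys(1) by (cases ys) auto
  define y where "y = (!) ys"
  have y_less: "y i < y j" if "i < j" "j \<le> N" for i j
    using sorted_wrt_nth_less[OF ys(2) that(1)] that len by (simp add: y_def)
  have y_mono: "y i \<le> y j" if "i \<le> j" "j \<le> N" for i j
    using y_less[of i j] that by (cases "i = j") auto
  have yY: "y i \<in> Y" if "i \<le> N" for i using that len ys(1) nth_mem[of i ys] by (auto simp: y_def)
  have ex: "\<exists>i\<le>N. y i = s" if "s \<in> Y" for s
    using that ys(1) len by (metis in_set_conv_nth less_Suc_eq_le y_def)
  have y0: "y 0 = 0" and yN: "y N = 1"
    using ex[OF Y(3)] ex[OF Y(4)] y_mono[of 0] y_mono[of _ N] yY[of 0] yY[of N] Y(2) by fastforce+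
  let ?D = "\<lambda>j. dist (\<gamma> (y j)) (\<gamma> (y (Suc j)))"
  define covers where "covers = (\<lambda>i j. \<gamma> ` {y j<..<y (Suc j)} \<subseteq> S i)"
  let ?J = "\<lambda>i. {j\<in>{..<N}. covers i j}"
  have "sum ?D {..<N} \<le> B"
    by (rule B) (use y_mono yY Y(2) in \<open>auto simp: mono_on_def\<close>)
  have each: "dist (p i) (q i) \<le> sum ?D (?J i)" if i: "i \<in> I" for i
  proof -
    have "p i \<in> path_image \<gamma>" "q i \<in> path_image \<gamma>" using S(2) pq i by auto
    moreover obtain k l where "k \<le> N" "y k = \<pi> (p i)" "l \<le> N" "y l = \<pi> (q i)"
      using ex[of "\<pi> (p i)"] ex[of "\<pi> (q i)"] i by (auto simp: Y_def)
    ultimately show ?thesis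
      using dist_le_sum_over_covered_arcs[OF \<gamma> S(1)[OF i] S(2)[OF i] y_less y0 yN, of k l] \<pi> pq i by (auto simp: covers_def)
  qed
  have mult: "card {i\<in>I. covers i j} \<le> m" if j: "j < N" for j
  proof -
    have "inj_on \<gamma> {y j<..<y (Suc j)}"
    proof (rule inj_onI)
      fix s t assume "s \<in> {y j<..<y (Suc j)}" "t \<in> {y j<..<y (Suc j)}" "\<gamma> s = \<gamma> t"
      moreover have "0 \<le> y j" "y (Suc j) \<le> 1" using yY[of j] yY[of "Suc j"] Y(2) j by auto
      ultimately show "s = t" using \<gamma>(1) by (fastforce simp: simple_path_def loop_free_def)
    qed
    moreover have "infinite {y j<..<y (Suc j)}" using y_less[of j "Suc j"] j by (simp add: infinite_Ioo)
    ultimately have "infinite (\<gamma> ` {y j<..<y (Suc j)})" by (simp add: finite_image_iff)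
    then obtain w where w: "w \<in> \<gamma> ` {y j<..<y (Suc j)}" "w \<notin> P"
      using P(1) by (meson finite_subset subsetI)
    have "w \<in> path_image \<gamma>"
      using w(1) yY[of j] yY[of "Suc j"] Y(2) j by (force simp: path_image_def)
    then have "card {i\<in>I. w \<in> S i} \<le> m" using P(2) w(2) by blast
    moreover have "card {i\<in>I. covers i j} \<le> card {i\<in>I. w \<in> S i}"
      by (rule card_mono) (use I w(1) in \<open>auto simp: covers_def\<close>)
    ultimately show ?thesis by linarith
  qed
  have "(\<Sum>i\<in>I. dist (p i) (q i)) \<le> (\<Sum>i\<in>I. sum ?D (?J i))" by (rule sum_mono) (rule each)
  also have "\<dots> = (\<Sum>i\<in>I. \<Sum>j<N. if covers i j then ?D j else 0)"
    by (intro sum.cong refl sum.inter_filter) simp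
  also have "\<dots> = (\<Sum>j<N. \<Sum>i\<in>I. if covers i j then ?D j else 0)" by (rule sum.swap)
  also have "\<dots> = (\<Sum>j<N. real (card {i\<in>I. covers i j}) * ?D j)"
    by (intro sum.cong refl) (simp add: sum.inter_filter[OF I, symmetric])
  also have "\<dots> \<le> (\<Sum>j<N. real m * ?D j)"
    by (intro sum_mono mult_right_mono) (use mult in auto)
  also have "\<dots> = real m * sum ?D {..<N}" by (simp add: sum_distrib_left)
  also have "\<dots> \<le> real m * B" using \<open>sum ?D {..<N} \<le> B\<close> by (intro mult_left_mono) auto
  finally show ?thesis .
qed

section \<open>Weakly monotone set-valued maps into a Jordan curve\<close>

lemma periodic_int_multiple:
  assumes "\<And>t::real. g (t + 2 * pi) = g t"
  shows "g (t + 2 * pi * of_int n) = g t"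
proof (induction n rule: int_induct[of _ 0])
  case (step1 i)
  then show ?case using assms[of "t + 2 * pi * of_int i"] by (simp add: algebra_simps)
next
  case (step2 i)
  then show ?case using assms[of "t + 2 * pi * of_int (i - 1)"] by (simp add: algebra_simps)
qed simp

lemma infinite_Rats_Ioo:
  assumes "u < (v::real)"
  shows "infinite (\<rat> \<inter> {u<..<v})"
proof
  assume fin: "finite (\<rat> \<inter> {u<..<v})"
  obtain q where "q \<in> \<rat>" "u < q" "q < v" using Rats_dense_in_real[OF assms] by blast
  then have ne: "\<rat> \<inter> {u<..<v} \<noteq> {}" by auto
  then have M: "Max (\<rat> \<inter> {u<..<v}) \<in> \<rat> \<inter> {u<..<v}" using Max_in[OF fin] by blast
  then obtain r where "r \<in> \<rat>" "Max (\<rat> \<inter> {u<..<v}) < r" "r < v"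
    using Rats_dense_in_real[of "Max (\<rat> \<inter> {u<..<v})" v] by auto
  moreover from this have "r \<in> \<rat> \<inter> {u<..<v}" using M by auto
  ultimately show False using Max_ge[OF fin] by fastforce
qed

text \<open>The two points divide the curve into two arcs; if one of them is not contained in \<open>S\<close>, the other is.\<close>

lemma connected_in_simple_loop_contains_arc:
  fixes \<gamma> :: "real \<Rightarrow> 'a::t2_space"
  assumes \<gamma>: "simple_path \<gamma>" "pathfinish \<gamma> = pathstart \<gamma>" and S: "connected S" "S \<subseteq> path_image \<gamma>"
    and pq: "p \<in> S" "q \<in> S" "p \<noteq> q"
  shows "\<exists>u v. 0 \<le> u \<and> u < v \<and> v \<le> 1 \<and> \<gamma> ` {u<..<v} \<subseteq> S"
proof -
  have "p \<in> \<gamma> ` {0..1}" "q \<in> \<gamma> ` {0..1}"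
    using S(2) pq by (auto simp: path_image_def)
  then obtain a' b' where a'b': "a' \<in> {0..1}" "b' \<in> {0..1}" "p = \<gamma> a'" "q = \<gamma> b'"
    by blast
  define a b where "a = min a' b'" and "b = max a' b'"
  have "a' \<noteq> b'" using a'b' pq(3) by blast
  then have ab: "0 \<le> a" "a < b" "b \<le> 1" "\<gamma> a \<in> S" "\<gamma> b \<in> S" "\<gamma> a \<noteq> \<gamma> b"
    using a'b' pq by (auto simp: a_def b_def min_def max_def)
  show ?thesis
  proof (cases "\<gamma> ` {a<..<b} \<subseteq> S")
    case True
    then show ?thesis using ab by blast
  next
    case False
    then obtain c where c: "a < c" "c < b" "\<gamma> c \<notin> S" by (auto simp: image_subset_iff)
    have "\<gamma> 0 = \<gamma> 1" using \<gamma>(2) by (simp add: pathfinish_def pathstart_def)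
    then have "0 < a \<or> b < 1" using ab by (cases "a = 0"; cases "b = 1") auto
    then show ?thesis
    proof
      assume "0 < a"
      moreover have "\<gamma> ` {0<..<a} \<subseteq> S"
      proof (rule ccontr)
        assume "\<not> \<gamma> ` {0<..<a} \<subseteq> S"
        then obtain c' where "0 < c'" "c' < a" "\<gamma> c' \<notin> S" by (auto simp: image_subset_iff)
        then show False
          using simple_loop_separation[OF \<gamma>(1) S, of c' a c b] ab c by simp
      qed
      ultimately show ?thesis using ab by (intro exI[of _ 0] exI[of _ a]) auto
    next
      assume "b < 1"
      moreover have "\<gamma> ` {b<..<1} \<subseteq> S"
      proof (rule ccontr)
        assume "\<not> \<gamma> ` {b<..<1} \<subseteq> S"
        then obtain c' where "b < c'" "c' < 1" "\<gamma> c' \<notin> S" by (auto simp: image_subset_iff)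
        then show False
          using simple_loop_separation[OF \<gamma>(1) S, of c b c' a] ab c by simp
      qed
      ultimately show ?thesis using ab by (intro exI[of _ b] exI[of _ 1]) auto
    qed
  qed
qed

text \<open>The properties of the cluster sets \<open>C t\<close> of \<open>f\<close> at \<open>cis t\<close> from which the regularity of the boundary
function follows. The last one is a weak form of monotonicity: a value can be shared by two points
of the circle only if it is the only value on one of the arcs between them.\<close>

locale boundary_correspondence =
  fixes C :: "real \<Rightarrow> 'a::metric_space set" and \<gamma> :: "real \<Rightarrow> 'a"
  assumes loop: "simple_path \<gamma>" "pathfinish \<gamma> = pathstart \<gamma>"
    and periodic: "C (t + 2 * pi) = C t"
    and nonempty: "C t \<noteq> {}"
    and on_loop: "C t \<subseteq> path_image \<gamma>"
    and connected_arc: "a \<le> b \<Longrightarrow> connected (\<Union>t\<in>{a..b}. C t)"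
    and shared_value: "\<lbrakk>s < s'; s' < s + 2 * pi; w \<in> C s; w \<in> C s'\<rbrakk> \<Longrightarrow>
      (\<forall>c\<in>{s<..<s'}. C c = {w}) \<or> (\<forall>c\<in>{s'<..<s + 2 * pi}. C c = {w})"
begin

lemma periodic_int: "C (t + 2 * pi * of_int k) = C t"
  by (rule periodic_int_multiple) (rule periodic)

text \<open>The points \<open>t'\<close> of the open interval represent all points of the circle other than \<open>cis t\<close>, each
of them once.\<close>

definition shared :: "real \<Rightarrow> 'a set" where
  "shared t = {w \<in> C t. \<exists>t'. t < t' \<and> t' < t + 2 * pi \<and> w \<in> C t'}"

text \<open>Each shared value is the only value on a one-sided neighbourhood of \<open>t\<close>, and each side admits at
most one such value.\<close>

lemma finite_shared: "finite (shared t)"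
proof -
  \<comment> \<open>Points that are the only value just after \<open>t\<close>, and just before \<open>t + 2\<pi>\<close>.\<close>
  define R where "R = {w. \<exists>e>0. \<forall>c\<in>{t<..<t + e}. C c = {w}}"
  define L where "L = {w. \<exists>e>0. \<forall>c\<in>{t + 2 * pi - e<..<t + 2 * pi}. C c = {w}}"
  have "shared t \<subseteq> R \<union> L"
  proof
    fix w assume "w \<in> shared t"
    then obtain t' where t': "t < t'" "t' < t + 2 * pi" "w \<in> C t" "w \<in> C t'" by (auto simp: shared_def)
    from shared_value[OF this] show "w \<in> R \<union> L"
    proof
      assume "\<forall>c\<in>{t<..<t'}. C c = {w}"
      then have "w \<in> R" unfolding R_def using t' by (intro CollectI exI[of _ "t' - t"]) auto
      then show ?thesis by blast
    next
      assume "\<forall>c\<in>{t'<..<t + 2 * pi}. C c = {w}"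
      then have "w \<in> L" unfolding L_def using t' by (intro CollectI exI[of _ "t + 2 * pi - t'"]) auto
      then show ?thesis by blast
    qed
  qed
  moreover have "w = v" if "w \<in> R" "v \<in> R" for w v
  proof -
    from that obtain e e' where e: "e > 0" "e' > 0" "\<forall>c\<in>{t<..<t + e}. C c = {w}" "\<forall>c\<in>{t<..<t + e'}. C c = {v}"
      by (auto simp: R_def)
    have "t + min e e' / 2 \<in> {t<..<t + e}" "t + min e e' / 2 \<in> {t<..<t + e'}"
      using e(1,2) by (auto simp: min_def)
    then have "C (t + min e e' / 2) = {w}" "C (t + min e e' / 2) = {v}"
      using e(3,4) by blast+
    then show ?thesis by simp
  qed
  moreover have "w = v" if "w \<in> L" "v \<in> L" for w v
  proof -
    from that obtain e e' where e: "e > 0" "e' > 0" "\<forall>c\<in>{t + 2 * pi - e<..<t + 2 * pi}. C c = {w}"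
        "\<forall>c\<in>{t + 2 * pi - e'<..<t + 2 * pi}. C c = {v}"
      by (auto simp: L_def)
    have "t + 2 * pi - min e e' / 2 \<in> {t + 2 * pi - e<..<t + 2 * pi}"
        "t + 2 * pi - min e e' / 2 \<in> {t + 2 * pi - e'<..<t + 2 * pi}"
      using e(1,2) by (auto simp: min_def)
    then have "C (t + 2 * pi - min e e' / 2) = {w}" "C (t + 2 * pi - min e e' / 2) = {v}"
      using e(3,4) by blast+
    then show ?thesis by simp
  qed
  ultimately show ?thesis
    by (metis finite_subset finite_UnI finite.emptyI finite.insertI insertI1 subsetI)
qed

lemma not_shared_unique:
  assumes "w \<in> C t" "w \<notin> shared t" "w \<in> C t'"
  shows "\<exists>k::int. t' = t + 2 * pi * of_int k"
proof -
  define k where "k = \<lfloor>(t' - t) / (2 * pi)\<rfloor>"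
  define t'' where "t'' = t' - 2 * pi * of_int k"
  have "of_int k \<le> (t' - t) / (2 * pi)" "(t' - t) / (2 * pi) < of_int k + 1"
    unfolding k_def by linarith+
  then have t'': "t \<le> t''" "t'' < t + 2 * pi"
    by (simp_all add: t''_def field_simps)
  have "w \<in> C t''" using assms(3) periodic_int[of t'' k] by (simp add: t''_def)
  then have "t'' = t" using assms t'' by (force simp: shared_def)
  then show ?thesis by (auto simp: t''_def algebra_simps)
qed

text \<open>If \<open>C t\<close> has two points, it contains an arc, hence infinitely many points with rational parameter
on the curve. All but finitely many of these belong to no other point of the circle, so each
rational parameter is used for only one \<open>t\<close> modulo \<open>2\<pi>\<close>.\<close>

lemma countable_not_singleton: "countable {t. \<nexists>w. C t = {w}}"
proof -
  define T where "T = (\<lambda>w. {t. w \<in> C t - shared t})"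
  have "countable (T w)" for w
  proof (cases "T w = {}")
    case False
    then obtain t where t: "t \<in> T w" by blast
    have "T w \<subseteq> range (\<lambda>k::int. t + 2 * pi * of_int k)"
    proof
      fix t' assume "t' \<in> T w"
      then have "\<exists>k::int. t' = t + 2 * pi * of_int k"
        using t by (intro not_shared_unique[of w]) (simp_all add: T_def)
      then show "t' \<in> range (\<lambda>k::int. t + 2 * pi * of_int k)" by blast
    qed
    then show ?thesis by (rule countable_subset) simp
  qed simp
  then have "countable (\<Union>q\<in>\<rat>. T (\<gamma> q))" by (intro countable_UN countable_rat)
  moreover have "{t. \<nexists>w. C t = {w}} \<subseteq> (\<Union>q\<in>\<rat>. T (\<gamma> q))"
  proof
    fix t assume "t \<in> {t. \<nexists>w. C t = {w}}"
    then have no: "\<nexists>w. C t = {w}" by simp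
    obtain p where p: "p \<in> C t" using nonempty[of t] by blast
    moreover have "C t \<noteq> {p}" using no by blast
    ultimately obtain q where "q \<in> C t" "p \<noteq> q" by blast
    note pq = p this
    have "connected (C t)" using connected_arc[of t t] by simp
    from connected_in_simple_loop_contains_arc[OF loop this on_loop pq]
    obtain u v where uv: "0 \<le> u" "u < v" "v \<le> 1" "\<gamma> ` {u<..<v} \<subseteq> C t" by blast
    have "inj_on \<gamma> {u<..<v}"
      using loop(1) uv by (intro inj_onI) (fastforce simp: simple_path_def loop_free_def)
    then have "inj_on \<gamma> (\<rat> \<inter> {u<..<v})" by (rule inj_on_subset) auto
    then have "infinite (\<gamma> ` (\<rat> \<inter> {u<..<v}))"
      using infinite_Rats_Ioo[OF uv(2)] by (simp add: finite_image_iff)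
    then have "\<not> \<gamma> ` (\<rat> \<inter> {u<..<v}) \<subseteq> shared t"
      using finite_shared[of t] finite_subset by metis
    then obtain q where "q \<in> \<rat> \<inter> {u<..<v}" "\<gamma> q \<notin> shared t" by (auto simp: image_subset_iff)
    then have "t \<in> T (\<gamma> q)" "q \<in> \<rat>" using uv(4) by (auto simp: T_def image_subset_iff)
    then show "t \<in> (\<Union>q\<in>\<rat>. T (\<gamma> q))" by blast
  qed
  ultimately show ?thesis by (rule countable_subset[rotated])
qed

text \<open>The sets \<open>S i\<close> of all values on the intervals \<open>[x i, x (i + 1)]\<close> of a partition are connected. Let \<open>w\<close> be
neither selected nor shared at a partition point. If \<open>w\<close> lies in \<open>S i\<close> and in \<open>S j\<close>, then both sets take
it from the same point of the circle: otherwise \<open>w\<close> would be the only value on an arc that contains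
a partition point or ends in one. So two nondegenerate intervals with the common value \<open>w\<close> have a
common endpoint on the circle, and there are at most three of them. The variation of the selection is
thus at most three times a bound for the variation of \<open>\<gamma>\<close>.\<close>

lemma selection_bounded_variation:
  assumes g: "\<And>t. g t \<in> C t" and \<gamma>: "bounded_variation_on \<gamma> 0 1"
  shows "bounded_variation_on g 0 (2 * pi)"
proof -
  from \<gamma> obtain B where B: "\<And>n (x :: nat \<Rightarrow> real). mono_on {..n} x \<Longrightarrow> x ` {..n} \<subseteq> {0..1} \<Longrightarrow>
      (\<Sum>i<n. dist (\<gamma> (x i)) (\<gamma> (x (Suc i)))) \<le> B"
    unfolding bounded_variation_on_def by blast
  have "(\<Sum>i<n. dist (g (x i)) (g (x (Suc i)))) \<le> real 3 * B"
    if mono: "mono_on {..n} x" and img: "x ` {..n} \<subseteq> {0..2 * pi}" for n and x :: "nat \<Rightarrow> real"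
  proof -
    have xm: "x i \<le> x j" if "i \<le> j" "j \<le> n" for i j
      using mono that by (auto simp: mono_on_def)
    have x01: "0 \<le> x i" "x i \<le> 2 * pi" if "i \<le> n" for i
      using img that by auto
    define I where "I = {i. i < n \<and> x i < x (Suc i)}"
    define S where "S = (\<lambda>i. \<Union>t\<in>{x i..x (Suc i)}. C t)"
    \<comment> \<open>The exceptional values: those that are selected or shared at a partition point.\<close>
    define P where "P = (\<Union>i\<le>n. insert (g (x i)) (shared (x i)))"
    have fin: "finite I" "finite P" by (auto simp: I_def P_def finite_shared)
    have PI: "w \<notin> shared (x i)" "C (x i) \<noteq> {w}" if "w \<notin> P" "i \<le> n" for w i
      using that g[of "x i"] by (auto simp: P_def)
    have order: "x (Suc i) \<le> x j" if "i < j" "j \<in> I" for i j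
      using that xm[of "Suc i" j] by (auto simp: I_def)
    have adjacent: "x j = x (Suc i) \<or> x (Suc j) = 2 * pi"
      if w: "w \<notin> P" and ij: "i < j" "i \<in> I" "j \<in> I" "w \<in> S i" "w \<in> S j" for i j w
    proof (rule ccontr)
      assume no: "\<not> (x j = x (Suc i) \<or> x (Suc j) = 2 * pi)"
      from ij obtain s t where s: "x i \<le> s" "s \<le> x (Suc i)" "w \<in> C s"
        and t: "x j \<le> t" "t \<le> x (Suc j)" "w \<in> C t" by (auto simp: S_def)
      have n: "Suc i \<le> n" "j \<le> n" "Suc j \<le> n" "i \<le> n" using ij by (auto simp: I_def)
      have st: "s < t" "x (Suc i) < t" using order[OF ij(1,3)] s t no by auto
      have ts: "x (Suc j) < s + 2 * pi" "t < s + 2 * pi"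
        using no s t x01(1)[OF n(4)] x01(2)[OF n(3)] by auto
      from shared_value[OF st(1) ts(2) s(3) t(3)] show False
      proof
        assume c: "\<forall>c\<in>{s<..<t}. C c = {w}"
        show False
        proof (cases "s = x (Suc i)")
          case True
          then have "w \<in> shared (x (Suc i))" using s t st ts by (auto simp: shared_def)
          then show False using PI(1)[OF w n(1)] by simp
        next
          case False
          then have "C (x (Suc i)) = {w}" using c s st by auto
          then show False using PI(2)[OF w n(1)] by simp
        qed
      next
        assume c: "\<forall>c\<in>{t<..<s + 2 * pi}. C c = {w}"
        show False
        proof (cases "t = x (Suc j)")
          case True
          then have "w \<in> shared (x (Suc j))" using s t st ts periodic[of s]
            by (auto simp: shared_def intro!: exI[of _ "s + 2 * pi"])
          then show False using PI(1)[OF w n(3)] by simp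
        next
          case False
          then have "C (x (Suc j)) = {w}" using c t ts by auto
          then show False using PI(2)[OF w n(3)] by simp
        qed
      qed
    qed
    have strict: "x j < x j'" "x (Suc j) < x (Suc j')" if "j < j'" "j \<in> I" "j' \<in> I" for j j'
      using order[OF that(1,3)] that by (auto simp: I_def)
    have one: "card {j\<in>I. x j = a} \<le> 1" "card {j\<in>I. x (Suc j) = a} \<le> 1" for a
      using fin(1) strict by (auto simp: card_le_Suc0_iff_eq) (metis less_irrefl linorder_neqE_nat)+
    have mult: "card {i\<in>I. w \<in> S i} \<le> 3" if w: "w \<notin> P" for w
    proof (cases "{i\<in>I. w \<in> S i} = {}")
      case False
      define i0 where "i0 = Min {i\<in>I. w \<in> S i}"
      have finM: "finite {i\<in>I. w \<in> S i}" using fin by simp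
      have i0: "i0 \<in> I" "w \<in> S i0" using Min_in[OF finM False] by (auto simp: i0_def)
      have "{i\<in>I. w \<in> S i} \<subseteq> {i0} \<union> {j\<in>I. x j = x (Suc i0)} \<union> {j\<in>I. x (Suc j) = 2 * pi}"
      proof
        fix j assume j: "j \<in> {i\<in>I. w \<in> S i}"
        then have "i0 \<le> j" using Min_le[OF finM] by (simp add: i0_def)
        then show "j \<in> {i0} \<union> {j\<in>I. x j = x (Suc i0)} \<union> {j\<in>I. x (Suc j) = 2 * pi}"
          using adjacent[OF w, of i0 j] i0 j by (cases "i0 = j") auto
      qed
      then have "card {i\<in>I. w \<in> S i} \<le> card ({i0} \<union> {j\<in>I. x j = x (Suc i0)} \<union> {j\<in>I. x (Suc j) = 2 * pi})"
        by (rule card_mono[rotated]) (use fin in auto)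
      also have "\<dots> \<le> card {i0} + card {j\<in>I. x j = x (Suc i0)} + card {j\<in>I. x (Suc j) = 2 * pi}"
        by (intro order_trans[OF card_Un_le] add_mono order_refl card_Un_le)
      also have "\<dots> \<le> 3" using one[of "x (Suc i0)"] one[of "2 * pi"] by simp
      finally show ?thesis .
    next
      case True
      then show ?thesis by (simp only: card.empty)
    qed
    have "(\<Sum>i<n. dist (g (x i)) (g (x (Suc i)))) = (\<Sum>i\<in>I. dist (g (x i)) (g (x (Suc i))))"
    proof (rule sum.mono_neutral_right)
      show "\<forall>i\<in>{..<n} - I. dist (g (x i)) (g (x (Suc i))) = 0"
      proof
        fix i assume "i \<in> {..<n} - I"
        then have "x i = x (Suc i)" using xm[of i "Suc i"] by (auto simp: I_def)
        then show "dist (g (x i)) (g (x (Suc i))) = 0" by simp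
      qed
    qed (auto simp: I_def)
    also have "\<dots> \<le> real 3 * B"
    proof (rule sum_dist_connected_multiplicity[OF loop B fin(1), where S = S and P = P])
      fix i assume i: "i \<in> I"
      show "connected (S i)" unfolding S_def using i by (intro connected_arc) (auto simp: I_def)
      show "S i \<subseteq> path_image \<gamma>" unfolding S_def using on_loop by blast
      show "g (x i) \<in> S i" "g (x (Suc i)) \<in> S i"
        unfolding S_def using g i by (auto simp: I_def intro!: bexI)
    qed (use fin mult in auto)
    finally show ?thesis .
  qed
  then show ?thesis unfolding bounded_variation_on_def by blast
qed

end

section \<open>One-sided limits of functions of bounded variation\<close>

lemma bounded_variation_on_reverse:
  assumes "bounded_variation_on g a b"
  shows "bounded_variation_on (\<lambda>t. g (- t)) (- b) (- a)"
proof -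
  from assms obtain B where B: "\<And>n (x :: nat \<Rightarrow> real). mono_on {..n} x \<Longrightarrow> x ` {..n} \<subseteq> {a..b} \<Longrightarrow>
      (\<Sum>i<n. dist (g (x i)) (g (x (Suc i)))) \<le> B"
    unfolding bounded_variation_on_def by blast
  have "(\<Sum>i<n. dist (g (- x i)) (g (- x (Suc i)))) \<le> B"
    if "mono_on {..n} x" "x ` {..n} \<subseteq> {- b..- a}" for n and x :: "nat \<Rightarrow> real"
  proof -
    define y where "y = (\<lambda>i. - x (n - i))"
    have "(\<Sum>i<n. dist (g (y i)) (g (y (Suc i)))) \<le> B"
    proof (rule B)
      show "mono_on {..n} y" using that(1) by (auto simp: mono_on_def y_def)
      have "- b \<le> x (n - i) \<and> x (n - i) \<le> - a" for i
        using subsetD[OF that(2) imageI, of "n - i"] by simp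
      then have "a \<le> y i \<and> y i \<le> b" for i
        unfolding y_def by (metis minus_le_iff le_minus_iff)
      then show "y ` {..n} \<subseteq> {a..b}" by (simp add: image_subset_iff)
    qed
    also have "(\<Sum>i<n. dist (g (y i)) (g (y (Suc i)))) = (\<Sum>i<n. dist (g (- x (n - Suc i))) (g (- x (Suc (n - Suc i)))))"
      by (intro sum.cong refl) (auto simp: y_def dist_commute Suc_diff_Suc)
    also have "\<dots> = (\<Sum>i<n. dist (g (- x i)) (g (- x (Suc i))))"
      by (rule sum.nat_diff_reindex[where g = "\<lambda>i. dist (g (- x i)) (g (- x (Suc i)))"])
    finally show ?thesis .
  qed
  then show ?thesis unfolding bounded_variation_on_def by blast
qed

text \<open>If \<open>g\<close> oscillates by \<open>e\<close> in every right neighbourhood of \<open>s\<close>, one finds, moving towards \<open>s\<close>, as many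
disjoint oscillations as desired, which exceeds every bound on the variation.\<close>

lemma bounded_variation_right_limit:
  fixes g :: "real \<Rightarrow> 'a::complete_space"
  assumes bv: "bounded_variation_on g a b" and s: "a \<le> s" "s < b"
  shows "\<exists>A. (g \<longlongrightarrow> A) (at_right s)"
proof -
  from bv obtain B where B: "\<And>n (x :: nat \<Rightarrow> real). mono_on {..n} x \<Longrightarrow> x ` {..n} \<subseteq> {a..b} \<Longrightarrow>
      (\<Sum>i<n. dist (g (x i)) (g (x (Suc i)))) \<le> B"
    unfolding bounded_variation_on_def by blast
  have cauchy: "\<exists>d>0. \<forall>x y. s < x \<and> x < s + d \<and> s < y \<and> y < s + d \<longrightarrow> dist (g x) (g y) < e" if e: "e > 0" for e
  proof (rule ccontr)
    assume "\<not> ?thesis"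
    then have osc: "\<exists>u v. s < u \<and> u < s + d \<and> s < v \<and> v < s + d \<and> dist (g u) (g v) \<ge> e" if "d > 0" for d
      using that by (meson not_less)
    have osc': "\<exists>u v. s < u \<and> u < v \<and> v < s + d \<and> dist (g u) (g v) \<ge> e" if d: "d > 0" for d
    proof -
      obtain u v where uv: "s < u" "u < s + d" "s < v" "v < s + d" "dist (g u) (g v) \<ge> e" using osc[OF d] by blast
      show ?thesis
      proof (cases u v rule: linorder_cases)
        case equal
        then show ?thesis using uv e by simp
      next
        case less
        then show ?thesis using uv by blast
      next
        case greater
        then show ?thesis using uv by (metis dist_commute)
      qed
    qed
    have many: "\<exists>m (x :: nat \<Rightarrow> real). mono_on {..m} x \<and> (\<forall>i\<le>m. s < x i \<and> x i < b) \<and>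
        real n * e \<le> (\<Sum>i<m. dist (g (x i)) (g (x (Suc i))))" for n :: nat
    proof (induction n)
      case 0
      show ?case using s by (intro exI[of _ 0] exI[of _ "\<lambda>_. (s + b) / 2"]) (auto simp: mono_on_def)
    next
      case (Suc n)
      then obtain m and x :: "nat \<Rightarrow> real" where x: "mono_on {..m} x" "\<And>i. i \<le> m \<Longrightarrow> s < x i \<and> x i < b"
        "real n * e \<le> (\<Sum>i<m. dist (g (x i)) (g (x (Suc i))))" by blast
      obtain u v where uv: "s < u" "u < v" "v < x 0" "dist (g u) (g v) \<ge> e"
        using osc'[of "x 0 - s"] x(2)[of 0] by auto
      define y where "y = case_nat u (case_nat v x)"
      have y: "y 0 = u" "y (Suc 0) = v" "\<And>i. y (Suc (Suc i)) = x i" by (simp_all add: y_def)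
      have "y i \<le> y j" if "i \<le> j" "j \<le> Suc (Suc m)" for i j
      proof -
        have x0: "x 0 \<le> x k" if "k \<le> m" for k using x(1) that by (auto simp: mono_on_def)
        show ?thesis
        proof (cases "i < 2")
          case True
          then have i: "i = 0 \<or> i = Suc 0" by auto
          consider "j = 0" | "j = Suc 0" | k where "j = Suc (Suc k)" by (metis not0_implies_Suc)
          then show ?thesis using i that uv x0 by cases (fastforce simp: y)+
        next
          case False
          then have kl: "Suc (Suc (i - 2)) = i" "Suc (Suc (j - 2)) = j" using that(1) by auto
          have "y i = x (i - 2)" "y j = x (j - 2)" using y(3)[of "i - 2"] y(3)[of "j - 2"] by (simp_all only: kl)
          moreover have "i - 2 \<le> j - 2" "j - 2 \<le> m" using that by auto
          ultimately show ?thesis using x(1) by (simp add: mono_on_def)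
        qed
      qed
      then have "mono_on {..Suc (Suc m)} y" by (auto simp: mono_on_def)
      moreover have "s < y i \<and> y i < b" if "i \<le> Suc (Suc m)" for i
      proof -
        have "x 0 < b" using x(2)[of 0] by simp
        then have uvb: "u < b" "v < b" "s < v" using uv(1-3) by auto
        consider "i = 0" | "i = Suc 0" | k where "i = Suc (Suc k)" by (metis not0_implies_Suc)
        then show ?thesis using uv(1) uvb x(2) that by cases (auto simp: y)
      qed
      moreover have total: "(\<Sum>i<Suc (Suc m). dist (g (y i)) (g (y (Suc i)))) =
          dist (g u) (g v) + (dist (g v) (g (x 0)) + (\<Sum>i<m. dist (g (x i)) (g (x (Suc i)))))"
        by (simp only: sum.lessThan_Suc_shift y)
      then have "real (Suc n) * e \<le> (\<Sum>i<Suc (Suc m). dist (g (y i)) (g (y (Suc i))))"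
      proof -
        have "real (Suc n) * e = e + real n * e" by (simp add: algebra_simps)
        with total x(3) uv(4) zero_le_dist[of "g v" "g (x 0)"] show ?thesis by linarith
      qed
      ultimately show ?case by blast
    qed
    obtain n :: nat where n: "real n * e > B" using reals_Archimedean3[OF e] by blast
    obtain m and x :: "nat \<Rightarrow> real" where x: "mono_on {..m} x" "\<forall>i\<le>m. s < x i \<and> x i < b"
      "real n * e \<le> (\<Sum>i<m. dist (g (x i)) (g (x (Suc i))))" using many[of n] by blast
    have "x ` {..m} \<subseteq> {a..b}" using x(2) s by force
    from B[OF x(1) this] n x(3) show False by linarith
  qed
  have "cauchy_filter (filtermap g (at_right s))"
    unfolding cauchy_filter_metric_filtermap
  proof (intro allI impI)
    fix e :: real assume "e > 0"
    from cauchy[OF this] obtain d where d: "d > 0"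
      "\<forall>x y. s < x \<and> x < s + d \<and> s < y \<and> y < s + d \<longrightarrow> dist (g x) (g y) < e" by blast
    have "eventually (\<lambda>x. s < x \<and> x < s + d) (at_right s)"
      using d(1) by (auto simp: eventually_at_right_field intro!: exI[of _ "s + d"])
    then show "\<exists>P. eventually P (at_right s) \<and> (\<forall>x y. P x \<and> P y \<longrightarrow> dist (g x) (g y) < e)"
      using d(2) by blast
  qed
  then have "\<exists>A. filtermap g (at_right s) \<le> nhds A"
    using convergent_filter_iff_cauchy[of "filtermap g (at_right s)"] by (simp add: convergent_filter_iff)
  then show ?thesis by (simp add: filterlim_def)
qed

lemma bounded_variation_left_limit:
  fixes g :: "real \<Rightarrow> 'a::complete_space"
  assumes "bounded_variation_on g a b" "a < s" "s \<le> b"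
  shows "\<exists>A. (g \<longlongrightarrow> A) (at_left s)"
  using bounded_variation_right_limit[OF bounded_variation_on_reverse[OF assms(1)], of "- s"] assms
  by (simp add: filterlim_at_left_to_right)

lemma periodic_one_sided_limits:
  fixes g :: "real \<Rightarrow> 'a::complete_space"
  assumes per: "\<And>t. g (t + 2 * pi) = g t" and bv: "bounded_variation_on g 0 (2 * pi)"
  shows "\<exists>A. (g \<longlongrightarrow> A) (at_left s)" "\<exists>B. (g \<longlongrightarrow> B) (at_right s)"
proof -
  note per_int = periodic_int_multiple[of g, OF per]
  show "\<exists>B. (g \<longlongrightarrow> B) (at_right s)"
  proof -
    define n where "n = \<lfloor>s / (2 * pi)\<rfloor>"
    define d where "d = 2 * pi * of_int n"
    have "of_int n \<le> s / (2 * pi)" "s / (2 * pi) < of_int n + 1" unfolding n_def by linarith+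
    then have "0 \<le> s - d" "s - d < 2 * pi" by (simp_all add: d_def field_simps)
    then obtain B where "(g \<longlongrightarrow> B) (at_right (s - d))"
      using bounded_variation_right_limit[OF bv] by blast
    then have "((\<lambda>t. g (t - d)) \<longlongrightarrow> B) (at_right s)"
      unfolding filtermap_at_right_shift[symmetric] by (simp add: filterlim_filtermap)
    moreover have "g (t - d) = g t" for t using per_int[of "t - d" n] by (simp add: d_def)
    ultimately show ?thesis by auto
  qed
  show "\<exists>A. (g \<longlongrightarrow> A) (at_left s)"
  proof -
    define n where "n = \<lceil>s / (2 * pi)\<rceil> - 1"
    define d where "d = 2 * pi * of_int n"
    have "of_int n < s / (2 * pi)" "s / (2 * pi) \<le> of_int n + 1" unfolding n_def by linarith+
    then have "0 < s - d" "s - d \<le> 2 * pi" by (simp_all add: d_def field_simps)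
    then obtain A where "(g \<longlongrightarrow> A) (at_left (s - d))"
      using bounded_variation_left_limit[OF bv] by blast
    moreover have "filterlim (\<lambda>t. t - d) (at_left (s - d)) (at_left s)"
      by (auto simp: filterlim_at eventually_at_filter intro!: tendsto_intros)
    ultimately have "((\<lambda>t. g (t - d)) \<longlongrightarrow> A) (at_left s)"
      by (rule filterlim_compose)
    moreover have "g (t - d) = g t" for t using per_int[of "t - d" n] by (simp add: d_def)
    ultimately show ?thesis by auto
  qed
qed

section \<open>Poisson integrals\<close>

lemma poisson_kernel_eq_norm:
  "poisson_kernel (cmod z) (t - Arg z) = (1 - (cmod z)\<^sup>2) / (2 * pi * (cmod (cis t - z))\<^sup>2)"
proof -
  have z: "Re z = cmod z * cos (Arg z)" "Im z = cmod z * sin (Arg z)"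
    using rcis_cmod_Arg[of z] by (metis Re_rcis, metis Im_rcis)
  have "(cmod (cis t - z))\<^sup>2 = (cos t - Re z)\<^sup>2 + (sin t - Im z)\<^sup>2"
    by (simp add: cmod_power2)
  also have "\<dots> = ((cos t)\<^sup>2 + (sin t)\<^sup>2) - 2 * cmod z * (cos t * cos (Arg z) + sin t * sin (Arg z))
      + (cmod z)\<^sup>2 * ((cos (Arg z))\<^sup>2 + (sin (Arg z))\<^sup>2)"
    by (simp only: z) algebra
  also have "\<dots> = 1 - 2 * cmod z * cos (t - Arg z) + (cmod z)\<^sup>2"
    by (simp add: cos_diff)
  finally show ?thesis by (simp add: poisson_kernel_def)
qed

lemma poisson_kernel_nonneg:
  assumes "cmod z < 1"
  shows "poisson_kernel (cmod z) (t - Arg z) \<ge> 0"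
  unfolding poisson_kernel_eq_norm using assms by (auto simp: power_le_one)

lemma continuous_on_poisson_kernel:
  assumes "cmod z < 1"
  shows "continuous_on A (\<lambda>t. poisson_kernel (cmod z) (t - Arg z))"
  unfolding poisson_kernel_eq_norm
proof (intro continuous_intros ballI)
  fix t
  have "cis t \<noteq> z" using assms by auto
  then show "2 * pi * (cmod (cis t - z))\<^sup>2 \<noteq> 0" by simp
qed

text \<open>Cauchy's formula at \<open>z\<close> for \<open>G\<close> multiplied by \<open>(1 - \<bar>z\<bar>\<^sup>2) / (1 - cnj z w)\<close>: the factor equals 1 at
\<open>w = z\<close>, and on the unit circle it turns the Cauchy kernel into the Poisson kernel.\<close>

lemma poisson_formula_closed_disc:
  assumes cont: "continuous_on (cball 0 1) G" and holo: "G holomorphic_on ball 0 1"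
    and z: "cmod z < 1"
  shows "((\<lambda>t. of_real (poisson_kernel (cmod z) (t - Arg z)) * G (cis t)) has_integral G z) {0..2 * pi}"
proof -
  define H where "H = (\<lambda>w. G w * (1 - of_real ((cmod z)\<^sup>2)) / (1 - cnj z * w))"
  have nz: "1 - cnj z * w \<noteq> 0" if "cmod w \<le> 1" for w
  proof
    assume "1 - cnj z * w = 0"
    then have "cmod (cnj z * w) = 1" by simp
    moreover have "cmod (cnj z * w) \<le> cmod z * 1"
      unfolding norm_mult complex_mod_cnj by (intro mult_left_mono that) simp
    ultimately show False using z by linarith
  qed
  have "((\<lambda>u. H u / (u - z)) has_contour_integral (2 * of_real pi * \<i> * H z)) (circlepath 0 1)"
  proof (rule Cauchy_integral_circlepath)
    show "continuous_on (cball 0 1) H"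
      unfolding H_def by (intro continuous_intros cont) (use nz in auto)
    show "H holomorphic_on ball 0 1"
      unfolding H_def by (intro holomorphic_intros holo) (use nz in force)
  qed (use z in simp)
  then have I: "((\<lambda>t. H (cis t) / (cis t - z) * \<i> * cis t) has_integral (2 * of_real pi * \<i> * H z)) {0..2 * pi}"
    unfolding circlepath_def by (subst (asm) has_contour_integral_part_circlepath_iff) auto
  have Hz: "H z = G z"
  proof -
    have "1 - cnj z * z = 1 - of_real ((cmod z)\<^sup>2)"
      by (metis complex_norm_square mult.commute of_real_power)
    with nz[of z] z show ?thesis by (simp add: H_def)
  qed
  have eq: "H (cis t) / (cis t - z) * \<i> * cis t / (2 * of_real pi * \<i>)
      = of_real (poisson_kernel (cmod z) (t - Arg z)) * G (cis t)" for t
  proof -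
    let ?c = "cis t"
    have c: "?c * cnj ?c = 1" by (simp add: complex_norm_square[symmetric])
    have cz: "?c \<noteq> z" using z by auto
    have "of_real ((cmod (?c - z))\<^sup>2) = (?c - z) * (cnj ?c - cnj z)"
      by (metis complex_norm_square complex_cnj_diff)
    then have "?c * of_real ((cmod (?c - z))\<^sup>2) = ?c * ((?c - z) * (cnj ?c - cnj z))"
      by (simp only:)
    also have "\<dots> = (?c - z) * (?c * cnj ?c - cnj z * ?c)"
      by (simp add: algebra_simps)
    finally have "?c * of_real ((cmod (?c - z))\<^sup>2) = (?c - z) * (?c * cnj ?c - cnj z * ?c)" .
    then have e: "(?c - z) * (1 - cnj z * ?c) = ?c * of_real ((cmod (?c - z))\<^sup>2)"
      unfolding c by simp
    have nz1: "1 - cnj z * ?c \<noteq> 0" by (rule nz) simp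
    have nz2: "complex_of_real ((cmod (?c - z))\<^sup>2) \<noteq> 0" using cz by simp
    have "H ?c / (?c - z) * \<i> * ?c / (2 * of_real pi * \<i>)
      = G ?c * (1 - of_real ((cmod z)\<^sup>2)) * ?c / (2 * of_real pi * ((?c - z) * (1 - cnj z * ?c)))"
    proof -
      have "X / d / e * \<i> * k / (2 * p * \<i>) = X * k / (2 * p * (e * d))" for X d e k p :: complex
        by (cases "d = 0"; cases "e = 0"; cases "p = 0") (simp_all add: field_simps)
      then show ?thesis by (simp only: H_def)
    qed
    also have "\<dots> = G ?c * (1 - of_real ((cmod z)\<^sup>2)) / (2 * of_real pi * of_real ((cmod (?c - z))\<^sup>2))"
      unfolding e using nz2 by (simp add: field_simps)
    also have "\<dots> = of_real (poisson_kernel (cmod z) (t - Arg z)) * G ?c"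
      unfolding poisson_kernel_eq_norm by simp
    finally show ?thesis .
  qed
  have "((\<lambda>t. H (cis t) / (cis t - z) * \<i> * cis t / (2 * of_real pi * \<i>)) has_integral
      (2 * of_real pi * \<i> * H z) / (2 * of_real pi * \<i>)) {0..2 * pi}"
    by (rule has_integral_divide[OF I])
  then show ?thesis
    unfolding eq by (simp add: Hz)
qed

lemma AE_not_countable_lebesgue:
  assumes "countable (C :: real set)"
  shows "AE t in lebesgue. t \<notin> C"
  using countable_imp_null_set_lborel[OF assms] null_sets_completionI[of C lborel]
  by (intro AE_not_in) auto

text \<open>Poisson's formula on the circles of radius \<open>r < 1\<close>, followed by dominated convergence as \<open>r\<close> tends
to 1. Countably many missing radial limits form a null set.\<close>

lemma poisson_integral_bounded_harmonic:
  assumes holo: "F holomorphic_on ball 0 1" and bound: "\<And>w. w \<in> ball 0 1 \<Longrightarrow> \<bar>Re (F w)\<bar> \<le> M"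
    and z: "cmod z < 1" and C: "countable C"
    and lim: "\<And>t. \<lbrakk>0 \<le> t; t \<le> 2 * pi; t \<notin> C\<rbrakk> \<Longrightarrow> ((\<lambda>r. Re (F (of_real r * cis t))) \<longlongrightarrow> \<psi> t) (at_left 1)"
  shows "set_integrable lebesgue {0..2 * pi} (\<lambda>t. poisson_kernel (cmod z) (t - Arg z) * \<psi> t)"
    and "(LINT t:{0..2 * pi}|lebesgue. poisson_kernel (cmod z) (t - Arg z) * \<psi> t) = Re (F z)"
proof -
  let ?K = "\<lambda>t. poisson_kernel (cmod z) (t - Arg z)"
  define r where "r = (\<lambda>n. 1 - 1 / (real n + 2))"
  have r: "0 < r n" "r n < 1" for n by (auto simp: r_def field_simps)
  have r1: "r \<longlonglongrightarrow> 1" unfolding r_def by real_asymp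
  have rl: "filterlim r (at_left 1) sequentially"
    using r1 unfolding filterlim_at by (auto simp: r less_imp_neq)
  define s where "s = (\<lambda>n t. indicator {0..2 * pi} t *\<^sub>R (?K t * Re (F (of_real (r n) * cis t))))"
  define l where "l = (\<lambda>t. indicator {0..2 * pi} t *\<^sub>R (?K t * \<psi> t))"
  define w where "w = (\<lambda>t. indicator {0..2 * pi} t *\<^sub>R (?K t * M))"
  have inb: "of_real (r n) * v \<in> ball 0 1" if "cmod v \<le> 1" for n v
  proof -
    have "cmod (of_real (r n) * v) \<le> r n * 1"
      unfolding norm_mult using r[of n] that by (simp add: mult_left_le)
    then show ?thesis using r[of n] by (simp add: le_less_trans)
  qed
  have contF: "continuous_on (cball 0 1) (\<lambda>v. F (of_real (r n) * v))" for n
    by (rule continuous_on_compose2[OF holomorphic_on_imp_continuous_on[OF holo]])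
      (intro continuous_intros, use inb in \<open>simp add: image_subset_iff\<close>)
  have holF: "(\<lambda>v. F (of_real (r n) * v)) holomorphic_on ball 0 1" for n
    by (rule holomorphic_on_compose_gen[OF _ holo, unfolded comp_def])
      (intro holomorphic_intros, use inb in \<open>simp add: image_subset_iff less_imp_le\<close>)
  have contK: "continuous_on {0..2 * pi} (\<lambda>t. ?K t * Re (F (of_real (r n) * cis t)))" for n
    by (intro continuous_intros continuous_on_poisson_kernel z continuous_on_compose2[OF contF]) auto
  have s_int: "set_integrable lebesgue {0..2 * pi} (\<lambda>t. ?K t * Re (F (of_real (r n) * cis t)))" for n
    by (rule absolutely_integrable_continuous_real[OF contK])
  have s_val: "integral\<^sup>L lebesgue (s n) = Re (F (of_real (r n) * z))" for n
  proof -
    have "((\<lambda>t. Re (of_real (?K t) * F (of_real (r n) * cis t))) has_integral Re (F (of_real (r n) * z))) {0..2 * pi}"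
      using has_integral_linear[OF poisson_formula_closed_disc[OF contF holF z] bounded_linear_Re]
      by (simp add: comp_def)
    then have "integral {0..2 * pi} (\<lambda>t. ?K t * Re (F (of_real (r n) * cis t))) = Re (F (of_real (r n) * z))"
      by (simp add: integral_unique)
    then show ?thesis
      using set_lebesgue_integral_eq_integral(2)[OF s_int, of n]
      by (simp add: s_def set_lebesgue_integral_def)
  qed
  have s_meas: "s n \<in> borel_measurable lebesgue" for n
    using s_int[of n] unfolding s_def set_integrable_def by (rule borel_measurable_integrable)
  have conv: "(\<lambda>n. s n t) \<longlonglongrightarrow> l t" if "t \<notin> C" for t
  proof (cases "t \<in> {0..2 * pi}")
    case True
    then have "((\<lambda>r. Re (F (of_real r * cis t))) \<longlongrightarrow> \<psi> t) (at_left 1)"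
      by (intro lim that) auto
    from filterlim_compose[OF this rl] show ?thesis
      unfolding s_def l_def by (rule tendsto_scaleR[OF tendsto_const tendsto_mult[OF tendsto_const]])
  qed (simp add: s_def l_def)
  have l_meas: "l \<in> borel_measurable lebesgue"
  proof (rule measurable_discrete_difference[where X = C and f = "\<lambda>t. indicator (- C) t *\<^sub>R l t"])
    have Cm: "C \<in> sets lebesgue"
      by (rule sets.countable[OF _ C]) simp
    show "(\<lambda>t. indicator (- C) t *\<^sub>R l t) \<in> borel_measurable lebesgue"
    proof (rule borel_measurable_LIMSEQ_metric)
      show "(\<lambda>t. indicator (- C) t *\<^sub>R s n t) \<in> borel_measurable lebesgue" for n
        using sets.compl_sets[OF Cm]
        by (intro borel_measurable_scaleR s_meas borel_measurable_indicator) (simp add: Compl_eq_Diff_UNIV)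
      show "(\<lambda>n. indicator (- C) t *\<^sub>R s n t) \<longlonglongrightarrow> indicator (- C) t *\<^sub>R l t" for t
        using conv by (cases "t \<in> C") simp_all
    qed
  qed (use C in auto)
  have w_int: "integrable lebesgue w"
    using absolutely_integrable_continuous_real[OF continuous_on_mult_right[OF continuous_on_poisson_kernel[OF z]], of 0 "2 * pi" M]
    by (simp add: w_def set_integrable_def)
  have AE1: "AE t in lebesgue. (\<lambda>n. s n t) \<longlonglongrightarrow> l t"
    using AE_not_countable_lebesgue[OF C] by eventually_elim (rule conv)
  have AE2: "AE t in lebesgue. norm (s n t) \<le> w t" for n
  proof (rule AE_I2)
    fix t
    have "\<bar>Re (F (of_real (r n) * cis t))\<bar> \<le> M" by (rule bound[OF inb]) simp
    then show "norm (s n t) \<le> w t"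
      using poisson_kernel_nonneg[OF z, of t]
      by (auto simp: s_def w_def indicator_def abs_mult mult_left_mono)
  qed
  have "integrable lebesgue l"
    by (rule integrable_dominated_convergence[OF l_meas s_meas w_int AE1 AE2])
  then show "set_integrable lebesgue {0..2 * pi} (\<lambda>t. ?K t * \<psi> t)"
    by (simp add: set_integrable_def l_def)
  have L1: "(\<lambda>n. integral\<^sup>L lebesgue (s n)) \<longlonglongrightarrow> integral\<^sup>L lebesgue l"
    by (rule integral_dominated_convergence[OF l_meas s_meas w_int AE1 AE2])
  have "(\<lambda>n. of_real (r n) * z) \<longlonglongrightarrow> of_real 1 * z"
    by (intro tendsto_intros r1)
  moreover have "isCont F z"
    using holomorphic_on_imp_continuous_on[OF holo] z by (simp add: continuous_on_eq_continuous_at)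
  ultimately have "(\<lambda>n. Re (F (of_real (r n) * z))) \<longlonglongrightarrow> Re (F z)"
    by (auto intro!: tendsto_intros isCont_tendsto_compose[of z F])
  from LIMSEQ_unique[OF L1[unfolded s_val] this]
  show "(LINT t:{0..2 * pi}|lebesgue. ?K t * \<psi> t) = Re (F z)"
    by (simp add: set_lebesgue_integral_def l_def)
qed

section \<open>Poisson integrals at a jump\<close>

lemma measurable_continuous_except_countable:
  fixes h :: "real \<Rightarrow> 'a::euclidean_space"
  assumes S: "S \<in> sets lebesgue" and X: "countable X"
    and cont: "\<And>t. t \<in> S \<Longrightarrow> t \<notin> X \<Longrightarrow> continuous (at t within S) h"
  shows "(\<lambda>t. indicator S t *\<^sub>R h t) \<in> borel_measurable lebesgue"
proof (rule measurable_discrete_difference[where X = X and f = "\<lambda>t. indicator (S - X) t *\<^sub>R h t"])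
  have Xm: "X \<in> sets lebesgue"
    by (rule sets.countable[OF _ X]) simp
  have "continuous_on (S - X) h"
    unfolding continuous_on_eq_continuous_within
    using cont by (meson DiffD1 DiffD2 Diff_subset continuous_within_subset)
  then have "h \<in> borel_measurable (lebesgue_on (S - X))"
    using S Xm by (intro continuous_imp_measurable_on_sets_lebesgue sets.Diff)
  then show "(\<lambda>t. indicator (S - X) t *\<^sub>R h t) \<in> borel_measurable lebesgue"
    using S Xm by (subst (asm) borel_measurable_restrict_space_iff) auto
qed (use X in \<open>auto simp: indicator_def\<close>)

lemma poisson_set_integrable:
  fixes h :: "real \<Rightarrow> 'a::euclidean_space"
  assumes z: "cmod z < 1" and X: "countable X" and M: "\<And>t. norm (h t) \<le> M"
    and cont: "\<And>t. t \<in> {0..2 * pi} \<Longrightarrow> t \<notin> X \<Longrightarrow> continuous (at t within {0..2 * pi}) h"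
  shows "set_integrable lebesgue {0..2 * pi} (\<lambda>t. poisson_kernel (cmod z) (t - Arg z) *\<^sub>R h t)"
  unfolding set_integrable_def
proof (rule Bochner_Integration.integrable_bound)
  let ?K = "\<lambda>t. poisson_kernel (cmod z) (t - Arg z)"
  have contK: "continuous_on {0..2 * pi} ?K" by (rule continuous_on_poisson_kernel[OF z])
  show "integrable lebesgue (\<lambda>t. indicator {0..2 * pi} t *\<^sub>R (?K t * M))"
    using absolutely_integrable_continuous_real[OF continuous_on_mult_right[OF contK]]
    unfolding set_integrable_def .
  show "(\<lambda>t. indicator {0..2 * pi} t *\<^sub>R (?K t *\<^sub>R h t)) \<in> borel_measurable lebesgue"
  proof (rule measurable_continuous_except_countable[OF _ X])
    fix t assume t: "t \<in> {0..2 * pi}" "t \<notin> X"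
    have "continuous (at t within {0..2 * pi}) ?K"
      using contK t(1) by (simp add: continuous_on_eq_continuous_within)
    then show "continuous (at t within {0..2 * pi}) (\<lambda>t. ?K t *\<^sub>R h t)"
      using cont[OF t] by (rule continuous_scaleR)
  qed simp
  show "AE t in lebesgue. norm (indicator {0..2 * pi} t *\<^sub>R (?K t *\<^sub>R h t)) \<le> norm (indicator {0..2 * pi} t *\<^sub>R (?K t * M))"
  proof (rule AE_I2)
    fix t
    have "0 \<le> M" using M[of t] norm_ge_zero order_trans by blast
    then show "norm (indicator {0..2 * pi} t *\<^sub>R (?K t *\<^sub>R h t)) \<le> norm (indicator {0..2 * pi} t *\<^sub>R (?K t * M))"
      using poisson_kernel_nonneg[OF z, of t] M[of t]
      by (auto simp: indicator_def abs_mult mult_left_mono)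
  qed
qed

lemma countable_cis_fibre: "countable {t. cis t = cis s}"
proof (rule countable_subset)
  show "{t. cis t = cis s} \<subseteq> range (\<lambda>k::int. s + 2 * pi * of_int k)"
  proof
    fix t assume "t \<in> {t. cis t = cis s}"
    then have "sin t = sin s \<and> cos t = cos s" by (simp add: complex_eq_iff)
    then obtain k :: int where "t = s + 2 * pi * of_int k" unfolding sin_cos_eq_iff by auto
    then show "t \<in> range (\<lambda>k::int. s + 2 * pi * of_int k)" by blast
  qed
qed simp

lemma countable_cis_vimage:
  assumes "countable Z"
  shows "countable {t. cis t \<in> Z}"
proof -
  have "countable (\<Union>\<zeta>\<in>Z. {t. cis t = \<zeta>})"
  proof (intro countable_UN assms)
    fix \<zeta> show "countable {t. cis t = \<zeta>}"
    proof (cases "\<exists>s. \<zeta> = cis s")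
      case True
      then show ?thesis using countable_cis_fibre by blast
    next
      case False
      then have "{t. cis t = \<zeta>} = {}" by auto
      then show ?thesis by simp
    qed
  qed
  then show ?thesis by (rule countable_subset[rotated]) auto
qed

text \<open>Up to the factor \<open>\<pi>\<close>, the angle under which \<open>z\<close> is seen from \<open>cis s\<close>, measured from the inner normal.
It is the bounded harmonic function whose boundary values decrease by 1 at \<open>cis s\<close> and are linear
in the angle elsewhere.\<close>

definition jump_function :: "real \<Rightarrow> complex \<Rightarrow> real" where
  "jump_function s z = Im (Ln (1 - z * cis (- s))) / pi"

lemma Re_one_minus_pos:
  assumes "z \<in> cball 0 1" "z \<noteq> cis s"
  shows "0 < Re (1 - z * cis (- s))"
proof (rule ccontr)
  define w where "w = z * cis (- s)"
  assume "\<not> 0 < Re (1 - z * cis (- s))"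
  then have 1: "Re w \<ge> 1" by (simp add: w_def)
  have "cmod w \<le> 1" using assms(1) by (simp add: w_def norm_mult)
  then have "Re w \<le> 1" "(Re w)\<^sup>2 + (Im w)\<^sup>2 \<le> 1"
    using complex_Re_le_cmod[of w] by (auto simp: cmod_power2[symmetric] power_le_one)
  then have "w = 1" using 1 by (auto simp: complex_eq_iff)
  then have "z * cis (- s) * cis s = cis s" by (simp add: w_def)
  then have "z = cis s" by (simp add: cis_mult mult.assoc)
  then show False using assms(2) by simp
qed

lemma jump_function_bound:
  assumes "z \<in> cball 0 1" "z \<noteq> cis s"
  shows "\<bar>jump_function s z\<bar> < 1 / 2"
proof -
  have "\<bar>Im (Ln (1 - z * cis (- s)))\<bar> < pi / 2"
    using Re_Ln_pos_lt_imp[OF Re_one_minus_pos[OF assms]] .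
  then show ?thesis by (simp add: jump_function_def abs_divide field_simps)
qed

lemma jump_function_cis:
  "0 < x \<Longrightarrow> x < 2 * pi \<Longrightarrow> jump_function s (cis (s + x)) = x / (2 * pi) - 1 / 2"
  "- 2 * pi < x \<Longrightarrow> x < 0 \<Longrightarrow> jump_function s (cis (s + x)) = x / (2 * pi) + 1 / 2"
proof -
  have exp_polar: "exp (of_real (ln a) + \<i> * of_real b) = of_real a * cis b" if "a > 0" for a b :: real
    using that by (simp add: exp_add cis_conv_exp exp_of_real)
  have main: "jump_function s (cis (s + x)) = x / (2 * pi) - 1 / 2" if x: "0 < x" "x < 2 * pi" for x
  proof -
    define y where "y = x / 2"
    have y: "x = 2 * y" "0 < y" "y < pi" using x by (auto simp: y_def)
    have "sin y > 0" using y by (intro sin_gt_zero) auto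
    have "1 - cis (s + x) * cis (- s) = of_real (2 * sin y) * cis (y - pi / 2)"
      by (simp add: cis_mult complex_eq_iff y(1) cos_diff sin_diff cos_double_sin sin_double power2_eq_square)
    also have "\<dots> = exp (of_real (ln (2 * sin y)) + \<i> * of_real (y - pi / 2))"
      using \<open>sin y > 0\<close> by (intro exp_polar[symmetric]) simp
    finally have "Ln (1 - cis (s + x) * cis (- s)) = of_real (ln (2 * sin y)) + \<i> * of_real (y - pi / 2)"
      using y by (simp only:) (rule Ln_exp, auto)
    from arg_cong[OF this, of Im] have "Im (Ln (1 - cis (s + x) * cis (- s))) = y - pi / 2" by simp
    then have "jump_function s (cis (s + x)) = (y - pi / 2) / pi" by (simp only: jump_function_def)
    also have "\<dots> = x / (2 * pi) - 1 / 2" by (simp add: y(1) field_simps)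
    finally show ?thesis .
  qed
  then show "0 < x \<Longrightarrow> x < 2 * pi \<Longrightarrow> jump_function s (cis (s + x)) = x / (2 * pi) - 1 / 2" .
  assume "- 2 * pi < x" "x < 0"
  moreover have "cis (s + (x + 2 * pi)) = cis (s + x)"
    by (simp add: complex_eq_iff add.assoc[symmetric])
  ultimately show "jump_function s (cis (s + x)) = x / (2 * pi) + 1 / 2"
    using main[of "x + 2 * pi"] by (simp add: field_simps)
qed

lemma jump_function_left_right:
  "((\<lambda>t. jump_function s (cis t)) \<longlongrightarrow> 1 / 2) (at_left s)"
  "((\<lambda>t. jump_function s (cis t)) \<longlongrightarrow> - 1 / 2) (at_right s)"
proof -
  have l1: "((\<lambda>t. (t - s) / (2 * pi) + 1 / 2) \<longlongrightarrow> (s - s) / (2 * pi) + 1 / 2) (at_left s)"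
    by (intro tendsto_intros) simp
  have l2: "\<forall>\<^sub>F t in at_left s. (t - s) / (2 * pi) + 1 / 2 = jump_function s (cis t)"
  proof (rule eventually_at_leftI[of "s - 2 * pi"])
    fix t assume "t \<in> {s - 2 * pi<..<s}"
    then show "(t - s) / (2 * pi) + 1 / 2 = jump_function s (cis t)"
      using jump_function_cis(2)[of "t - s" s] by simp
  qed simp
  show "((\<lambda>t. jump_function s (cis t)) \<longlongrightarrow> 1 / 2) (at_left s)"
    using Lim_transform_eventually[OF l1 l2] by simp
  have r1: "((\<lambda>t. (t - s) / (2 * pi) - 1 / 2) \<longlongrightarrow> (s - s) / (2 * pi) - 1 / 2) (at_right s)"
    by (intro tendsto_intros) simp
  have r2: "\<forall>\<^sub>F t in at_right s. (t - s) / (2 * pi) - 1 / 2 = jump_function s (cis t)"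
  proof (rule eventually_at_rightI[of s "s + 2 * pi"])
    fix t assume "t \<in> {s<..<s + 2 * pi}"
    then show "(t - s) / (2 * pi) - 1 / 2 = jump_function s (cis t)"
      using jump_function_cis(1)[of "t - s" s] by simp
  qed simp
  show "((\<lambda>t. jump_function s (cis t)) \<longlongrightarrow> - 1 / 2) (at_right s)"
    using Lim_transform_eventually[OF r1 r2] by simp
qed

lemma jump_function_poisson:
  assumes z: "cmod z < 1"
  shows "set_integrable lebesgue {0..2 * pi} (\<lambda>t. poisson_kernel (cmod z) (t - Arg z) * jump_function s (cis t))"
    and "(LINT t:{0..2 * pi}|lebesgue. poisson_kernel (cmod z) (t - Arg z) * jump_function s (cis t)) = jump_function s z"
proof -
  define F where "F = (\<lambda>z. - \<i> * Ln (1 - z * cis (- s)) / of_real pi)"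
  have ReF: "Re (F w) = jump_function s w" for w
    by (simp add: F_def jump_function_def)
  have pos: "0 < Re (1 - w * cis (- s))" if "w \<in> ball 0 1" for w
    by (rule Re_one_minus_pos) (use that in auto)
  have slit: "1 - w * cis (- s) \<notin> \<real>\<^sub>\<le>\<^sub>0" if "0 < Re (1 - w * cis (- s))" for w
    using that by (auto simp: complex_nonpos_Reals_iff)
  have 1: "F holomorphic_on ball 0 1"
    unfolding F_def by (intro holomorphic_intros) (use slit pos in auto)
  have 2: "\<bar>Re (F w)\<bar> \<le> 1 / 2" if "w \<in> ball 0 1" for w
  proof -
    have "\<bar>jump_function s w\<bar> < 1 / 2" by (rule jump_function_bound) (use that in auto)
    then show ?thesis by (simp add: ReF)
  qed
  have 3: "((\<lambda>r. Re (F (of_real r * cis t))) \<longlongrightarrow> jump_function s (cis t)) (at_left 1)"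
    if t: "t \<notin> {t. cis t = cis s}" for t
  proof -
    have p: "0 < Re (1 - cis t * cis (- s))" by (rule Re_one_minus_pos) (use t in auto)
    have "isCont F (cis t)"
      unfolding F_def by (intro continuous_intros) (use slit[OF p] in auto)
    moreover have "((\<lambda>r. of_real r * cis t) \<longlongrightarrow> of_real 1 * cis t) (at_left 1)"
      by (intro tendsto_intros)
    ultimately have "((\<lambda>r. F (of_real r * cis t)) \<longlongrightarrow> F (cis t)) (at_left 1)"
      by (auto intro: isCont_tendsto_compose)
    from tendsto_Re[OF this] show ?thesis by (simp add: ReF)
  qed
  from poisson_integral_bounded_harmonic[OF 1 2 z countable_cis_fibre 3]
  show "set_integrable lebesgue {0..2 * pi} (\<lambda>t. poisson_kernel (cmod z) (t - Arg z) * jump_function s (cis t))"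
    and "(LINT t:{0..2 * pi}|lebesgue. poisson_kernel (cmod z) (t - Arg z) * jump_function s (cis t)) = jump_function s z"
    by (simp_all add: ReF)
qed

lemma bound_poisson:
  assumes z: "cmod z < 1"
  shows "set_integrable lebesgue {0..2 * pi} (\<lambda>t. poisson_kernel (cmod z) (t - Arg z) * (a + b * (1 - cos (t - s))))"
    and "(LINT t:{0..2 * pi}|lebesgue. poisson_kernel (cmod z) (t - Arg z) * (a + b * (1 - cos (t - s))))
      = a + b * (1 - Re (z * cis (- s)))"
proof -
  define F where "F = (\<lambda>w. of_real a + of_real b * (1 - w * cis (- s)))"
  have 1: "F holomorphic_on ball 0 1" unfolding F_def by (intro holomorphic_intros)
  have 2: "\<bar>Re (F w)\<bar> \<le> \<bar>a\<bar> + \<bar>b\<bar> * 2" if "w \<in> ball 0 1" for w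
  proof -
    have "\<bar>Re (F w)\<bar> \<le> cmod (F w)" by (rule abs_Re_le_cmod)
    also have "\<dots> \<le> \<bar>a\<bar> + cmod (of_real b * (1 - w * cis (- s)))"
      unfolding F_def by (rule order_trans[OF norm_triangle_ineq]) simp
    also have "cmod (of_real b * (1 - w * cis (- s))) \<le> \<bar>b\<bar> * 2"
    proof -
      have "cmod (1 - w * cis (- s)) \<le> 1 + cmod (w * cis (- s))"
        using norm_triangle_ineq4[of 1 "w * cis (- s)"] by simp
      also have "\<dots> \<le> 2" using that by (simp add: norm_mult)
      finally show ?thesis unfolding norm_mult by (intro mult_mono) auto
    qed
    finally show ?thesis by simp
  qed
  have 3: "((\<lambda>r. Re (F (of_real r * cis t))) \<longlongrightarrow> a + b * (1 - cos (t - s))) (at_left 1)" for t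
  proof -
    have "((\<lambda>r. Re (F (of_real r * cis t))) \<longlongrightarrow> Re (F (of_real 1 * cis t))) (at_left 1)"
      unfolding F_def by (intro tendsto_intros)
    also have "Re (F (of_real 1 * cis t)) = a + b * (1 - cos (t - s))"
      by (simp add: F_def cis_mult)
    finally show ?thesis .
  qed
  from poisson_integral_bounded_harmonic[OF 1 2 z countable_empty 3]
  show "set_integrable lebesgue {0..2 * pi} (\<lambda>t. poisson_kernel (cmod z) (t - Arg z) * (a + b * (1 - cos (t - s))))"
    and "(LINT t:{0..2 * pi}|lebesgue. poisson_kernel (cmod z) (t - Arg z) * (a + b * (1 - cos (t - s))))
      = a + b * (1 - Re (z * cis (- s)))"
    by (simp_all add: F_def)
qed

lemma set_integral_times_vector:
  fixes v :: "'a::euclidean_space" and k :: "'b \<Rightarrow> real"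
  assumes "set_integrable M S k"
  shows "set_integrable M S (\<lambda>t. k t *\<^sub>R v)" "(LINT t:S|M. k t *\<^sub>R v) = (LINT t:S|M. k t) *\<^sub>R v"
proof -
  have eq: "indicator S t *\<^sub>R (k t *\<^sub>R v) = (indicat_real S t *\<^sub>R k t) *\<^sub>R v" for t by simp
  have int: "integrable M (\<lambda>t. indicat_real S t *\<^sub>R k t)"
    using assms unfolding set_integrable_def .
  show "set_integrable M S (\<lambda>t. k t *\<^sub>R v)"
    unfolding set_integrable_def eq by (rule integrable_scaleR_left) (rule int)
  show "(LINT t:S|M. k t *\<^sub>R v) = (LINT t:S|M. k t) *\<^sub>R v"
    unfolding set_lebesgue_integral_def eq by (rule integral_scaleR_left) (rule int)
qed

text \<open>Near \<open>cis s\<close> the Poisson integral of a function with one-sided limits \<open>A\<close>, \<open>B\<close> behaves like the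
combination of \<open>A\<close> and \<open>B\<close> given by the jump function: the difference \<open>k\<close> of the boundary values
tends to 0 at \<open>s\<close>, so it is bounded by \<open>e + b (1 - cos (t - s))\<close> for some \<open>b\<close>, and the Poisson integral
of this majorant is explicit.\<close>

lemma poisson_integral_jump_approximation:
  fixes h :: "real \<Rightarrow> 'a::euclidean_space"
  assumes per: "\<And>t. h (t + 2 * pi) = h t" and M: "\<And>t. norm (h t) \<le> M"
    and int: "\<And>z. cmod z < 1 \<Longrightarrow> set_integrable lebesgue {0..2 * pi} (\<lambda>t. poisson_kernel (cmod z) (t - Arg z) *\<^sub>R h t)"
    and A: "(h \<longlongrightarrow> A) (at_left s)" and B: "(h \<longlongrightarrow> B) (at_right s)" and e: "e > 0"
  shows "\<exists>b. \<forall>z. cmod z < 1 \<longrightarrow>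
    norm ((LINT t:{0..2 * pi}|lebesgue. poisson_kernel (cmod z) (t - Arg z) *\<^sub>R h t)
      - ((1 / 2) *\<^sub>R (A + B) + jump_function s z *\<^sub>R (A - B))) \<le> e + b * (1 - Re (z * cis (- s)))"
proof -
  define k where "k = (\<lambda>t. h t - ((1 / 2) *\<^sub>R (A + B) + jump_function s (cis t) *\<^sub>R (A - B)))"
  have kper: "k (t + 2 * pi) = k t" for t by (simp add: k_def per cis.ctr)
  note kper_int = periodic_int_multiple[of k, OF kper]
  have half: "(1 / 2) *\<^sub>R x + (1 / 2) *\<^sub>R x = x" for x :: 'a
    by (simp add: scaleR_left_distrib[symmetric])
  have "(k \<longlongrightarrow> A - ((1 / 2) *\<^sub>R (A + B) + (1 / 2) *\<^sub>R (A - B))) (at_left s)"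
    unfolding k_def by (intro tendsto_intros A jump_function_left_right)
  moreover have "A - ((1 / 2) *\<^sub>R (A + B) + (1 / 2) *\<^sub>R (A - B)) = 0"
    using half[of A] by (simp add: scaleR_right_distrib scaleR_right_diff_distrib)
  moreover have "(k \<longlongrightarrow> B - ((1 / 2) *\<^sub>R (A + B) + (- 1 / 2) *\<^sub>R (A - B))) (at_right s)"
    unfolding k_def by (intro tendsto_intros B jump_function_left_right)
  moreover have "B - ((1 / 2) *\<^sub>R (A + B) + (- 1 / 2) *\<^sub>R (A - B)) = 0"
    using half[of B] by (simp add: scaleR_right_distrib scaleR_right_diff_distrib)
  ultimately have "(k \<longlongrightarrow> 0) (at s)"
    by (simp add: filterlim_split_at)
  then obtain d where d: "d > 0" "\<And>t. t \<noteq> s \<Longrightarrow> dist t s < d \<Longrightarrow> norm (k t) < e"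
    using tendstoD[OF _ e, of k 0 "at s"] unfolding eventually_at by auto
  define d' where "d' = min d pi"
  have d': "0 < d'" "d' \<le> pi" using d(1) by (auto simp: d'_def)
  define c where "c = 1 - cos d'"
  have "cos d' < cos 0" using d' by (intro cos_monotone_0_pi) auto
  then have c: "c > 0" by (simp add: c_def)
  define N where "N = M + norm ((1 / 2) *\<^sub>R (A + B)) + norm (A - B)"
  have M0: "0 \<le> M" using M[of 0] norm_ge_zero order_trans by blast
  have N: "N \<ge> 0" using M0 by (simp add: N_def)
  have kN: "norm (k t) \<le> N" if "cis t \<noteq> cis s" for t
  proof -
    have "\<bar>jump_function s (cis t)\<bar> \<le> 1"
      using jump_function_bound[of "cis t" s] that by simp
    then have "norm (jump_function s (cis t) *\<^sub>R (A - B)) \<le> norm (A - B)"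
      by (simp add: mult_left_le_one_le)
    then show ?thesis
      unfolding k_def N_def using M[of t]
      by (intro order_trans[OF norm_triangle_ineq4] order_trans[OF add_left_mono[OF norm_triangle_ineq]]) auto
  qed
  have kb: "norm (k t) \<le> e + N / c * (1 - cos (t - s))" if ne: "cis t \<noteq> cis s" for t
  proof -
    \<comment> \<open>The representative \<open>u\<close> of \<open>t\<close> modulo \<open>2\<pi>\<close> lies within \<open>\<pi>\<close> of \<open>s\<close>.\<close>
    define n where "n = \<lfloor>(t - s + pi) / (2 * pi)\<rfloor>"
    define u where "u = t - 2 * pi * of_int n"
    have "of_int n \<le> (t - s + pi) / (2 * pi)" "(t - s + pi) / (2 * pi) < of_int n + 1"
      unfolding n_def by linarith+
    then have u: "- pi \<le> u - s" "u - s \<le> pi" by (simp_all add: u_def field_simps)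
    have ku: "k t = k u" using kper_int[of u n] by (simp add: u_def)
    have tu: "cos (t - s) = cos (u - s)" "cis t = cis u"
      using sin_cos_eq_iff[of "t - s" "u - s"] sin_cos_eq_iff[of t u] by (auto simp: u_def complex_eq_iff)
    have q: "0 \<le> N / c * (1 - cos (u - s))" using N c by simp
    show ?thesis
    proof (cases "\<bar>u - s\<bar> < d'")
      case True
      have "u \<noteq> s" using ne tu by auto
      then have "norm (k u) < e" using True by (intro d) (auto simp: dist_real_def d'_def)
      then show ?thesis unfolding ku tu using q by linarith
    next
      case False
      have "cos \<bar>u - s\<bar> \<le> cos d'" using False u d' by (intro cos_monotone_0_pi_le) auto
      then have "c \<le> 1 - cos (u - s)" by (simp add: c_def)
      then have "N / c * c \<le> N / c * (1 - cos (u - s))" using N c by (intro mult_left_mono) auto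
      then show ?thesis unfolding ku tu using kN[of u] ne tu e c by simp
    qed
  qed
  have "norm ((LINT t:{0..2 * pi}|lebesgue. poisson_kernel (cmod z) (t - Arg z) *\<^sub>R h t)
      - ((1 / 2) *\<^sub>R (A + B) + jump_function s z *\<^sub>R (A - B))) \<le> e + N / c * (1 - Re (z * cis (- s)))"
    if z: "cmod z < 1" for z
  proof -
    let ?K = "\<lambda>t. poisson_kernel (cmod z) (t - Arg z)"
    note jump_int = jump_function_poisson[OF z, of s]
    have one_int: "set_integrable lebesgue {0..2 * pi} ?K" "(LINT t:{0..2 * pi}|lebesgue. ?K t) = 1"
      using bound_poisson[OF z, of 1 0 s] by simp_all
    note b_int = bound_poisson[OF z, of e "N / c" s]
    note i1 = set_integral_times_vector[OF one_int(1)] and i2 = set_integral_times_vector[OF jump_int(1)]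
    have k_eq: "?K t *\<^sub>R k t = ?K t *\<^sub>R h t - (?K t *\<^sub>R ((1 / 2) *\<^sub>R (A + B)) + (?K t * jump_function s (cis t)) *\<^sub>R (A - B))" for t
      by (simp add: k_def scaleR_right_diff_distrib scaleR_right_distrib)
    have ik: "set_integrable lebesgue {0..2 * pi} (\<lambda>t. ?K t *\<^sub>R k t)"
      unfolding k_eq by (intro set_integral_diff set_integral_add int[OF z] i1(1) i2(1))
    have "(LINT t:{0..2 * pi}|lebesgue. ?K t *\<^sub>R k t) = (LINT t:{0..2 * pi}|lebesgue. ?K t *\<^sub>R h t)
        - ((LINT t:{0..2 * pi}|lebesgue. ?K t *\<^sub>R ((1 / 2) *\<^sub>R (A + B)))
          + (LINT t:{0..2 * pi}|lebesgue. (?K t * jump_function s (cis t)) *\<^sub>R (A - B)))"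
      unfolding k_eq by (simp only: set_integral_diff(2) set_integral_add int[OF z] i1(1) i2(1))
    also have "(LINT t:{0..2 * pi}|lebesgue. ?K t *\<^sub>R ((1 / 2) *\<^sub>R (A + B))) = (1 / 2) *\<^sub>R (A + B)"
      unfolding i1(2) one_int(2) by simp
    also have "(LINT t:{0..2 * pi}|lebesgue. (?K t * jump_function s (cis t)) *\<^sub>R (A - B)) = jump_function s z *\<^sub>R (A - B)"
      unfolding i2(2) jump_int(2) ..
    finally have eq: "(LINT t:{0..2 * pi}|lebesgue. ?K t *\<^sub>R h t)
      - ((1 / 2) *\<^sub>R (A + B) + jump_function s z *\<^sub>R (A - B)) = (LINT t:{0..2 * pi}|lebesgue. ?K t *\<^sub>R k t)" by simp
    have "norm (LINT t:{0..2 * pi}|lebesgue. ?K t *\<^sub>R k t)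
        \<le> (LINT t:{0..2 * pi}|lebesgue. ?K t * (e + N / c * (1 - cos (t - s))))"
      unfolding set_lebesgue_integral_def
    proof (rule order_trans[OF integral_norm_bound integral_mono_AE])
      show "integrable lebesgue (\<lambda>t. norm (indicator {0..2 * pi} t *\<^sub>R (?K t *\<^sub>R k t)))"
        using ik unfolding set_integrable_def by (rule integrable_norm)
      show "integrable lebesgue (\<lambda>t. indicat_real {0..2 * pi} t *\<^sub>R (?K t * (e + N / c * (1 - cos (t - s)))))"
        using b_int(1) unfolding set_integrable_def .
      have ptw: "norm (indicator {0..2 * pi} t *\<^sub>R (?K t *\<^sub>R k t))
          \<le> indicat_real {0..2 * pi} t *\<^sub>R (?K t * (e + N / c * (1 - cos (t - s))))" if "t \<notin> {t. cis t = cis s}" for t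
        using poisson_kernel_nonneg[OF z, of t] kb[of t] that by (auto simp: indicator_def intro!: mult_left_mono)
      show "AE t in lebesgue. norm (indicator {0..2 * pi} t *\<^sub>R (?K t *\<^sub>R k t))
          \<le> indicat_real {0..2 * pi} t *\<^sub>R (?K t * (e + N / c * (1 - cos (t - s))))"
        using AE_not_countable_lebesgue[OF countable_cis_fibre[of s]] by eventually_elim (rule ptw)
    qed
    then show ?thesis unfolding eq b_int(2) .
  qed
  then show ?thesis by blast
qed

lemma continuous_circle_function:
  assumes "\<not> circle_discontinuity \<phi> (cis t)"
  shows "continuous (at t within S) (\<lambda>t. \<phi> (cis t))"
proof (rule continuous_within_compose2[where f = cis and g = \<phi>])
  have "continuous_on UNIV cis" by (intro continuous_intros)
  then show "continuous (at t within S) cis"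
    by (meson UNIV_I continuous_on_eq_continuous_within continuous_within_subset subset_UNIV)
  have "continuous (at (cis t) within sphere 0 1) \<phi>"
    using assms by (simp add: circle_discontinuity_def)
  then show "continuous (at (cis t) within cis ` S) \<phi>"
    by (rule continuous_within_subset) auto
qed

text \<open>Every cluster value is a limit of points of the segment, because the jump function takes values
between \<open>- 1 / 2\<close> and \<open>1 / 2\<close> in the disk. Conversely, along a straight line that ends at \<open>cis s\<close> the
jump function is constant, and its value is determined by the direction of the line; varying the
direction yields every point of the segment.\<close>

lemma cluster_set_poisson_jump:
  fixes f \<phi> :: "complex \<Rightarrow> 'a::euclidean_space"
  assumes poisson: "\<And>z. z \<in> ball 0 1 \<Longrightarrow> f z = poisson_integral \<phi> z"
    and M: "\<And>z. z \<in> sphere 0 1 \<Longrightarrow> norm (\<phi> z) \<le> M"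
    and X: "countable {\<zeta>. circle_discontinuity \<phi> \<zeta>}"
    and A: "((\<lambda>t. \<phi> (cis t)) \<longlongrightarrow> A) (at_left s)" and B: "((\<lambda>t. \<phi> (cis t)) \<longlongrightarrow> B) (at_right s)"
  shows "cluster_set f (cis s) = closed_segment A B"
proof -
  have int: "set_integrable lebesgue {0..2 * pi} (\<lambda>t. poisson_kernel (cmod z) (t - Arg z) *\<^sub>R \<phi> (cis t))"
    if "cmod z < 1" for z
    by (rule poisson_set_integrable[OF that countable_cis_vimage[OF X], where M = M])
      (use M continuous_circle_function in auto)
  have per: "\<phi> (cis (t + 2 * pi)) = \<phi> (cis t)" for t by (simp add: cis.ctr)
  have Mcis: "norm (\<phi> (cis t)) \<le> M" for t by (rule M) simp
  note approx = poisson_integral_jump_approximation[where h = "\<lambda>t. \<phi> (cis t)", OF per Mcis int A B]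
  define c where "c = (\<lambda>z. (1 / 2) *\<^sub>R (A + B) + jump_function s z *\<^sub>R (A - B))"
  have lim: "(\<lambda>n. f (z n) - c (z n)) \<longlonglongrightarrow> 0"
    if z: "\<And>n. z n \<in> ball 0 1" "z \<longlonglongrightarrow> cis s" for z
  proof (rule tendstoI)
    fix e :: real assume "e > 0"
    then obtain b where b: "\<And>z. cmod z < 1 \<Longrightarrow>
      norm ((LINT t:{0..2 * pi}|lebesgue. poisson_kernel (cmod z) (t - Arg z) *\<^sub>R \<phi> (cis t)) - c z)
        \<le> e / 2 + b * (1 - Re (z * cis (- s)))"
      using approx[of "e / 2"] by (auto simp: c_def)
    have "(\<lambda>n. e / 2 + b * (1 - Re (z n * cis (- s)))) \<longlonglongrightarrow> e / 2 + b * (1 - Re (cis s * cis (- s)))"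
      by (intro tendsto_intros z)
    then have "(\<lambda>n. e / 2 + b * (1 - Re (z n * cis (- s)))) \<longlonglongrightarrow> e / 2"
      by (simp add: cis_mult)
    from order_tendstoD(2)[OF this, of e] \<open>e > 0\<close>
    have "\<forall>\<^sub>F n in sequentially. e / 2 + b * (1 - Re (z n * cis (- s))) < e" by simp
    then show "\<forall>\<^sub>F n in sequentially. dist (f (z n) - c (z n)) 0 < e"
    proof eventually_elim
      case (elim n)
      have "norm (f (z n) - c (z n)) \<le> e / 2 + b * (1 - Re (z n * cis (- s)))"
        using b[of "z n"] z(1)[of n] poisson[OF z(1)[of n]] by (simp add: poisson_integral_def)
      then show ?case using elim by simp
    qed
  qed
  have seg: "c z = (1 - (1 / 2 - jump_function s z)) *\<^sub>R A + (1 / 2 - jump_function s z) *\<^sub>R B" for z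
    by (simp add: c_def algebra_simps)
  show ?thesis
  proof (intro subset_antisym subsetI)
    fix \<alpha> assume "\<alpha> \<in> cluster_set f (cis s)"
    then obtain z where z: "\<And>n. z n \<in> ball 0 1" "z \<longlonglongrightarrow> cis s" "(\<lambda>n. f (z n)) \<longlonglongrightarrow> \<alpha>"
      by (auto simp: cluster_set_def)
    have "(\<lambda>n. f (z n) - (f (z n) - c (z n))) \<longlonglongrightarrow> \<alpha> - 0"
      by (intro tendsto_diff z lim)
    then have cl: "(\<lambda>n. c (z n)) \<longlonglongrightarrow> \<alpha>" by simp
    have "c (z n) \<in> closed_segment A B" for n
    proof -
      have "\<bar>jump_function s (z n)\<bar> < 1 / 2" by (rule jump_function_bound) (use z(1)[of n] in auto)
      then show ?thesis unfolding in_segment seg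
        by (intro exI[of _ "1 / 2 - jump_function s (z n)"]) auto
    qed
    then show "\<alpha> \<in> closed_segment A B"
      by (rule closed_sequentially[OF closed_segment _ cl])
  next
    fix \<alpha> assume "\<alpha> \<in> closed_segment A B"
    then obtain u where u: "0 \<le> u" "u \<le> 1" "\<alpha> = (1 - u) *\<^sub>R A + u *\<^sub>R B" by (auto simp: in_segment)
    \<comment> \<open>The value that the jump function must tend to is \<open>1 / 2 - u\<close>; the factor keeps the lines
       transversal to the circle when \<open>u\<close> is 0 or 1.\<close>
    define l where "l = (\<lambda>n::nat. (1 / 2 - u) * (1 - 1 / real (Suc (Suc n))))"
    have l: "\<bar>l n\<bar> < 1 / 2" for n
    proof -
      have "\<bar>l n\<bar> = \<bar>1 / 2 - u\<bar> * (1 - 1 / real (Suc (Suc n)))" by (simp add: l_def abs_mult)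
      also have "\<dots> \<le> 1 / 2 * (1 - 1 / real (Suc (Suc n)))"
      proof (rule mult_right_mono)
        show "\<bar>1 / 2 - u\<bar> \<le> 1 / 2" using u(1,2) by linarith
      qed simp
      also have "\<dots> < 1 / 2" by simp
      finally show ?thesis .
    qed
    \<comment> \<open>The line with angle \<open>\<pi> l n\<close> to the inner normal stays in the disk for lengths below \<open>2 cos (\<pi> l n)\<close>.\<close>
    define d where "d = (\<lambda>n::nat. cos (pi * l n) / real (Suc n))"
    have cospos: "0 < cos (pi * l n)" for n
    proof (rule cos_gt_zero_pi)
      have "- (1 / 2) < l n" "l n < 1 / 2" using l[of n] by linarith+
      then have "pi * (- (1 / 2)) < pi * l n" "pi * l n < pi * (1 / 2)"
        by (simp_all only: mult_less_cancel_left_pos[OF pi_gt_zero])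
      then show "- (pi / 2) < pi * l n" "pi * l n < pi / 2" by simp_all
    qed
    have "d n \<le> 1 / real (Suc n)" for n
      unfolding d_def by (rule divide_right_mono) simp_all
    then have d: "0 < d n" "d n \<le> cos (pi * l n)" "d n \<le> 1 / real (Suc n)" for n
      using cospos[of n] by (auto simp: d_def field_simps)
    define z where "z = (\<lambda>n. cis s * (1 - of_real (d n) * cis (pi * l n)))"
    have inb: "z n \<in> ball 0 1" for n
    proof -
      have "(cmod (z n))\<^sup>2 = (1 - d n * cos (pi * l n))\<^sup>2 + (d n * sin (pi * l n))\<^sup>2"
        by (simp add: z_def norm_mult cmod_power2)
      also have "\<dots> = 1 - 2 * d n * cos (pi * l n) + (d n)\<^sup>2 * ((cos (pi * l n))\<^sup>2 + (sin (pi * l n))\<^sup>2)"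
        by (simp only: power2_eq_square) (simp only: algebra_simps)
      also have "\<dots> = 1 - d n * (2 * cos (pi * l n) - d n)"
        by (simp add: power2_eq_square algebra_simps)
      also have "\<dots> < 1"
      proof -
        have "0 < 2 * cos (pi * l n) - d n" using d(2)[of n] cospos[of n] by linarith
        then show ?thesis using d(1)[of n] by simp
      qed
      finally show ?thesis by (simp add: power_less_one_iff abs_square_less_1)
    qed
    have d0: "d \<longlonglongrightarrow> 0"
      by (rule tendsto_sandwich[OF _ _ tendsto_const lim_1_over_n[THEN LIMSEQ_Suc]])
        (use d in \<open>auto intro!: always_eventually less_imp_le simp del: of_nat_Suc\<close>)
    have zlim: "z \<longlonglongrightarrow> cis s"
    proof (rule metric_tendsto_imp_tendsto[OF d0])
      show "\<forall>\<^sub>F n in sequentially. dist (z n) (cis s) \<le> dist (d n) 0"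
        by (auto intro!: always_eventually simp: z_def dist_norm algebra_simps norm_mult)
    qed
    have Jz: "jump_function s (z n) = l n" for n
    proof -
      have "1 - z n * cis (- s) = of_real (d n) * cis (pi * l n)"
        by (simp add: z_def cis_mult algebra_simps)
      also have "\<dots> = exp (of_real (ln (d n)) + \<i> * of_real (pi * l n))"
        using d(1)[of n] by (simp add: exp_add cis_conv_exp exp_of_real)
      finally have "Ln (1 - z n * cis (- s)) = of_real (ln (d n)) + \<i> * of_real (pi * l n)"
      proof (simp only:, intro Ln_exp)
        show "- pi < Im (of_real (ln (d n)) + \<i> * of_real (pi * l n))" "Im (of_real (ln (d n)) + \<i> * of_real (pi * l n)) \<le> pi"
        proof -
          have "\<bar>pi * l n\<bar> \<le> pi * (1 / 2)"
            unfolding abs_mult using l[of n] by (intro mult_mono) auto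
          moreover have "pi * (1 / 2) < pi" by simp
          ultimately have "- pi < pi * l n" "pi * l n \<le> pi" by linarith+
          then show "- pi < Im (of_real (ln (d n)) + \<i> * of_real (pi * l n))" "Im (of_real (ln (d n)) + \<i> * of_real (pi * l n)) \<le> pi"
            by simp_all
        qed
      qed
      from arg_cong[OF this, of Im] have "Im (Ln (1 - z n * cis (- s))) = pi * l n" by simp
      then have "jump_function s (z n) = pi * l n / pi" by (simp only: jump_function_def)
      then show ?thesis by simp
    qed
    have "l \<longlonglongrightarrow> (1 / 2 - u) * (1 - 0)"
      unfolding l_def by (intro tendsto_mult tendsto_diff tendsto_const lim_1_over_n[THEN LIMSEQ_Suc, THEN LIMSEQ_Suc])
    then have "(\<lambda>n. (1 - (1 / 2 - l n)) *\<^sub>R A + (1 / 2 - l n) *\<^sub>R B) \<longlonglongrightarrow>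
        (1 - (1 / 2 - (1 / 2 - u) * (1 - 0))) *\<^sub>R A + (1 / 2 - (1 / 2 - u) * (1 - 0)) *\<^sub>R B"
      by (intro tendsto_intros)
    then have "(\<lambda>n. c (z n)) \<longlonglongrightarrow> \<alpha>" by (simp add: seg Jz u(3))
    from tendsto_add[OF this lim[OF inb zlim]] have "(\<lambda>n. f (z n)) \<longlonglongrightarrow> \<alpha>" by simp
    then show "\<alpha> \<in> cluster_set f (cis s)"
      unfolding cluster_set_def using inb zlim by blast
  qed
qed

text \<open>In a compact range a unique cluster value is a limit, and then cluster values at nearby points are
close to it as well.\<close>

lemma limit_at_cluster_singleton:
  fixes f :: "complex \<Rightarrow> 'a::metric_space"
  assumes K: "compact K" "f ` ball 0 1 \<subseteq> K" and p: "cluster_set f z = {p}" and e: "e > 0"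
  shows "\<exists>d>0. (\<forall>w\<in>ball 0 1. dist w z < d \<longrightarrow> dist (f w) p < e) \<and>
    (\<forall>z' \<alpha>. dist z' z < d \<longrightarrow> \<alpha> \<in> cluster_set f z' \<longrightarrow> dist \<alpha> p \<le> e)"
proof -
  have "\<exists>d>0. \<forall>w\<in>ball 0 1. dist w z < d \<longrightarrow> dist (f w) p < e"
  proof (rule ccontr)
    assume no: "\<not> ?thesis"
    have "\<exists>w. w \<in> ball 0 1 \<and> dist w z < 1 / real (Suc n) \<and> e \<le> dist (f w) p" for n
      using no by (metis not_le of_nat_0_less_iff zero_less_Suc zero_less_divide_1_iff)
    then obtain w where w: "\<And>n. w n \<in> ball 0 1" "\<And>n. dist (w n) z < 1 / real (Suc n)" "\<And>n. e \<le> dist (f (w n)) p"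
      by metis
    have wl: "w \<longlonglongrightarrow> z"
      by (rule metric_tendsto_imp_tendsto[OF lim_1_over_n[where 'a = real, THEN LIMSEQ_Suc]])
        (use w(2) in \<open>auto intro!: always_eventually less_imp_le\<close>)
    have "\<forall>n. f (w n) \<in> K" using w(1) K(2) by blast
    then obtain l r where lr: "strict_mono (r :: nat \<Rightarrow> nat)" "(f \<circ> w \<circ> r) \<longlonglongrightarrow> l"
      using K(1) unfolding compact_def by (metis comp_apply)
    have "l \<in> cluster_set f z"
      unfolding cluster_set_def
      using w(1) LIMSEQ_subseq_LIMSEQ[OF wl lr(1)] lr(2)
      by (intro CollectI exI[of _ "w \<circ> r"]) (auto simp: comp_def)
    then have "l = p" using p by simp
    then have "(\<lambda>n. dist ((f \<circ> w \<circ> r) n) p) \<longlonglongrightarrow> 0"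
      using tendsto_dist[OF lr(2) tendsto_const[of p]] by simp
    from LIMSEQ_le_const[OF this, of e] w(3) e show False by (auto simp: comp_def)
  qed
  then obtain d where d: "d > 0" "\<And>w. w \<in> ball 0 1 \<Longrightarrow> dist w z < d \<Longrightarrow> dist (f w) p < e" by blast
  have "dist \<alpha> p \<le> e" if z': "dist z' z < d" "\<alpha> \<in> cluster_set f z'" for z' \<alpha>
  proof -
    obtain w where w: "\<And>n. w n \<in> ball 0 1" "w \<longlonglongrightarrow> z'" "(\<lambda>n. f (w n)) \<longlonglongrightarrow> \<alpha>"
      using z'(2) by (auto simp: cluster_set_def)
    have "\<forall>\<^sub>F n in sequentially. dist (w n) z < d"
      using order_tendstoD(2)[OF tendsto_dist[OF w(2) tendsto_const] z'(1)] .
    then have "\<forall>\<^sub>F n in sequentially. dist (f (w n)) p \<le> e"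
      by eventually_elim (use d(2) w(1) less_imp_le in blast)
    then show ?thesis
      by (rule tendsto_upperbound[OF tendsto_dist[OF w(3) tendsto_const]]) simp
  qed
  then show ?thesis using d by blast
qed

section \<open>Boundary behaviour of harmonic homeomorphisms\<close>

context harmonic_jordan_surface
begin

lemma cluster_boundary_correspondence:
  assumes "simple_path \<gamma>" "pathfinish \<gamma> = pathstart \<gamma>" "path_image \<gamma> = \<Gamma>"
  shows "boundary_correspondence (\<lambda>t. cluster_set f (cis t)) \<gamma>"
proof
  show "cluster_set f (cis (t + 2 * pi)) = cluster_set f (cis t)" for t
    by (simp add: cis.ctr)
  show "cluster_set f (cis t) \<noteq> {}" for t
    by (rule cluster_set_nonempty[OF compact_surface image_disc_subset]) simp
  show "cluster_set f (cis t) \<subseteq> path_image \<gamma>" for t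
    unfolding assms(3) by (rule cluster_set_subset_boundary) simp
  show "connected (\<Union>t\<in>{a..b}. cluster_set f (cis t))" if "a \<le> b" for a b
    by (rule connected_cluster_arc[OF compact_surface image_disc_subset continuous_disc that])
qed (use assms shared_cluster_value in auto)

lemma bounded_on_circle:
  assumes "\<phi> ` sphere 0 1 \<subseteq> \<Gamma>"
  obtains M where "\<And>z. z \<in> sphere 0 1 \<Longrightarrow> norm (\<phi> z) \<le> M"
  using compact_imp_bounded[OF compact_surface] boundary_subset assms
  unfolding bounded_iff by (metis image_subset_iff subsetD)

lemma cluster_set_at_discontinuity:
  assumes bf: "boundary_function \<phi> f \<Gamma>"
    and "((\<lambda>t. \<phi> (cis t)) \<longlongrightarrow> A) (at_left s)" "((\<lambda>t. \<phi> (cis t)) \<longlongrightarrow> B) (at_right s)"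
  shows "cluster_set f (cis s) = closed_segment A B"
proof -
  obtain M where M: "\<And>z. z \<in> sphere 0 1 \<Longrightarrow> norm (\<phi> z) \<le> M"
    using bf bounded_on_circle unfolding boundary_function_def by metis
  show ?thesis
    by (rule cluster_set_poisson_jump[OF _ M _ assms(2,3)]) (use bf in \<open>auto simp: boundary_function_def\<close>)
qed

text \<open>Any selection \<open>\<phi>\<close> from the cluster sets has bounded variation. It is continuous, and the radial
limit of \<open>f\<close>, wherever the cluster set is a singleton, that is, off a countable set; this gives the
Poisson representation of \<open>f\<close>.\<close>

lemma boundary_function_exists:
  assumes "rectifiable_jordan_curve \<Gamma>"
  shows "\<exists>\<phi>. boundary_function \<phi> f \<Gamma>"
proof -
  obtain \<gamma> where \<gamma>: "simple_path \<gamma>" "pathfinish \<gamma> = pathstart \<gamma>" "path_image \<gamma> = \<Gamma>"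
    and bv: "bounded_variation_on \<gamma> 0 1"
    using assms unfolding rectifiable_jordan_curve_def by blast
  interpret bc: boundary_correspondence "\<lambda>t. cluster_set f (cis t)" \<gamma>
    by (rule cluster_boundary_correspondence[OF \<gamma>])
  define \<phi> where "\<phi> = (\<lambda>z. SOME p. p \<in> cluster_set f z)"
  have \<phi>: "\<phi> z \<in> cluster_set f z" if "z \<in> sphere 0 1" for z
  proof -
    have "cluster_set f z \<noteq> {}"
      by (rule cluster_set_nonempty[OF compact_surface image_disc_subset]) (use that in auto)
    then show ?thesis unfolding \<phi>_def by (simp add: some_in_eq)
  qed
  have \<phi>\<Gamma>: "\<phi> ` sphere 0 1 \<subseteq> \<Gamma>" using \<phi> cluster_set_subset_boundary by blast
  define N where "N = {t. \<nexists>p. cluster_set f (cis t) = {p}}"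
  have N: "countable N" unfolding N_def by (rule bc.countable_not_singleton)
  have bv\<phi>: "bounded_variation_on (\<lambda>t. \<phi> (cis t)) 0 (2 * pi)"
    by (rule bc.selection_bounded_variation[OF _ bv]) (simp add: \<phi>)
  have single: "cluster_set f (cis t) = {\<phi> (cis t)}" if t: "t \<notin> N" for t
    using t \<phi>[of "cis t"] by (auto simp: N_def)
  have "{\<zeta>. circle_discontinuity \<phi> \<zeta>} \<subseteq> cis ` N"
  proof
    fix \<zeta> assume "\<zeta> \<in> {\<zeta>. circle_discontinuity \<phi> \<zeta>}"
    then have \<zeta>: "\<zeta> \<in> sphere 0 1" "\<not> continuous (at \<zeta> within sphere 0 1) \<phi>"
      by (auto simp: circle_discontinuity_def)
    then have "\<zeta> = cis (Arg \<zeta>)" using rcis_cmod_Arg[of \<zeta>] by (simp add: rcis_def)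
    then obtain t where t: "\<zeta> = cis t" by blast
    have "t \<in> N"
    proof (rule ccontr)
      assume "t \<notin> N"
      note p = single[OF this]
      have "continuous (at \<zeta> within sphere 0 1) \<phi>"
        unfolding continuous_within_eps_delta
      proof (intro allI impI)
        fix e :: real assume e: "e > 0"
        then have "e / 2 > 0" by simp
        from limit_at_cluster_singleton[OF compact_surface image_disc_subset p this]
        obtain d where d: "d > 0" "\<And>z' \<alpha>. dist z' (cis t) < d \<Longrightarrow> \<alpha> \<in> cluster_set f z' \<Longrightarrow> dist \<alpha> (\<phi> (cis t)) \<le> e / 2"
          by blast
        have "dist (\<phi> z') (\<phi> \<zeta>) < e" if "z' \<in> sphere 0 1" "dist z' \<zeta> < d" for z'
          using d(2)[OF _ \<phi>[OF that(1)]] that(2) e unfolding t by fastforce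
        then show "\<exists>d>0. \<forall>z'\<in>sphere 0 1. dist z' \<zeta> < d \<longrightarrow> dist (\<phi> z') (\<phi> \<zeta>) < e"
          using d(1) by blast
      qed
      then show False using \<zeta>(2) by simp
    qed
    then show "\<zeta> \<in> cis ` N" using t by blast
  qed
  then have disc: "countable {\<zeta>. circle_discontinuity \<phi> \<zeta>}"
    using N countable_image countable_subset by metis
  have per: "\<phi> (cis (t + 2 * pi)) = \<phi> (cis t)" for t by (simp add: cis.ctr)
  have lims: "\<exists>A. ((\<lambda>t. \<phi> (cis t)) \<longlongrightarrow> A) (at_left s)" "\<exists>B. ((\<lambda>t. \<phi> (cis t)) \<longlongrightarrow> B) (at_right s)" for s
    using periodic_one_sided_limits[where g = "\<lambda>t. \<phi> (cis t)", OF per bv\<phi>] by blast+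
  obtain M where M: "\<And>z. z \<in> sphere 0 1 \<Longrightarrow> norm (\<phi> z) \<le> M"
    using bounded_on_circle[OF \<phi>\<Gamma>] by blast
  obtain M' where M': "\<And>x. x \<in> \<Sigma> \<Longrightarrow> norm x \<le> M'"
    using compact_imp_bounded[OF compact_surface] unfolding bounded_iff by blast
  have "f z = poisson_integral \<phi> z" if z: "z \<in> ball 0 1" for z
  proof -
    let ?K = "\<lambda>t. poisson_kernel (cmod z) (t - Arg z)"
    have z1: "cmod z < 1" using z by simp
    have int: "set_integrable lebesgue {0..2 * pi} (\<lambda>t. ?K t *\<^sub>R \<phi> (cis t))"
      by (rule poisson_set_integrable[OF z1 countable_cis_vimage[OF disc], where M = M])
        (use M continuous_circle_function in auto)
    have "f z $ j = poisson_integral \<phi> z $ j" for j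
    proof -
      obtain F where F: "F holomorphic_on ball 0 1" "\<And>w. w \<in> ball 0 1 \<Longrightarrow> Re (F w) = f w $ j"
        using harmonic_on_Re_holomorphic[OF harmonic convex_ball] by blast
      have bnd: "\<bar>Re (F w)\<bar> \<le> M'" if "w \<in> ball 0 1" for w
      proof -
        have "f w \<in> \<Sigma>" using image_disc_subset that by blast
        then show ?thesis using M' component_le_norm_cart[of "f w" j] F(2)[OF that] by fastforce
      qed
      have lim: "((\<lambda>r. Re (F (of_real r * cis t))) \<longlongrightarrow> \<phi> (cis t) $ j) (at_left 1)" if t: "t \<notin> N" for t
      proof (rule tendstoI)
        fix e :: real assume e: "e > 0"
        from limit_at_cluster_singleton[OF compact_surface image_disc_subset single[OF t] e]
        obtain d where d: "d > 0" "\<And>w. w \<in> ball 0 1 \<Longrightarrow> dist w (cis t) < d \<Longrightarrow> dist (f w) (\<phi> (cis t)) < e"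
          by blast
        have "\<forall>\<^sub>F r in at_left 1. max 0 (1 - d) < r \<and> r < (1::real)"
          using d(1) by (intro eventually_at_leftI[of "max 0 (1 - d)"]) auto
        then show "\<forall>\<^sub>F r in at_left 1. dist (Re (F (of_real r * cis t))) (\<phi> (cis t) $ j) < e"
        proof eventually_elim
          case (elim r)
          have wb: "of_real r * cis t \<in> ball 0 1" using elim by (simp add: norm_mult)
          have "of_real r * cis t - cis t = of_real (r - 1) * cis t" by (simp add: algebra_simps)
          then have "dist (of_real r * cis t) (cis t) = \<bar>r - 1\<bar>" unfolding dist_norm by (simp only: norm_mult norm_cis norm_of_real mult_1_right)
          then have "dist (f (of_real r * cis t)) (\<phi> (cis t)) < e"
            using elim by (intro d(2) wb) auto
          then show ?case
            using dist_vec_nth_le[of "f (of_real r * cis t)" j "\<phi> (cis t)"] F(2)[OF wb] by simp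
        qed
      qed
      have "(LINT t:{0..2 * pi}|lebesgue. ?K t * \<phi> (cis t) $ j) = Re (F z)"
        by (rule poisson_integral_bounded_harmonic(2)[OF F(1) bnd z1 N lim])
      also have "(LINT t:{0..2 * pi}|lebesgue. ?K t * \<phi> (cis t) $ j)
          = (LINT t|lebesgue. (indicator {0..2 * pi} t *\<^sub>R (?K t *\<^sub>R \<phi> (cis t))) $ j)"
        by (simp add: set_lebesgue_integral_def mult.assoc)
      also have "\<dots> = poisson_integral \<phi> z $ j"
        unfolding poisson_integral_def set_lebesgue_integral_def
        by (rule integral_bounded_linear[OF bounded_linear_vec_nth int[unfolded set_integrable_def]])
      finally show ?thesis using F(2)[OF z] by simp
    qed
    then show ?thesis by (simp add: vec_eq_iff)
  qed
  then have "boundary_function \<phi> f \<Gamma>"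
    unfolding boundary_function_def using \<phi>\<Gamma> bv\<phi> disc lims by blast
  then show ?thesis by blast
qed

lemma cluster_set_at_boundary_discontinuity:
  assumes bf: "boundary_function \<phi> f \<Gamma>" and disc: "circle_discontinuity \<phi> (cis s)"
  shows "\<exists>A B. ((\<lambda>t. \<phi> (cis t)) \<longlongrightarrow> A) (at_left s) \<and> ((\<lambda>t. \<phi> (cis t)) \<longlongrightarrow> B) (at_right s) \<and>
    cluster_set f (cis s) = closed_segment A B \<and> closed_segment A B \<subseteq> \<Gamma>"
proof -
  obtain A B where AB: "((\<lambda>t. \<phi> (cis t)) \<longlongrightarrow> A) (at_left s)" "((\<lambda>t. \<phi> (cis t)) \<longlongrightarrow> B) (at_right s)"
    using bf disc unfolding boundary_function_def by blast
  have "cluster_set f (cis s) = closed_segment A B"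
    by (rule cluster_set_at_discontinuity[OF bf AB])
  moreover have "cluster_set f (cis s) \<subseteq> \<Gamma>"
    by (rule cluster_set_subset_boundary) simp
  ultimately show ?thesis using AB by metis
qed

text \<open>At a discontinuity of \<open>\<phi>\<close> the cluster set is a segment in \<open>\<Gamma>\<close>, hence a point; at a point of
continuity the two one-sided limits agree, and the cluster set is again a point.\<close>

lemma continuous_extension_without_segments:
  assumes rect: "rectifiable_jordan_curve \<Gamma>"
    and no_seg: "\<And>a b. a \<noteq> b \<Longrightarrow> \<not> closed_segment a b \<subseteq> \<Gamma>"
  shows "\<exists>F. continuous_on (cball 0 1) F \<and> (\<forall>z\<in>ball 0 1. F z = f z)"
proof -
  obtain \<phi> where bf: "boundary_function \<phi> f \<Gamma>" using boundary_function_exists[OF rect] by blast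
  have single: "\<exists>p. cluster_set f z = {p}" if z: "z \<in> sphere 0 1" for z
  proof -
    have "z = cis (Arg z)" using z rcis_cmod_Arg[of z] by (simp add: rcis_def)
    then obtain s where s: "z = cis s" by blast
    show ?thesis
    proof (cases "circle_discontinuity \<phi> (cis s)")
      case True
      then obtain A B where "cluster_set f (cis s) = closed_segment A B" "closed_segment A B \<subseteq> \<Gamma>"
        using cluster_set_at_boundary_discontinuity[OF bf] by blast
      moreover from this(2) have "A = B" using no_seg by blast
      ultimately show ?thesis using s by simp
    next
      case False
      have "continuous (at s) (\<lambda>t. \<phi> (cis t))" by (rule continuous_circle_function[OF False])
      then have "((\<lambda>t. \<phi> (cis t)) \<longlongrightarrow> \<phi> (cis s)) (at s)" by (simp add: continuous_at)
      then have "((\<lambda>t. \<phi> (cis t)) \<longlongrightarrow> \<phi> (cis s)) (at_left s)" "((\<lambda>t. \<phi> (cis t)) \<longlongrightarrow> \<phi> (cis s)) (at_right s)"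
        by (simp_all add: filterlim_split_at_real filterlim_at_split)
      from cluster_set_at_discontinuity[OF bf this] show ?thesis using s by simp
    qed
  qed
  then obtain \<psi> where \<psi>: "\<And>z. z \<in> sphere 0 1 \<Longrightarrow> cluster_set f z = {\<psi> z}" by metis
  define F where "F = (\<lambda>z. if z \<in> ball 0 1 then f z else \<psi> z)"
  have "continuous (at z within cball 0 1) F" if z: "z \<in> cball 0 1" for z
  proof (cases "z \<in> ball 0 1")
    case True
    have "continuous_on (ball 0 1) F"
      using continuous_disc by (rule continuous_on_eq) (simp add: F_def)
    then have "isCont F z" using True by (simp add: continuous_on_eq_continuous_at del: mem_ball_0 mem_ball)
    then show ?thesis by (rule continuous_at_imp_continuous_at_within)
  next
    case False
    then have zs: "z \<in> sphere 0 1" using z by auto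
    show ?thesis
      unfolding continuous_within_eps_delta
    proof (intro allI impI)
      fix e :: real assume e: "e > 0"
      then have "e / 2 > 0" by simp
      from limit_at_cluster_singleton[OF compact_surface image_disc_subset \<psi>[OF zs] this]
      obtain d where d: "d > 0" "\<And>w. w \<in> ball 0 1 \<Longrightarrow> dist w z < d \<Longrightarrow> dist (f w) (\<psi> z) < e / 2"
        "\<And>z' \<alpha>. dist z' z < d \<Longrightarrow> \<alpha> \<in> cluster_set f z' \<Longrightarrow> dist \<alpha> (\<psi> z) \<le> e / 2" by blast
      have "dist (F w) (F z) < e" if w: "w \<in> cball 0 1" "dist w z < d" for w
      proof (cases "w \<in> ball 0 1")
        case True
        then show ?thesis using d(2)[OF True w(2)] False e by (simp add: F_def)
      next
        case wF: False
        then have "w \<in> sphere 0 1" using w by auto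
        then have "\<psi> w \<in> cluster_set f w" using \<psi> by blast
        then show ?thesis using d(3)[OF w(2)] wF False e by (fastforce simp: F_def)
      qed
      then show "\<exists>d>0. \<forall>w\<in>cball 0 1. dist w z < d \<longrightarrow> dist (F w) (F z) < e"
        using d(1) by blast
    qed
  qed
  then have "continuous_on (cball 0 1) F"
    by (simp add: continuous_on_eq_continuous_within)
  then show ?thesis by (intro exI[of _ F]) (simp add: F_def)
qed

end

theorem theorem2p6:
  fixes \<Phi> f :: "complex \<Rightarrow> real ^ 'n" and \<Sigma> \<Gamma> :: "(real ^ 'n) set"
  assumes "jordan_surface_param \<Phi> \<Sigma>"
    and "\<Gamma> = \<Phi> ` sphere 0 1"
    and "rectifiable_jordan_curve \<Gamma>"
    and "\<forall>j. harmonic_on (\<lambda>z. f z $ j) (ball 0 1)"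
    and "\<exists>g. homeomorphism (ball 0 1) (\<Sigma> - \<Gamma>) f g"
  shows "(\<exists>\<phi>. boundary_function \<phi> f \<Gamma>) \<and>
    ((\<forall>a b. a \<noteq> b \<longrightarrow> \<not> closed_segment a b \<subseteq> \<Gamma>) \<longrightarrow>
      (\<exists>F. continuous_on (cball 0 1) F \<and> (\<forall>z\<in>ball 0 1. F z = f z))) \<and>
    (\<forall>\<phi>. boundary_function \<phi> f \<Gamma> \<longrightarrow>
      (\<forall>s. circle_discontinuity \<phi> (cis s) \<longrightarrow>
        (\<exists>A\<^sub>0 B\<^sub>0. ((\<lambda>t. \<phi> (cis t)) \<longlongrightarrow> A\<^sub>0) (at_left s) \<and>
          ((\<lambda>t. \<phi> (cis t)) \<longlongrightarrow> B\<^sub>0) (at_right s) \<and>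
          cluster_set f (cis s) = closed_segment A\<^sub>0 B\<^sub>0 \<and>
          closed_segment A\<^sub>0 B\<^sub>0 \<subseteq> \<Gamma>)))"
proof -
  obtain \<Psi> where \<Psi>: "homeomorphism (cball 0 1) \<Sigma> \<Phi> \<Psi>"
    using assms(1) unfolding jordan_surface_param_def by blast
  obtain g where g: "homeomorphism (ball 0 1) (\<Sigma> - \<Gamma>) f g"
    using assms(5) by blast
  interpret harmonic_jordan_surface \<Phi> f \<Sigma> \<Gamma> \<Psi> g
    using \<Psi> assms(2,4) g by unfold_locales auto
  show ?thesis
    using boundary_function_exists[OF assms(3)] continuous_extension_without_segments[OF assms(3)]
      cluster_set_at_boundary_discontinuity by blast
qed

end
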